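(* Let $(\Omega,\mathcal{F},\mathbb{P})$ be a probability space, $T>0$, $m,d\in\mathbb{N}^*$, $(\beta_t)_{t\in[0,T]}$ an $m$-dimensional Brownian motion and $Y$ an $\mathbb{R}^d$-valued random vector independent of $(\beta_t)_{t\in[0,T]}$. Let $(X_t)_{t\in[0,T]}$ be the $\mathbb{R}^d$-valued solution to the Itô stochastic differential equation $$dX_t=\sigma(t,X_t)\,d\beta_t+b(t,X_t)\,dt,\qquad X_0=Y,$$ where $b:[0,T]\times\mathbb{R}^d\to\mathbb{R}^d$ is $\mathcal{C}^3$ and $\sigma:[0,T]\times\mathbb{R}^d\to\mathbb{R}^{d\times m}$ is $\mathcal{C}^4$, both with linear growth, and assume the uniform ellipticity condition: there exists $\lambda>0$ such that $\xi\,\sigma(t,x)\sigma(t,x)^\top\xi^\top\ge\lambda\|\xi\|^2$ for all $t\in[0,T]$, all $x\in\mathbb{R}^d$ and all row vectors $\xi\in\mathbb{R}^d$. Let $N\in\mathbb{N}^*$, let $B\subset\mathcal{W}_{\le N}$ be a basis of words for $\mathcal{W}_N$, and let $(D_n=\{0=t_0<\dots<t_n=T\})_{n\in\mathbb{N}^*}$ be a sequence of dissections of $[0,T]$ (the points $t_k$ depending on $n$) such that $|D_n|:=\sup_{0\le k\le n-1}|t_{k+1}-t_k|\to0$ as $n\to\infty$. Let $X^{(n)}$ be the piecewise affine interpolation of $X$ on $D_n$ and let $\widehat{\mathbb{X}^{(n)}}$ be the signature of the time-augmented path $(t,X^{(n)}_t)_{t\le T}$. Then there exists $n_0\in\mathbb{N}$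 such that for all $n\ge n_0$, the family of random variables $\big(\widehat{\mathbb{X}^{(n)}}^{w}_T\big)_{w\in B}$ is a basis of $\mathrm{Span}\big(\widehat{\mathbb{X}^{(n)}}^{w}_T\mid w\in\mathcal{W}_{\le N}\big)$.
   Context: $\mathbb{N}=\{0,1,2,\dots\}$, $\mathbb{N}^*=\mathbb{N}\setminus\{0\}$. The alphabet is $\mathcal{A}=\{0,1,\dots,d\}$. $\mathcal{W}_N$ is the set of words of length $N$ over $\mathcal{A}$ (with $\mathcal{W}_0=\{\epsilon\}$, $\epsilon$ the empty word), $\mathcal{W}_{\le N}=\bigsqcup_{k=0}^N\mathcal{W}_k$; $\|w\|$ is the length of a word $w$; $0_k$ is the word made of $k$ letters $0$ ($0_0=\epsilon$). For a set $C$ of words, $\mathrm{Span}(C)$ is the real vector space of formal finite linear combinations of elements of $C$. Concatenation of words is extended bilinearly. The shuffle product $\sqcup\!\sqcup$ is defined inductively by $w\sqcup\!\sqcup\epsilon=\epsilon\sqcup\!\sqcup w=w$ and $(wi)\sqcup\!\sqcup(vj)=(w\sqcup\!\sqcup(vj))i+((wi)\sqcup\!\sqcup v)j$ for words $w,v$ and letters $i,j$, and extended bilinearly. A subset $B\subset\mathcal{W}_{\le N}$ is a basis of words for $\mathcal{W}_N$ if the family $(w\sqcup\!\sqcup 0_{N-\|w\|})_{w\in B}$ is a basis of $\mathrm{Span}(\mathcal{W}_N)$. Piecewise affine interpolation: $X^{(n)}$ is continuous, equals $X$ at every point of $D_n$ and is affine on each $[t_k,t_{k+1}]$. Time-augmented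 signature of a continuous finite-variation path $x=(x^1,\dots,x^d)$ on $[0,T]$: put $\widehat x^0_t=t$, $\widehat x^i_t=x^i_t$ for $i\ge1$; then the component of the empty word is $1$ and the component of the word $wi$ at time $t$ is $\int_0^t(\text{component of } w\text{ at time } s)\,d\widehat x^i_s$ (Riemann–Stieltjes integral). It is applied pathwise to $X^{(n)}$. For a set $C$ of words, $\mathrm{Span}\big(\widehat{\mathbb{X}^{(n)}}^{w}_T\mid w\in C\big)$ is the real linear span of these random variables, identified when almost surely equal; bases are understood for almost-sure equality. *)

theory Defs
  imports "HOL-Probability.Probability" "HOL-Analysis.Finite_Function_Topology"
begin

section \<open>Words and the shuffle product\<close>

text \<open>
  The alphabet \<open>{0,1,\<dots>,d}\<close> is \<^typ>\<open>'d::finite option\<close> with \<open>d = CARD('d)\<close>: the letter \<open>0\<close> is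
  \<^const>\<open>None\<close>, the letters \<open>1,\<dots>,d\<close> are \<open>Some i\<close>. A formal linear combination of words is a
  \<^typ>\<open>'d option list \<Rightarrow>\<^sub>0 real\<close>.
\<close>

type_synonym 'd word = "'d option list"

definition words :: "nat \<Rightarrow> 'd word set" where
  "words N = {w. length w = N}"

definition words_le :: "nat \<Rightarrow> 'd word set" where
  "words_le N = (\<Union>k\<le>N. words k)"

definition formal :: "'d word \<Rightarrow> ('d word \<Rightarrow>\<^sub>0 real)" where
  "formal w = Poly_Mapping.single w 1"

text \<open>Right concatenation with a letter, extended linearly to formal combinations of words.\<close>

definition append_letter :: "('d word \<Rightarrow>\<^sub>0 real) \<Rightarrow> 'd option \<Rightarrow> ('d word \<Rightarrow>\<^sub>0 real)" where
  "append_letter p i =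
     (\<Sum>u\<in>Poly_Mapping.keys p. Poly_Mapping.lookup p u *\<^sub>R formal (u @ [i]))"

function shuffle_product :: "'d word \<Rightarrow> 'd word \<Rightarrow> ('d word \<Rightarrow>\<^sub>0 real)" where
  "shuffle_product w [] = formal w"
| "shuffle_product [] v = formal v"
| "shuffle_product (w @ [i]) (v @ [j]) =
     append_letter (shuffle_product w (v @ [j])) i + append_letter (shuffle_product (w @ [i]) v) j"
proof -
  fix P and x :: "'d word \<times> 'd word"
  assume *: "\<And>w. x = (w, []) \<Longrightarrow> P" "\<And>v. x = ([], v) \<Longrightarrow> P"
    "\<And>w i v j. x = (w @ [i], v @ [j]) \<Longrightarrow> P"
  obtain w v where x: "x = (w, v)"
    by (cases x)
  show P
    by (cases w rule: rev_cases; cases v rule: rev_cases) (use * x in blast)+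
qed auto
termination
  by (relation "Wellfounded.measure (\<lambda>(w, v). length w + length v)") auto

definition family_basis :: "('i \<Rightarrow> 'v::real_vector) \<Rightarrow> 'i set \<Rightarrow> 'v set \<Rightarrow> bool" where
  "family_basis f I V \<longleftrightarrow> inj_on f I \<and> independent (f ` I) \<and> span (f ` I) = V"

definition basis_of_words :: "nat \<Rightarrow> 'd word set \<Rightarrow> bool" where
  "basis_of_words N B \<longleftrightarrow> B \<subseteq> words_le N \<and>
     family_basis (\<lambda>w. shuffle_product w (replicate (N - length w) None)) B
       (span (formal ` words N))"

section \<open>Signature of the time-augmented path\<close>

text \<open>A Riemann--Stieltjes integral: the gauge \<open>\<lambda>x. ball x \<delta>\<close> is constant, so that only the mesh
  of the tagged division is restricted.\<close>

definition has_rs_integral ::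
    "(real \<Rightarrow> real) \<Rightarrow> (real \<Rightarrow> real) \<Rightarrow> real \<Rightarrow> real \<Rightarrow> real \<Rightarrow> bool" where
  "has_rs_integral f g a b I \<longleftrightarrow>
     (\<forall>\<epsilon>>0. \<exists>\<delta>>0. \<forall>p. p tagged_division_of {a..b} \<and> (\<lambda>x. ball x \<delta>) fine p \<longrightarrow>
        \<bar>(\<Sum>(x, K)\<in>p. f x * (g (Sup K) - g (Inf K))) - I\<bar> < \<epsilon>)"

definition rs_integral :: "(real \<Rightarrow> real) \<Rightarrow> (real \<Rightarrow> real) \<Rightarrow> real \<Rightarrow> real \<Rightarrow> real" where
  "rs_integral f g a b = (THE I. has_rs_integral f g a b I)"

definition time_augmented :: "(real \<Rightarrow> real ^ 'd) \<Rightarrow> 'd option \<Rightarrow> real \<Rightarrow> real" where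
  "time_augmented x i t = (case i of None \<Rightarrow> t | Some j \<Rightarrow> x t $ j)"

function signature :: "(real \<Rightarrow> real ^ 'd) \<Rightarrow> 'd word \<Rightarrow> real \<Rightarrow> real" where
  "signature x [] t = 1"
| "signature x (w @ [i]) t = rs_integral (\<lambda>s. signature x w s) (time_augmented x i) 0 t"
proof -
  fix P and x :: "(real \<Rightarrow> real ^ 'd) \<times> 'd word \<times> real"
  assume *: "\<And>y t. x = (y, [], t) \<Longrightarrow> P" "\<And>y w i t. x = (y, w @ [i], t) \<Longrightarrow> P"
  obtain y w t where x: "x = (y, w, t)"
    by (cases x)
  show P
    by (cases w rule: rev_cases) (use * x in blast)+
qed auto
termination
  by (relation "Wellfounded.measure (\<lambda>(x, w, t). length w)") auto

section \<open>Dissections and piecewise affine interpolation\<close>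

definition dissection :: "real \<Rightarrow> nat \<Rightarrow> (nat \<Rightarrow> real) \<Rightarrow> bool" where
  "dissection T n s \<longleftrightarrow> s 0 = 0 \<and> s n = T \<and> (\<forall>k<n. s k < s (Suc k))"

definition mesh :: "nat \<Rightarrow> (nat \<Rightarrow> real) \<Rightarrow> real" where
  "mesh n s = (SUP k\<in>{..<n}. \<bar>s (Suc k) - s k\<bar>)"

definition piecewise_affine_interpolation ::
    "nat \<Rightarrow> (nat \<Rightarrow> real) \<Rightarrow> (real \<Rightarrow> 'v::real_normed_vector) \<Rightarrow> (real \<Rightarrow> 'v) \<Rightarrow> bool" where
  "piecewise_affine_interpolation n s x y \<longleftrightarrow>
     continuous_on {s 0..s n} y \<and> (\<forall>k\<le>n. y (s k) = x (s k)) \<and>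
     (\<forall>k<n. \<exists>p q. \<forall>t\<in>{s k..s (Suc k)}. y t = p + t *\<^sub>R q)"

section \<open>Functions of class \<open>C\<^sup>k\<close>\<close>

text \<open>Derivatives are taken within \<open>S\<close>, hence one-sided at the end points of the time interval when
  \<open>S = {0..T} \<times> UNIV\<close>.\<close>

primrec Ck_on :: "nat \<Rightarrow> 'a::real_normed_vector set \<Rightarrow> ('a \<Rightarrow> 'b::real_normed_vector) \<Rightarrow> bool" where
  "Ck_on 0 S f \<longleftrightarrow> continuous_on S f"
| "Ck_on (Suc k) S f \<longleftrightarrow>
     (\<exists>f'. (\<forall>x\<in>S. (f has_derivative f' x) (at x within S)) \<and> (\<forall>v. Ck_on k S (\<lambda>x. f' x v)))"

section \<open>Brownian motion and the Ito integral\<close>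

definition brownian_motion :: "'w measure \<Rightarrow> real \<Rightarrow> (real \<Rightarrow> 'w \<Rightarrow> real ^ 'm) \<Rightarrow> bool" where
  "brownian_motion M T \<beta> \<longleftrightarrow>
     (\<forall>t\<in>{0..T}. \<beta> t \<in> borel_measurable M) \<and>
     (AE \<omega> in M. \<beta> 0 \<omega> = 0) \<and>
     (AE \<omega> in M. continuous_on {0..T} (\<lambda>t. \<beta> t \<omega>)) \<and>
     (\<forall>s t j. 0 \<le> s \<and> s < t \<and> t \<le> T \<longrightarrow>
        distributed M lborel (\<lambda>\<omega>. \<beta> t \<omega> $ j - \<beta> s \<omega> $ j) (normal_density 0 (sqrt (t - s)))) \<and>
     (\<forall>k s. 0 \<le> s 0 \<and> (\<forall>i<k. s i < s (Suc i)) \<and> s k \<le> T \<longrightarrow>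
        prob_space.indep_vars M (\<lambda>_. borel)
          (\<lambda>(i, j) \<omega>. \<beta> (s (Suc i)) \<omega> $ j - \<beta> (s i) \<omega> $ j) ({..<k} \<times> UNIV))"

text \<open>The filtration generated by the initial value and the Brownian motion, augmented by the null
  sets. The measure space need not be complete, so only measurable null sets are added.\<close>

definition augmented_filtration ::
    "'w measure \<Rightarrow> (real \<Rightarrow> 'w \<Rightarrow> real ^ 'm) \<Rightarrow> ('w \<Rightarrow> real ^ 'd) \<Rightarrow> real \<Rightarrow> 'w measure" where
  "augmented_filtration M \<beta> Y t = sigma (space M)
     ({Y -` A \<inter> space M | A. A \<in> sets borel} \<union>
      {\<beta> s -` A \<inter> space M | s A. s \<in> {0..t} \<and> A \<in> sets borel} \<union>
      null_sets M)"

text \<open>Convergence in probability to \<open>0\<close>. Passing to measurable supersets makes the notion meaningful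
  for functions that are measurable only up to a null set; for measurable \<open>Z\<close> it is the usual one.\<close>

definition tendsto_zero_in_prob :: "'w measure \<Rightarrow> (nat \<Rightarrow> 'w \<Rightarrow> ennreal) \<Rightarrow> bool" where
  "tendsto_zero_in_prob M Z \<longleftrightarrow>
     (\<forall>\<epsilon>>0. \<exists>A. (\<forall>k. A k \<in> sets M \<and> {\<omega> \<in> space M. \<epsilon> < Z k \<omega>} \<subseteq> A k) \<and>
        (\<lambda>k. measure M (A k)) \<longlonglongrightarrow> 0)"

text \<open>The data \<open>k\<close>, \<open>s\<close>, \<open>\<xi>\<close> encode the simple process
  \<open>\<Sum>i<k. \<xi> i \<cdot> 1\<^bsub>(s i, s (i + 1)]\<^esub>\<close> on \<open>[0, t]\<close>.\<close>

definition simple_process ::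
    "'w measure \<Rightarrow> (real \<Rightarrow> 'w measure) \<Rightarrow> real \<Rightarrow> nat \<Rightarrow> (nat \<Rightarrow> real) \<Rightarrow> (nat \<Rightarrow> 'w \<Rightarrow> real) \<Rightarrow> bool"
  where
  "simple_process M F t k s \<xi> \<longleftrightarrow>
     0 \<le> s 0 \<and> s k \<le> t \<and>
     (\<forall>i<k. s i < s (Suc i) \<and> \<xi> i \<in> borel_measurable (F (s i)) \<and>
        (\<exists>C. \<forall>\<omega>\<in>space M. \<bar>\<xi> i \<omega>\<bar> \<le> C))"

definition simple_value ::
    "nat \<Rightarrow> (nat \<Rightarrow> real) \<Rightarrow> (nat \<Rightarrow> 'w \<Rightarrow> real) \<Rightarrow> real \<Rightarrow> 'w \<Rightarrow> real" where
  "simple_value k s \<xi> u \<omega> = (\<Sum>i<k. \<xi> i \<omega> * indicator {s i<..s (Suc i)} u)"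

definition simple_integral ::
    "(real \<Rightarrow> 'w \<Rightarrow> real) \<Rightarrow> nat \<Rightarrow> (nat \<Rightarrow> real) \<Rightarrow> (nat \<Rightarrow> 'w \<Rightarrow> real) \<Rightarrow> 'w \<Rightarrow> real" where
  "simple_integral W k s \<xi> \<omega> = (\<Sum>i<k. \<xi> i \<omega> * (W (s (Suc i)) \<omega> - W (s i) \<omega>))"

text \<open>\<open>has_ito_integral M F W t H Z\<close>: the random variable \<open>Z\<close> is the Ito integral of \<open>H\<close> over
  \<open>[0, t]\<close> against the real Brownian motion \<open>W\<close>, that is, the limit in probability of the integrals
  of simple processes approximating \<open>H\<close> in \<open>L\<^sup>2([0, t])\<close>, in probability. It is unique up to
  almost-sure equality.\<close>

definition has_ito_integral ::
    "'w measure \<Rightarrow> (real \<Rightarrow> 'w measure) \<Rightarrow> (real \<Rightarrow> 'w \<Rightarrow> real) \<Rightarrow> real \<Rightarrow>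
     (real \<Rightarrow> 'w \<Rightarrow> real) \<Rightarrow> ('w \<Rightarrow> real) \<Rightarrow> bool" where
  "has_ito_integral M F W t H Z \<longleftrightarrow>
     Z \<in> borel_measurable M \<and>
     (\<exists>k s \<xi>. (\<forall>l. simple_process M F t (k l) (s l) (\<xi> l)) \<and>
        tendsto_zero_in_prob M
          (\<lambda>l \<omega>. \<integral>\<^sup>+u\<in>{0..t}. ennreal ((H u \<omega> - simple_value (k l) (s l) (\<xi> l) u \<omega>)\<^sup>2) \<partial>lborel) \<and>
        tendsto_zero_in_prob M
          (\<lambda>l \<omega>. ennreal \<bar>Z \<omega> - simple_integral W (k l) (s l) (\<xi> l) \<omega>\<bar>))"

text \<open>Strong solutions of \<open>dX\<^sub>t = \<sigma>(t, X\<^sub>t) d\<beta>\<^sub>t + b(t, X\<^sub>t) dt\<close>, \<open>X\<^sub>0 = Y\<close>.\<close>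

definition sde_solution ::
    "'w measure \<Rightarrow> real \<Rightarrow> (real \<Rightarrow> 'w \<Rightarrow> real ^ 'm) \<Rightarrow> ('w \<Rightarrow> real ^ 'd) \<Rightarrow>
     (real \<Rightarrow> real ^ 'd \<Rightarrow> real ^ 'm ^ 'd) \<Rightarrow> (real \<Rightarrow> real ^ 'd \<Rightarrow> real ^ 'd) \<Rightarrow>
     (real \<Rightarrow> 'w \<Rightarrow> real ^ 'd) \<Rightarrow> bool" where
  "sde_solution M T \<beta> Y \<sigma> b X \<longleftrightarrow>
     (\<forall>t\<in>{0..T}. X t \<in> borel_measurable (augmented_filtration M \<beta> Y t)) \<and>
     (AE \<omega> in M. continuous_on {0..T} (\<lambda>t. X t \<omega>)) \<and>
     (AE \<omega> in M. X 0 \<omega> = Y \<omega>) \<and>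
     (\<forall>t\<in>{0..T}. \<exists>Z.
        (\<forall>i j. has_ito_integral M (augmented_filtration M \<beta> Y) (\<lambda>s \<omega>. \<beta> s \<omega> $ j) t
           (\<lambda>s \<omega>. \<sigma> s (X s \<omega>) $ i $ j) (Z i j)) \<and>
        (\<forall>i. AE \<omega> in M. X t \<omega> $ i =
           Y \<omega> $ i + (\<Sum>j\<in>UNIV. Z i j \<omega>) + (LBINT s:{0..t}. b s (X s \<omega>) $ i)))"

section \<open>Spans and bases up to almost-sure equality\<close>

text \<open>Classes of almost surely equal random variables are represented by their unions: a subspace of
  the quotient is a set of random variables closed under almost-sure equality.\<close>

definition ae_span :: "'w measure \<Rightarrow> ('i \<Rightarrow> 'w \<Rightarrow> real) \<Rightarrow> 'i set \<Rightarrow> ('w \<Rightarrow> real) set" where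
  "ae_span M F I = {Z \<in> borel_measurable M.
     \<exists>S c. finite S \<and> S \<subseteq> I \<and> (AE \<omega> in M. Z \<omega> = (\<Sum>i\<in>S. c i * F i \<omega>))}"

definition ae_independent :: "'w measure \<Rightarrow> ('i \<Rightarrow> 'w \<Rightarrow> real) \<Rightarrow> 'i set \<Rightarrow> bool" where
  "ae_independent M F I \<longleftrightarrow>
     (\<forall>S c. finite S \<and> S \<subseteq> I \<and> (AE \<omega> in M. (\<Sum>i\<in>S. c i * F i \<omega>) = 0) \<longrightarrow> (\<forall>i\<in>S. c i = 0))"

definition ae_basis ::
    "'w measure \<Rightarrow> ('i \<Rightarrow> 'w \<Rightarrow> real) \<Rightarrow> 'i set \<Rightarrow> ('w \<Rightarrow> real) set \<Rightarrow> bool" where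
  "ae_basis M F I V \<longleftrightarrow>
     (\<forall>i\<in>I. F i \<in> V) \<and> ae_independent M F I \<and> ae_span M F I = V"

end

theory Submission
  imports Defs
begin

text \<open>
  The letter \<open>0\<close> integrates time, and the shuffle product linearises products of signature components;
  so \<open>T\<^sup>k / k!\<close> times the component of a word \<open>w\<close> of length \<open>N - k\<close> is the linear extension of the
  signature to \<open>w\<close> shuffled with \<open>k\<close> zeros. All components of level at most \<open>N\<close> are therefore linear
  combinations of those of level exactly \<open>N\<close>, and a basis of words yields a basis of their span as
  soon as no linear relation between the components of level \<open>N\<close> holds almost surely. The words of
  length at most \<open>N\<close> that do not end in \<open>0\<close> are as many as the words of length \<open>N\<close> (pad them with
  zeros), so that by a dimension count it suffices to prove independence for these words
  (\<open>signature_basis\<close>); functionals on them do not see a stretch of pure time at the end of the path.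

  The first half of the independence is probabilistic. A polynomial in the increment \<open>X\<^sub>t - X\<^sub>r\<close> whose
  random coefficients are known at time \<open>r\<close> vanishes almost surely only if all its coefficients do
  (\<open>increment_polynomial_relation_trivial\<close>). Seen from a time \<open>s\<close> shortly before \<open>t\<close>, the increment
  \<open>X\<^sub>t - X\<^sub>s\<close> is \<open>\<surd>(t - s)\<close> times \<open>\<sigma>(s, X\<^sub>s) G\<close>, where \<open>G\<close> is a standard Gaussian vector independent of
  the past up to \<open>s\<close>, up to an error of smaller order in probability (\<open>euler_error_tendsto_zero\<close>).
  Recentred at \<open>X\<^sub>s\<close>, rescaled by \<open>\<surd>(t - s)\<close> and normalised, the polynomial stays in a compact set of
  nonzero polynomials. By ellipticity \<open>\<sigma>(s, X\<^sub>s)\<close> is onto, so the Gaussian mean of the absolute value of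
  such a polynomial, cut off outside the unit ball, is bounded away from zero
  (\<open>gauss_mean_bounded_below\<close>), whereas it would have to tend to zero as \<open>s\<close> tends to \<open>t\<close>.
  Letting \<open>s\<close> tend to \<open>t\<close>, instead of \<open>t\<close> to \<open>r\<close>, gives the result for every interval, however long.

  The second half is combinatorial. Write \<open>c\<cdot>v\<close> for the functional \<open>u \<mapsto> c (u v)\<close> on words. By Chen's
  relation, the signature at the end \<open>t\<^bsub>k+1\<^esub>\<close> of an affine piece is a polynomial in the increment of
  \<open>X\<close> over that piece, with coefficients known at its beginning \<open>t\<^sub>k\<close>. If a functional \<open>c\<close> annihilates
  the signature at \<open>t\<^bsub>k+1\<^esub>\<close>, then the coefficients of degree zero and one give functionals that
  annihilate it at \<open>t\<^sub>k\<close>: one in which only time runs over the piece, and one for each letter \<open>i \<noteq> 0\<close>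
  read on that piece. Running backwards from \<open>t\<^sub>j\<close> to \<open>t\<^sub>l\<close>, the letter \<open>i\<close> may be read on any of the
  \<open>j - l\<close> pieces in between. The relations so obtained say that a polynomial of degree at most \<open>N + 1\<close>,
  whose coefficients are, up to factorials, the pairings with \<open>c\<cdot>(0\<^sup>m i 0\<^sup>a)\<close>, vanishes at the \<open>j - l + 1\<close> points
  \<open>t\<^sub>k - t\<^sub>l\<close>; if \<open>j - l > N\<close>, all these pairings vanish at \<open>t\<^sub>l\<close> (\<open>null_after_letter\<close>). Stripping a word
  of its letters in this way, at a price of \<open>N + 1\<close> pieces each, leads to time \<open>0\<close>, where the pairing
  with \<open>c\<cdot>w\<close> is the number \<open>c w\<close>. Hence \<open>n\<^sub>0 = N (N + 1)\<close> is a possible choice.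
\<close>

section \<open>Polynomials in several variables\<close>

text \<open>By induction on the set of variables: once the other variables are fixed, the relation is a polynomial
in one variable with infinitely many roots.\<close>

lemma monomials_independent_on_cube:
  fixes c :: "('i \<Rightarrow> nat) \<Rightarrow> real" and e :: real
  assumes "finite S" and e: "0 < e"
    and "\<And>x. (\<And>i. \<bar>x i\<bar> < e) \<Longrightarrow>
      (\<Sum>\<alpha>\<in>Pi\<^sub>E S (\<lambda>_. {..N}). c \<alpha> * (\<Prod>i\<in>S. x i ^ \<alpha> i)) = 0"
    and "\<alpha> \<in> Pi\<^sub>E S (\<lambda>_. {..N})"
  shows "c \<alpha> = 0"
  using assms(1,3,4)
proof (induction S arbitrary: c \<alpha> rule: finite_induct)
  case empty
  then show ?case using e empty(1)[of "\<lambda>_. 0"] by simp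
next
  case (insert j S)
  have split: "(\<Sum>\<alpha>\<in>Pi\<^sub>E (insert j S) (\<lambda>_. {..N}). c \<alpha> * (\<Prod>i\<in>insert j S. x i ^ \<alpha> i)) =
      (\<Sum>k\<le>N. (\<Sum>\<beta>\<in>Pi\<^sub>E S (\<lambda>_. {..N}). c (\<beta>(j := k)) * (\<Prod>i\<in>S. x i ^ \<beta> i)) * x j ^ k)" for x
  proof -
    have inj: "inj_on (\<lambda>(y, g). g(j := y)) ({..N} \<times> Pi\<^sub>E S (\<lambda>_. {..N}))"
      using insert.hyps inj_combinator[of j S "\<lambda>_. {..N}"] by simp
    have prd: "(\<Prod>i\<in>insert j S. x i ^ (\<beta>(j := k)) i) = x j ^ k * (\<Prod>i\<in>S. x i ^ \<beta> i)" for \<beta> k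
    proof -
      have "(\<Prod>i\<in>S. x i ^ (\<beta>(j := k)) i) = (\<Prod>i\<in>S. x i ^ \<beta> i)"
        by (rule prod.cong) (use insert.hyps in auto)
      then show ?thesis using insert.hyps by (simp del: fun_upd_apply) simp
    qed
    show ?thesis
      unfolding PiE_insert_eq
      apply (subst sum.reindex[OF inj])
      apply (simp only: o_def case_prod_unfold prd sum_distrib_right sum.cartesian_product fst_conv snd_conv)
      apply (simp add: mult_ac)
      done
  qed
  obtain k \<beta> where \<alpha>: "\<alpha> = \<beta>(j := k)" "k \<le> N" "\<beta> \<in> Pi\<^sub>E S (\<lambda>_. {..N})"
    using insert.prems(2) unfolding PiE_insert_eq by auto
  have "c (\<beta>'(j := k')) = 0" if k': "k' \<le> N" and \<beta>': "\<beta>' \<in> Pi\<^sub>E S (\<lambda>_. {..N})" for k' \<beta>'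
  proof (rule insert.IH[where c = "\<lambda>\<beta>. c (\<beta>(j := k'))", OF _ \<beta>'])
    fix x :: "'i \<Rightarrow> real" assume x: "\<And>i. \<bar>x i\<bar> < e"
    define a where "a k = (\<Sum>\<beta>\<in>Pi\<^sub>E S (\<lambda>_. {..N}). c (\<beta>(j := k)) * (\<Prod>i\<in>S. x i ^ \<beta> i))" for k
    have z: "(\<Sum>k\<le>N. a k * t ^ k) = 0" if t: "\<bar>t\<bar> < e" for t
    proof -
      have "(\<Sum>\<beta>\<in>Pi\<^sub>E S (\<lambda>_. {..N}). c (\<beta>(j := k)) * (\<Prod>i\<in>S. (x(j:=t)) i ^ \<beta> i)) = a k" for k
        unfolding a_def using insert.hyps by (intro sum.cong prod.cong arg_cong2[of _ _ _ _ "(*)"]) auto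
      then show ?thesis
        using insert.prems(1)[of "x(j := t)"] x t unfolding split by auto
    qed
    show "(\<Sum>\<beta>\<in>Pi\<^sub>E S (\<lambda>_. {..N}). c (\<beta>(j := k')) * (\<Prod>i\<in>S. x i ^ \<beta> i)) = 0"
    proof (rule ccontr)
      assume "\<not> ?thesis"
      then have "a k' \<noteq> 0" by (simp add: a_def)
      then have "finite {z. (\<Sum>k\<le>N. a k * z ^ k) = 0}"
        using polyfun_finite_roots[of a N] k' by auto
      moreover have "{0<..<e} \<subseteq> {z. (\<Sum>k\<le>N. a k * z ^ k) = 0}" using z by auto
      ultimately show False using e infinite_Ioo[of 0 e] finite_subset by blast
    qed
  qed
  with \<alpha> show ?case by blast
qed

definition exps :: "nat \<Rightarrow> ('d::finite \<Rightarrow> nat) set" where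
  "exps N = {\<alpha>. \<forall>i. \<alpha> i \<le> N}"

definition monomial :: "('d::finite \<Rightarrow> nat) \<Rightarrow> real ^ 'd \<Rightarrow> real" where
  "monomial \<alpha> x = (\<Prod>i\<in>UNIV. x $ i ^ \<alpha> i)"

definition poly_eval :: "nat \<Rightarrow> (('d::finite \<Rightarrow> nat) \<Rightarrow> real) \<Rightarrow> real ^ 'd \<Rightarrow> real" where
  "poly_eval N c x = (\<Sum>\<alpha>\<in>exps N. c \<alpha> * monomial \<alpha> x)"

text \<open>The coefficients of the polynomial \<open>x \<mapsto> p (a + \<rho> x)\<close>, where \<open>p\<close> has the coefficients \<open>c\<close>.\<close>

definition recenter ::
    "nat \<Rightarrow> real ^ 'd \<Rightarrow> real \<Rightarrow> (('d::finite \<Rightarrow> nat) \<Rightarrow> real) \<Rightarrow> ('d \<Rightarrow> nat) \<Rightarrow> real" where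
  "recenter N a \<rho> c \<beta> = (if \<beta> \<in> exps N then
     \<Sum>\<alpha>\<in>exps N. c \<alpha> * (\<Prod>i\<in>UNIV. of_nat (\<alpha> i choose \<beta> i) * (a $ i) ^ (\<alpha> i - \<beta> i) * \<rho> ^ \<beta> i)
     else 0)"

lemma exps_eq_PiE: "exps N = Pi\<^sub>E UNIV (\<lambda>_. {..N})"
  by (auto simp: exps_def PiE_UNIV_domain)

lemma finite_exps [simp]: "finite (exps N)"
  unfolding exps_eq_PiE by (intro finite_PiE) auto

lemma poly_eval_zero_imp:
  assumes "0 < e" and "\<And>x :: real ^ 'd::finite. norm x < e \<Longrightarrow> poly_eval N c x = 0"
    and "\<alpha> \<in> exps N"
  shows "c \<alpha> = 0"
proof -
  define e' where "e' = e / (real CARD('d) + 1)"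
  have e': "e' > 0" "real CARD('d) * e' < e" using assms(1)
    by (auto simp: e'_def field_simps)
  show ?thesis
  proof (rule monomials_independent_on_cube[where S = UNIV and e = e' and N = N and c = c])
    fix x :: "'d \<Rightarrow> real" assume x: "\<And>i. \<bar>x i\<bar> < e'"
    have "norm (\<chi> i. x i) \<le> (\<Sum>i\<in>UNIV. \<bar>x i\<bar>)" using norm_le_l1_cart[of "\<chi> i. x i"] by simp
    also have "\<dots> \<le> (\<Sum>i\<in>(UNIV::'d set). e')" by (intro sum_mono) (use x less_imp_le in auto)
    also have "\<dots> < e" using e' by simp
    finally show "(\<Sum>\<alpha>\<in>Pi\<^sub>E UNIV (\<lambda>_. {..N}). c \<alpha> * (\<Prod>i\<in>UNIV. x i ^ \<alpha> i)) = 0"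
      using assms(2)[of "\<chi> i. x i"] by (simp add: poly_eval_def monomial_def exps_eq_PiE)
  qed (use e' assms(3) in \<open>auto simp: exps_eq_PiE\<close>)
qed

lemma poly_eval_recenter:
  "poly_eval N c (a + \<rho> *\<^sub>R x) = poly_eval N (recenter N a \<rho> c) x"
proof -
  have "monomial \<alpha> (a + \<rho> *\<^sub>R x) = (\<Sum>\<beta>\<in>exps N.
      (\<Prod>i\<in>UNIV. of_nat (\<alpha> i choose \<beta> i) * (a $ i) ^ (\<alpha> i - \<beta> i) * \<rho> ^ \<beta> i) * monomial \<beta> x)"
    if \<alpha>: "\<alpha> \<in> exps N" for \<alpha>
  proof -
    have "((a + \<rho> *\<^sub>R x) $ i) ^ \<alpha> i =
        (\<Sum>k\<le>N. of_nat (\<alpha> i choose k) * (a $ i) ^ (\<alpha> i - k) * \<rho> ^ k * (x $ i) ^ k)" for i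
    proof -
      have "((a + \<rho> *\<^sub>R x) $ i) ^ \<alpha> i = (\<rho> * x $ i + a $ i) ^ \<alpha> i" by (simp add: add.commute)
      also have "\<dots> = (\<Sum>k\<le>\<alpha> i. of_nat (\<alpha> i choose k) * (\<rho> * x $ i) ^ k * (a $ i) ^ (\<alpha> i - k))"
        by (rule binomial_ring)
      also have "\<dots> = (\<Sum>k\<le>N. of_nat (\<alpha> i choose k) * (\<rho> * x $ i) ^ k * (a $ i) ^ (\<alpha> i - k))"
        by (rule sum.mono_neutral_left) (use \<alpha> in \<open>auto simp: exps_def\<close>)
      finally show ?thesis by (simp add: power_mult_distrib mult_ac)
    qed
    then have "monomial \<alpha> (a + \<rho> *\<^sub>R x) = (\<Prod>i\<in>UNIV.
        \<Sum>k\<le>N. of_nat (\<alpha> i choose k) * (a $ i) ^ (\<alpha> i - k) * \<rho> ^ k * (x $ i) ^ k)"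
      unfolding monomial_def by presburger
    also have "\<dots> = (\<Sum>\<beta>\<in>exps N. \<Prod>i\<in>UNIV.
        of_nat (\<alpha> i choose \<beta> i) * (a $ i) ^ (\<alpha> i - \<beta> i) * \<rho> ^ \<beta> i * (x $ i) ^ \<beta> i)"
      unfolding exps_eq_PiE by (rule prod_sum_PiE) auto
    finally show ?thesis by (simp add: monomial_def prod.distrib)
  qed
  then have "poly_eval N c (a + \<rho> *\<^sub>R x) = (\<Sum>\<alpha>\<in>exps N. \<Sum>\<beta>\<in>exps N. c \<alpha> *
      (\<Prod>i\<in>UNIV. of_nat (\<alpha> i choose \<beta> i) * (a $ i) ^ (\<alpha> i - \<beta> i) * \<rho> ^ \<beta> i) * monomial \<beta> x)"
    unfolding poly_eval_def by (intro sum.cong) (simp_all add: sum_distrib_left mult_ac)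
  also have "\<dots> = (\<Sum>\<beta>\<in>exps N. recenter N a \<rho> c \<beta> * monomial \<beta> x)"
    by (subst sum.swap) (auto simp: recenter_def sum_distrib_right intro!: sum.cong)
  finally show ?thesis by (simp add: poly_eval_def)
qed

lemma recenter_nonzero:
  assumes "\<rho> \<noteq> 0" and "\<alpha> \<in> exps N" and "c \<alpha> \<noteq> 0"
  shows "\<exists>\<beta>\<in>exps N. recenter N a \<rho> c \<beta> \<noteq> 0"
proof (rule ccontr)
  assume "\<not> ?thesis"
  then have z: "poly_eval N (recenter N a \<rho> c) x = 0" for x by (simp add: poly_eval_def)
  have "poly_eval N c x = 0" for x
  proof -
    have "x = a + \<rho> *\<^sub>R (inverse \<rho> *\<^sub>R (x - a))" using assms(1) by simp
    then show ?thesis using poly_eval_recenter[of N c a \<rho> "inverse \<rho> *\<^sub>R (x - a)"] z by simp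
  qed
  then show False using poly_eval_zero_imp[of 1 N c \<alpha>] assms by auto
qed

text \<open>Coefficient families are functions on all exponents, zero outside the admissible ones, so that the
product topology makes the sphere compact and its Borel sets are generated by the coordinates.\<close>

definition poly_sphere :: "nat \<Rightarrow> (('d::finite \<Rightarrow> nat) \<Rightarrow> real) set" where
  "poly_sphere N = {c. (\<forall>\<alpha>. \<alpha> \<notin> exps N \<longrightarrow> c \<alpha> = 0) \<and> (\<Sum>\<alpha>\<in>exps N. \<bar>c \<alpha>\<bar>) = 1}"

lemma continuous_on_coordinate:
  "continuous_on S f \<Longrightarrow> continuous_on S (\<lambda>x. f x i)"
  by (rule continuous_on_compose2[OF continuous_on_product_coordinates[of i]]) auto

lemma compact_poly_sphere: "compact (poly_sphere N :: (('d::finite \<Rightarrow> nat) \<Rightarrow> real) set)"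
proof -
  have "compactin (product_topology (\<lambda>_. euclidean) UNIV)
      (Pi\<^sub>E UNIV (\<lambda>_. {-1..1}) :: (('d \<Rightarrow> nat) \<Rightarrow> real) set)"
    unfolding compactin_PiE by (auto simp: compactin_euclidean_iff)
  then have c: "compact (Pi\<^sub>E UNIV (\<lambda>_. {-1..1}) :: (('d \<Rightarrow> nat) \<Rightarrow> real) set)"
    by (simp add: euclidean_product_topology compactin_euclidean_iff)
  have eq: "poly_sphere N = (\<Inter>\<alpha>\<in>-exps N. {c. c \<alpha> = 0}) \<inter> {c. (\<Sum>\<alpha>\<in>exps N. \<bar>c \<alpha>\<bar>) = 1}"
    unfolding poly_sphere_def by auto
  have cl: "closed (poly_sphere N :: (('d \<Rightarrow> nat) \<Rightarrow> real) set)"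
    unfolding eq by (intro closed_Int closed_INT ballI closed_Collect_eq continuous_on_const
        continuous_on_sum continuous_on_rabs continuous_on_product_coordinates)
  have sub: "poly_sphere N \<subseteq> (Pi\<^sub>E UNIV (\<lambda>_. {-1..1}) :: (('d \<Rightarrow> nat) \<Rightarrow> real) set)"
  proof
    fix c :: "('d \<Rightarrow> nat) \<Rightarrow> real" assume c: "c \<in> poly_sphere N"
    have "\<bar>c \<alpha>\<bar> \<le> 1" for \<alpha>
    proof (cases "\<alpha> \<in> exps N")
      case True
      have "\<bar>c \<alpha>\<bar> \<le> (\<Sum>\<alpha>\<in>exps N. \<bar>c \<alpha>\<bar>)" by (rule member_le_sum) (use True in auto)
      then show ?thesis using c by (simp add: poly_sphere_def)
    qed (use c in \<open>simp add: poly_sphere_def\<close>)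
    then have "-1 \<le> c \<alpha> \<and> c \<alpha> \<le> 1" for \<alpha> by (metis abs_le_iff minus_le_iff)
    then show "c \<in> Pi\<^sub>E UNIV (\<lambda>_. {-1..1})" by (simp add: PiE_UNIV_domain)
  qed
  show ?thesis using compact_Int_closed[OF c cl] sub by (simp add: Int_absorb1)
qed

text \<open>The cut-off outside the unit ball makes the modulus of a polynomial bounded and uniformly continuous,
uniformly over the sphere of coefficients.\<close>

definition bump :: "nat \<Rightarrow> (('d::finite \<Rightarrow> nat) \<Rightarrow> real) \<Rightarrow> real ^ 'd \<Rightarrow> real" where
  "bump N c z = \<bar>poly_eval N c z\<bar> * max 0 (1 - norm z)"

lemma continuous_on_bump:
  assumes "continuous_on S f" "continuous_on S g"
  shows "continuous_on S (\<lambda>x. bump N (f x) (g x))"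
  unfolding bump_def poly_eval_def monomial_def
  by (intro continuous_intros assms continuous_on_coordinate[OF assms(1)])

lemma bump_nonneg: "0 \<le> bump N c z"
  by (simp add: bump_def)

lemma bump_le_one:
  assumes "c \<in> poly_sphere N" shows "bump N c z \<le> 1"
proof (cases "norm z < 1")
  case True
  have m: "\<bar>monomial \<alpha> z\<bar> \<le> 1" for \<alpha> :: "'a \<Rightarrow> nat"
  proof -
    have "\<bar>z $ i\<bar> \<le> 1" for i using component_le_norm_cart[of z i] True by linarith
    then show ?thesis unfolding monomial_def abs_prod power_abs
      by (intro prod_le_1) (auto intro: power_le_one)
  qed
  have "\<bar>poly_eval N c z\<bar> \<le> (\<Sum>\<alpha>\<in>exps N. \<bar>c \<alpha> * monomial \<alpha> z\<bar>)" unfolding poly_eval_def by (rule sum_abs)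
  also have "\<dots> \<le> (\<Sum>\<alpha>\<in>exps N. \<bar>c \<alpha>\<bar>)"
    by (intro sum_mono) (use m in \<open>simp add: abs_mult mult_left_le\<close>)
  also have "\<dots> = 1" using assms by (simp add: poly_sphere_def)
  finally show ?thesis using True unfolding bump_def by (intro mult_le_one) auto
qed (simp add: bump_def)

lemma bump_uniform:
  assumes "0 < \<eta>"
  obtains \<rho> where "0 < \<rho>" "\<And>c z z'. c \<in> poly_sphere N \<Longrightarrow> norm (z - z') < \<rho> \<Longrightarrow>
     \<bar>bump N c z - bump N c z'\<bar> < \<eta>"
proof -
  let ?K = "poly_sphere N \<times> (cball 0 2 :: (real ^ 'a) set)"
  have "compact ?K" by (intro compact_Times compact_poly_sphere compact_cball)
  moreover have "continuous_on ?K (\<lambda>p. bump N (fst p) (snd p))"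
    by (intro continuous_on_bump continuous_intros)
  ultimately have "uniformly_continuous_on ?K (\<lambda>p. bump N (fst p) (snd p))"
    by (rule compact_uniformly_continuous[rotated])
  then obtain \<rho> where \<rho>: "\<rho> > 0" "\<And>p q. p \<in> ?K \<Longrightarrow> q \<in> ?K \<Longrightarrow> dist q p < \<rho> \<Longrightarrow>
      dist (bump N (fst q) (snd q)) (bump N (fst p) (snd p)) < \<eta>"
    unfolding uniformly_continuous_on_def using assms by metis
  show thesis
  proof (rule that[of "min \<rho> 1"])
    fix c :: "('a \<Rightarrow> nat) \<Rightarrow> real" and z z' :: "real ^ 'a"
    assume c: "c \<in> poly_sphere N" and d: "norm (z - z') < min \<rho> 1"
    show "\<bar>bump N c z - bump N c z'\<bar> < \<eta>"
    proof (cases "norm z \<le> 2 \<and> norm z' \<le> 2")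
      case True
      then show ?thesis using \<rho>(2)[of "(c, z')" "(c, z)"] c d
        by (auto simp: dist_Pair_Pair dist_norm dist_real_def)
    next
      case False
      have "1 \<le> norm z" "1 \<le> norm z'" using False d norm_triangle_ineq2[of z z']
          norm_triangle_ineq2[of z' z] by (auto simp: norm_minus_commute)
      then show ?thesis using assms by (simp add: bump_def)
    qed
  qed (use \<rho> in auto)
qed

section \<open>Gaussian averages of polynomials\<close>

definition std_gauss :: "('m::finite \<Rightarrow> real) measure" where
  "std_gauss = PiM UNIV (\<lambda>_. density lborel std_normal_density)"

text \<open>Vectors are given by their coordinate functions, on which the standard Gaussian law is a product
measure.\<close>

definition mat_apply :: "real ^ 'm ^ 'd \<Rightarrow> ('m::finite \<Rightarrow> real) \<Rightarrow> real ^ 'd" where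
  "mat_apply S g = (\<chi> i. \<Sum>j\<in>UNIV. S $ i $ j * g j)"

definition gauss_mean :: "nat \<Rightarrow> (('d::finite \<Rightarrow> nat) \<Rightarrow> real) \<Rightarrow> real ^ 'm::finite ^ 'd \<Rightarrow> real" where
  "gauss_mean N c S = (\<integral>g. bump N c (mat_apply S g) \<partial>std_gauss)"

lemma prob_space_std_normal: "prob_space (density lborel std_normal_density)"
  by (rule prob_space_normal_density) simp

lemma prob_space_std_gauss: "prob_space std_gauss"
  unfolding std_gauss_def by (intro prob_space_PiM prob_space_std_normal)

lemma sets_std_gauss: "sets (std_gauss :: ('m::finite \<Rightarrow> real) measure) = sets borel"
proof -
  have "sets (std_gauss :: ('m \<Rightarrow> real) measure) = sets (PiM UNIV (\<lambda>_. borel))"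
    unfolding std_gauss_def by (intro sets_PiM_cong) auto
  then show ?thesis by (simp add: sets_PiM_equal_borel)
qed

lemma continuous_on_mat_apply:
  assumes "continuous_on A f" "continuous_on A g"
  shows "continuous_on A (\<lambda>x. mat_apply (f x) (g x))"
  unfolding mat_apply_def
  by (intro continuous_on_vec_lambda continuous_intros assms continuous_on_coordinate[OF assms(2)])

lemma bump_mat_apply_measurable:
  "(\<lambda>g. bump N c (mat_apply S g)) \<in> borel_measurable std_gauss"
proof -
  have "(\<lambda>g. bump N c (mat_apply S g)) \<in> borel_measurable borel"
    by (intro borel_measurable_continuous_onI continuous_on_bump continuous_on_mat_apply
        continuous_on_const continuous_on_id)
  then show ?thesis using measurable_cong_sets[OF sets_std_gauss refl] by blast
qed

lemma integrable_bump:
  assumes "c \<in> poly_sphere N"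
  shows "integrable std_gauss (\<lambda>g. bump N c (mat_apply S g))"
proof -
  interpret prob_space std_gauss by (rule prob_space_std_gauss)
  show ?thesis
    by (intro integrable_const_bound[where B = 1] bump_mat_apply_measurable AE_I2)
       (simp add: bump_le_one[OF assms] bump_nonneg abs_of_nonneg)
qed

lemma continuous_on_gauss_mean:
  "continuous_on (poly_sphere N \<times> UNIV) (\<lambda>p. gauss_mean N (fst p) (snd p))"
proof (rule continuous_on_sequentiallyI)
  fix u and p :: "(('a \<Rightarrow> nat) \<Rightarrow> real) \<times> (real ^ 'b ^ 'a)"
  assume u: "\<forall>n. u n \<in> poly_sphere N \<times> UNIV" and p: "p \<in> poly_sphere N \<times> UNIV"
    and lim: "u \<longlonglongrightarrow> p"
  interpret prob_space "std_gauss :: ('b \<Rightarrow> real) measure" by (rule prob_space_std_gauss)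
  show "(\<lambda>n. gauss_mean N (fst (u n)) (snd (u n))) \<longlonglongrightarrow> gauss_mean N (fst p) (snd p)"
    unfolding gauss_mean_def
  proof (rule integral_dominated_convergence[where w = "\<lambda>_. 1"])
    show "AE g in std_gauss. (\<lambda>n. bump N (fst (u n)) (mat_apply (snd (u n)) g))
        \<longlonglongrightarrow> bump N (fst p) (mat_apply (snd p) g)"
    proof (rule AE_I2)
      fix g :: "'b \<Rightarrow> real"
      have "continuous_on UNIV (\<lambda>p. bump N (fst p) (mat_apply (snd p) g))"
        by (intro continuous_on_bump continuous_on_mat_apply continuous_intros)
      then have "isCont (\<lambda>p. bump N (fst p) (mat_apply (snd p) g)) p"
        unfolding continuous_on_eq_continuous_at[OF open_UNIV] by blast
      from isCont_tendsto_compose[OF this lim]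
      show "(\<lambda>n. bump N (fst (u n)) (mat_apply (snd (u n)) g))
        \<longlonglongrightarrow> bump N (fst p) (mat_apply (snd p) g)" .
    qed
    show "AE x in std_gauss. norm (bump N (fst (u n)) (mat_apply (snd (u n)) x)) \<le> 1" for n
      using u by (auto simp: mem_Times_iff bump_nonneg abs_of_nonneg intro!: bump_le_one AE_I2)
  qed (auto intro: bump_mat_apply_measurable)
qed

text \<open>An open set contains a box around each of its points, and every side of the box is charged by the
positive density.\<close>

lemma std_gauss_open_pos:
  assumes "open U" "g \<in> U"
  shows "emeasure std_gauss U > 0"
proof -
  let ?n = "density lborel std_normal_density"
  interpret product_sigma_finite "\<lambda>_::'a. ?n"
    by (rule product_sigma_finite.intro) (use prob_space_std_normal prob_space_imp_sigma_finite in blast)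
  obtain X where X: "g \<in> Pi\<^sub>E UNIV X" "\<And>i. open (X i)" "Pi\<^sub>E UNIV X \<subseteq> U"
    using product_topology_open_contains_basis[of "\<lambda>_. euclidean" UNIV U g] assms
    by (auto simp: euclidean_product_topology)
  have dens: "ennreal (std_normal_density x) \<noteq> 0" for x
    using normal_density_pos[of 1 0 x] by (simp only: ennreal_eq_0_iff not_le)
  have "emeasure ?n (X i) \<noteq> 0" for i
  proof
    assume "emeasure ?n (X i) = 0"
    then have "X i \<in> null_sets ?n" using X by (auto intro!: null_setsI)
    then have "AE x in lborel. x \<in> X i \<longrightarrow> ennreal (std_normal_density x) = 0"
      by (subst (asm) null_sets_density_iff) auto
    then have "AE x in lborel. x \<notin> X i"
      by eventually_elim (use dens in auto)
    then have "X i \<in> null_sets lborel" using X by (subst AE_iff_null_sets) auto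
    then have "negligible (X i)"
      by (simp add: negligible_iff_null_sets null_sets_completionI)
    then have "X i = {}" using X open_not_negligible by blast
    then show False using X(1) by auto
  qed
  then have "emeasure std_gauss (Pi\<^sub>E UNIV X) \<noteq> 0"
    unfolding std_gauss_def by (subst emeasure_PiM) (use X in auto)
  moreover have "emeasure std_gauss (Pi\<^sub>E UNIV X) \<le> emeasure std_gauss U"
    using X assms by (intro emeasure_mono) (auto simp: sets_std_gauss)
  ultimately show ?thesis by (metis le_zero_eq not_gr_zero)
qed

lemma gauss_mean_pos:
  assumes c: "c \<in> poly_sphere N" and S: "surj (mat_apply S)"
  shows "0 < gauss_mean N c S"
proof -
  have "\<exists>\<alpha>\<in>exps N. c \<alpha> \<noteq> 0"
  proof (rule ccontr)
    assume "\<not> ?thesis"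
    then have "(\<Sum>\<alpha>\<in>exps N. \<bar>c \<alpha>\<bar>) = 0" by simp
    then show False using c by (simp add: poly_sphere_def)
  qed
  then obtain z where z: "norm z < 1" "poly_eval N c z \<noteq> 0"
    using poly_eval_zero_imp[of 1 N c] by auto
  obtain g where g: "mat_apply S g = z" using S by (metis surjD)
  define U where "U = {g. 0 < bump N c (mat_apply S g)}"
  have "open U" unfolding U_def
    by (intro open_Collect_less continuous_on_bump continuous_on_mat_apply continuous_intros)
       (auto simp: continuous_on_id)
  moreover have "g \<in> U" using z g by (simp add: U_def bump_def)
  ultimately have pos: "emeasure std_gauss U > 0" by (rule std_gauss_open_pos)
  have nn: "0 \<le> gauss_mean N c S"
    unfolding gauss_mean_def by (intro Bochner_Integration.integral_nonneg) (rule bump_nonneg)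
  moreover have "gauss_mean N c S \<noteq> 0"
  proof
    assume "gauss_mean N c S = 0"
    then have "AE g in std_gauss. bump N c (mat_apply S g) = 0"
      unfolding gauss_mean_def
      by (subst (asm) integral_nonneg_eq_0_iff_AE) (auto intro: integrable_bump c bump_nonneg)
    then have "AE g in std_gauss. g \<notin> U" by eventually_elim (simp add: U_def)
    then have "U \<in> null_sets std_gauss"
      by (subst AE_iff_null_sets) (use \<open>open U\<close> in \<open>auto simp: sets_std_gauss\<close>)
    then show False using pos by auto
  qed
  ultimately show ?thesis by linarith
qed

text \<open>A positive continuous function on a compact set. Uniformity in the coefficients and in the matrix is
what allows random ones later.\<close>

lemma gauss_mean_bounded_below:
  fixes K :: "(real ^ 'm::finite ^ 'd::finite) set"
  assumes "compact K" and S: "\<And>S. S \<in> K \<Longrightarrow> surj (mat_apply S)"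
  obtains \<kappa> where "0 < \<kappa>" "\<And>c S. c \<in> poly_sphere N \<Longrightarrow> S \<in> K \<Longrightarrow> \<kappa> \<le> gauss_mean N c S"
proof (cases "(poly_sphere N :: (('d \<Rightarrow> nat) \<Rightarrow> real) set) \<times> K = {}")
  case True
  show thesis by (rule that[of 1]) (use True in auto)
next
  case False
  have "compact ((poly_sphere N :: (('d \<Rightarrow> nat) \<Rightarrow> real) set) \<times> K)" by (intro compact_Times compact_poly_sphere assms)
  moreover have "continuous_on (poly_sphere N \<times> K) (\<lambda>p. gauss_mean N (fst p) (snd p))"
    by (rule continuous_on_subset[OF continuous_on_gauss_mean]) auto
  ultimately obtain p :: "(('d \<Rightarrow> nat) \<Rightarrow> real) \<times> (real ^ 'm ^ 'd)" where p:
    "p \<in> poly_sphere N \<times> K"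
    "\<And>q. q \<in> poly_sphere N \<times> K \<Longrightarrow> gauss_mean N (fst p) (snd p) \<le> gauss_mean N (fst q) (snd q)"
    using continuous_attains_inf[of "poly_sphere N \<times> K" "\<lambda>p. gauss_mean N (fst p) (snd p)"] False by blast
  show thesis
  proof (rule that)
    show "0 < gauss_mean N (fst p) (snd p)" using p(1) S by (intro gauss_mean_pos) auto
    show "gauss_mean N (fst p) (snd p) \<le> gauss_mean N c S" if "c \<in> poly_sphere N" "S \<in> K" for c S
      using p(2)[of "(c, S)"] that by simp
  qed
qed

section \<open>Finite increasing sequences\<close>

lemma finite_set_increasing_enumeration:
  fixes A :: "real set"
  assumes "finite A" "A \<noteq> {}"
  obtains p :: "nat \<Rightarrow> real" and K where "p ` {..K} = A" "\<And>i. i < K \<Longrightarrow> p i < p (Suc i)"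
proof -
  define P where "P = sorted_list_of_set A"
  have setP: "set P = A" and srt: "sorted_wrt (<) P"
    using assms(1) unfolding P_def by (rule set_sorted_list_of_set, intro strict_sorted_list_of_set)
  define K where "K = length P - 1"
  have len: "length P = Suc K" using setP assms(2) by (cases P) (auto simp: K_def)
  show thesis
  proof (rule that)
    show "(\<lambda>i. P ! i) ` {..K} = A"
      using len unfolding setP[symmetric] by (auto simp: set_conv_nth less_Suc_eq_le)
    show "P ! i < P ! Suc i" if "i < K" for i using that len srt by (simp add: sorted_wrt_nth_less)
  qed
qed

lemma increasing_seq_less:
  fixes p :: "nat \<Rightarrow> real"
  assumes "\<And>i. i < K \<Longrightarrow> p i < p (Suc i)" and "i < j" "j \<le> K"
  shows "p i < p j"
  using assms(2,3)
proof (induction j)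
  case (Suc j)
  then show ?case using assms(1)[of j] by (cases "i = j") force+
qed simp

lemma increasing_seq_le_iff:
  fixes p :: "nat \<Rightarrow> real"
  assumes "\<And>i. i < K \<Longrightarrow> p i < p (Suc i)" and "i \<le> K" "j \<le> K"
  shows "p i \<le> p j \<longleftrightarrow> i \<le> j"
proof (cases i j rule: linorder_cases)
  case less
  then show ?thesis using increasing_seq_less[of K p i j] assms by auto
next
  case greater
  then show ?thesis using increasing_seq_less[of K p j i] assms by auto
qed auto

lemma increasing_seq_less_iff:
  fixes p :: "nat \<Rightarrow> real"
  assumes "\<And>i. i < K \<Longrightarrow> p i < p (Suc i)" and "i \<le> K" "j \<le> K"
  shows "p i < p j \<longleftrightarrow> i < j"
  using increasing_seq_le_iff[of K p j i] assms by auto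

section \<open>Independence of Brownian increments from the past\<close>

text \<open>The sets whose preimage is independent of \<open>E\<close> form a Dynkin system.\<close>

lemma (in prob_space) indep_event_of_generator:
  assumes f: "f \<in> measurable M N" and N: "sets N = sigma_sets (space N) G"
    and G: "G \<subseteq> Pow (space N)" "Int_stable G"
    and E: "E \<in> events"
    and gen: "\<And>A. A \<in> G \<Longrightarrow> prob (f -` A \<inter> space M \<inter> E) = prob (f -` A \<inter> space M) * prob E"
    and A: "A \<in> sets N"
  shows "prob (f -` A \<inter> space M \<inter> E) = prob (f -` A \<inter> space M) * prob E"
proof -
  have meas: "f -` B \<inter> space M \<in> events" if "B \<in> sigma_sets (space N) G" for B
    using f that N by (auto intro: measurable_sets)
  have "A \<in> sigma_sets (space N) G" using A N by simp
  with G(2,1) show ?thesis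
  proof (induction rule: sigma_sets_induct_disjoint)
    case (basic A)
    then show ?case by (rule gen)
  next
    case empty
    show ?case by simp
  next
    case (compl A)
    note mA = meas[OF compl(1)]
    have eq: "f -` (space N - A) \<inter> space M = space M - (f -` A \<inter> space M)"
      using measurable_space[OF f] by auto
    have "prob (f -` (space N - A) \<inter> space M \<inter> E) = prob (E - (f -` A \<inter> space M \<inter> E))"
      using sets.sets_into_space[OF E] unfolding eq by (intro arg_cong[where f = prob]) auto
    also have "\<dots> = prob E - prob (f -` A \<inter> space M \<inter> E)"
      by (rule finite_measure_Diff) (use mA E in auto)
    finally show ?case unfolding eq prob_compl[OF mA] compl(2) by (simp add: algebra_simps)
  next
    case (union A)
    have mA: "f -` A i \<inter> space M \<in> events" for i using union(2) by (intro meas) auto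
    have d: "disjoint_family (\<lambda>i. f -` A i \<inter> space M)"
      "disjoint_family (\<lambda>i. f -` A i \<inter> space M \<inter> E)"
      using union(1) by (auto simp: disjoint_family_on_def)
    have "(\<lambda>i. prob (f -` A i \<inter> space M \<inter> E)) sums prob (\<Union>i. f -` A i \<inter> space M \<inter> E)"
      by (rule finite_measure_UNION) (use mA E d in auto)
    moreover have "(\<lambda>i. prob (f -` A i \<inter> space M) * prob E) sums
        (prob (\<Union>i. f -` A i \<inter> space M) * prob E)"
      by (intro sums_mult2 finite_measure_UNION) (use mA d in auto)
    ultimately have "prob (\<Union>i. f -` A i \<inter> space M \<inter> E) = prob (\<Union>i. f -` A i \<inter> space M) * prob E"
      unfolding union(3) by (rule sums_unique2)
    moreover have "(\<Union>i. f -` A i \<inter> space M \<inter> E) = f -` (\<Union>(range A)) \<inter> space M \<inter> E"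
      "(\<Union>i. f -` A i \<inter> space M) = f -` (\<Union>(range A)) \<inter> space M" by auto
    ultimately show ?case by simp
  qed
qed

locale brownian_with_initial = prob_space M for M :: "'w measure" +
  fixes T :: real and \<beta> :: "real \<Rightarrow> 'w \<Rightarrow> real ^ 'm::finite" and Y :: "'w \<Rightarrow> real ^ 'd::finite"
  assumes brownian: "brownian_motion M T \<beta>"
    and Y_measurable: "Y \<in> borel_measurable M"
    and Y_indep: "indep_set (sets (vimage_algebra (space M) Y borel))
           (sets (vimage_algebra (space M) (\<lambda>\<omega>. \<lambda>t\<in>{0..T}. \<beta> t \<omega>)
             (PiM {0..T} (\<lambda>_. borel))))"
begin

abbreviation F :: "real \<Rightarrow> 'w measure" where "F \<equiv> augmented_filtration M \<beta> Y"

lemma beta_measurable: "0 \<le> t \<Longrightarrow> t \<le> T \<Longrightarrow> \<beta> t \<in> borel_measurable M"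
  using brownian by (auto simp: brownian_motion_def)

lemma filtration_generator_subset: "{Y -` A \<inter> space M | A. A \<in> sets borel} \<union>
      {\<beta> s -` A \<inter> space M | s A. s \<in> {0..t} \<and> A \<in> sets borel} \<union> null_sets M \<subseteq> Pow (space M)"
  using sets.sets_into_space by (auto simp: null_sets_def)

lemma space_F [simp]: "space (F t) = space M"
  unfolding augmented_filtration_def by (rule space_measure_of[OF filtration_generator_subset])

lemma sets_F: "sets (F t) = sigma_sets (space M) ({Y -` A \<inter> space M | A. A \<in> sets borel} \<union>
      {\<beta> s -` A \<inter> space M | s A. s \<in> {0..t} \<and> A \<in> sets borel} \<union> null_sets M)"
  unfolding augmented_filtration_def by (rule sets_measure_of[OF filtration_generator_subset])

lemma sets_F_mono:
  assumes "s \<le> t" shows "sets (F s) \<subseteq> sets (F t)"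
  unfolding sets_F
proof (intro sigma_sets_mono' Un_mono order_refl subsetI)
  fix B assume "B \<in> {\<beta> r -` A \<inter> space M | r A. r \<in> {0..s} \<and> A \<in> sets borel}"
  then obtain r A where "B = \<beta> r -` A \<inter> space M" "r \<in> {0..s}" "A \<in> sets borel" by blast
  moreover from this(2) have "r \<in> {0..t}" using assms by simp
  ultimately show "B \<in> {\<beta> r -` A \<inter> space M | r A. r \<in> {0..t} \<and> A \<in> sets borel}" by blast
qed

lemma sets_F_subset: "t \<le> T \<Longrightarrow> sets (F t) \<subseteq> events"
  unfolding sets_F
  by (intro sets.sigma_sets_subset)
     (auto intro!: measurable_sets[OF Y_measurable] measurable_sets[OF beta_measurable])

lemma measurable_F_M: "f \<in> measurable (F t) N \<Longrightarrow> t \<le> T \<Longrightarrow> f \<in> measurable M N"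
  using sets_F_subset[of t] unfolding measurable_def by auto

lemma measurable_F_mono: "f \<in> measurable (F s) N \<Longrightarrow> s \<le> t \<Longrightarrow> f \<in> measurable (F t) N"
  using sets_F_mono[of s t] unfolding measurable_def by auto

lemma beta_measurable_F: "0 \<le> s \<Longrightarrow> s \<le> t \<Longrightarrow> \<beta> s \<in> borel_measurable (F t)"
  by (rule measurableI) (auto simp: sets_F intro!: sigma_sets.Basic)

lemma borel_measurable_vec_lambda:
  assumes "\<And>i. (\<lambda>x. f x i) \<in> borel_measurable N"
  shows "(\<lambda>x. (\<chi> i. f x i) :: real ^ 'k::finite) \<in> borel_measurable N"
proof -
  have "(\<lambda>x. (\<chi> i. f x i) \<bullet> b) \<in> borel_measurable N" if b: "b \<in> Basis" for b :: "real ^ 'k"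
  proof -
    obtain i where "b = axis i 1" using b by (auto simp: Basis_vec_def)
    then show ?thesis using assms by (simp add: inner_axis)
  qed
  then show ?thesis by (subst borel_measurable_euclidean_space) blast
qed

text \<open>Along a subdivision containing \<open>J\<close>, \<open>0\<close>, \<open>a\<close> and \<open>b\<close> the values of the Brownian motion are sums of
earlier increments, up to a null set because \<open>\<beta>\<^sub>0\<close> vanishes only almost surely.\<close>

lemma increment_indep_of_grid:
  assumes ab: "0 \<le> a" "a < b" "b \<le> T" and J: "finite J" "J \<subseteq> {0..a}"
    and X: "\<And>j. j \<in> J \<Longrightarrow> X j \<in> sets borel" and C: "C \<in> sets borel"
  shows "prob ({\<omega> \<in> space M. \<forall>j\<in>J. \<beta> j \<omega> \<in> X j} \<inter> {\<omega> \<in> space M. \<beta> b \<omega> - \<beta> a \<omega> \<in> C}) =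
    prob {\<omega> \<in> space M. \<forall>j\<in>J. \<beta> j \<omega> \<in> X j} * prob {\<omega> \<in> space M. \<beta> b \<omega> - \<beta> a \<omega> \<in> C}"
proof -
  obtain p q where pS: "p ` {..q} = insert 0 (insert a J)" and p: "\<And>i. i < q \<Longrightarrow> p i < p (Suc i)"
    by (rule finite_set_increasing_enumeration[of "insert 0 (insert a J)"]) (use J(1) in auto)
  \<comment> \<open>the points of \<open>J\<close> with \<open>0\<close> and \<open>a\<close> in increasing order, followed by \<open>b\<close>\<close>
  define s where "s i = (if i \<le> q then p i else b)" for i
  have Pmem: "p i \<in> {0..a}" if "i \<le> q" for i
  proof -
    have "p i \<in> insert 0 (insert a J)" using that unfolding pS[symmetric] by blast
    then show ?thesis using J(2) ab by auto
  qed
  have Pmono: "p i < p j" if "i < j" "j \<le> q" for i j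
    by (rule increasing_seq_less[of q p, OF p that])
  have hit: "\<exists>i\<le>q. p i = u" if "u \<in> insert 0 (insert a J)" for u
    using that unfolding pS[symmetric] by auto
  have P0: "p 0 = 0"
  proof -
    obtain i where i: "i \<le> q" "p i = 0" using hit[of 0] by auto
    then show ?thesis using Pmono[of 0 i] Pmem[of 0] by (cases "i = 0") auto
  qed
  have Pq: "p q = a"
  proof -
    obtain i where i: "i \<le> q" "p i = a" using hit[of a] by auto
    then show ?thesis using Pmono[of i q] Pmem[of q] by (cases "i = q") auto
  qed
  have smono: "s i < s (Suc i)" if "i < Suc q" for i
    using that Pmono[of i "Suc i"] Pq ab by (auto simp: s_def le_less_Suc_eq dest!: less_antisym)
  have "0 \<le> s 0 \<and> (\<forall>i<Suc q. s i < s (Suc i)) \<and> s (Suc q) \<le> T"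
    using smono P0 ab by (auto simp: s_def)
  then have ind: "indep_vars (\<lambda>_. borel)
          (\<lambda>(i, j) \<omega>. \<beta> (s (Suc i)) \<omega> $ j - \<beta> (s i) \<omega> $ j) ({..<Suc q} \<times> UNIV)"
    using brownian unfolding brownian_motion_def by blast
  define V where "V = (\<lambda>(i, j :: 'm) \<omega>. \<beta> (s (Suc i)) \<omega> $ j - \<beta> (s i) \<omega> $ j)"
  define K1 where "K1 = {..<q} \<times> (UNIV :: 'm set)"
  define K2 where "K2 = {q} \<times> (UNIV :: 'm set)"
  have indv: "indep_var (PiM K1 (\<lambda>_. borel)) (\<lambda>\<omega>. \<lambda>k\<in>K1. V k \<omega>) (PiM K2 (\<lambda>_. borel)) (\<lambda>\<omega>. \<lambda>k\<in>K2. V k \<omega>)"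
    by (rule indep_var_restrict[OF ind[folded V_def]]) (auto simp: K1_def K2_def)
  have "\<exists>i. i \<le> q \<and> s i = j" if "j \<in> J" for j
    using hit[of j] that by (auto simp: s_def)
  then obtain idx where idx: "\<And>j. j \<in> J \<Longrightarrow> idx j \<le> q \<and> s (idx j) = j" by metis
  define S1 where "S1 = {f \<in> space (PiM K1 (\<lambda>_. borel)).
      \<forall>j\<in>J. (\<chi> l. \<Sum>i<idx j. f (i, l)) \<in> X j}"
  define S2 where "S2 = {f \<in> space (PiM K2 (\<lambda>_. borel)). (\<chi> l. f (q, l)) \<in> C}"
  have S1: "S1 \<in> sets (PiM K1 (\<lambda>_. borel))"
    unfolding S1_def
  proof (intro sets.sets_Collect_finite_All J(1))
    fix j assume j: "j \<in> J"
    have "(\<lambda>f. (\<chi> l. \<Sum>i<idx j. f (i, l)) :: real ^ 'm) \<in> borel_measurable (PiM K1 (\<lambda>_. borel))"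
      by (intro borel_measurable_vec_lambda borel_measurable_sum measurable_component_singleton)
         (use idx[OF j] in \<open>auto simp: K1_def\<close>)
    from measurable_sets[OF this X[OF j]]
    show "{f \<in> space (PiM K1 (\<lambda>_. borel)). (\<chi> l. \<Sum>i<idx j. f (i, l)) \<in> X j} \<in> sets (PiM K1 (\<lambda>_. borel))"
      by (simp add: vimage_def Int_def conj_commute)
  qed
  have S2: "S2 \<in> sets (PiM K2 (\<lambda>_. borel))"
  proof -
    have "(\<lambda>f. (\<chi> l. f (q, l)) :: real ^ 'm) \<in> borel_measurable (PiM K2 (\<lambda>_. borel))"
      by (intro borel_measurable_vec_lambda measurable_component_singleton) (auto simp: K2_def)
    from measurable_sets[OF this C] show ?thesis
      by (simp add: S2_def vimage_def Int_def conj_commute)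
  qed
  let ?A = "{\<omega> \<in> space M. \<forall>j\<in>J. \<beta> j \<omega> \<in> X j}" and ?E = "{\<omega> \<in> space M. \<beta> b \<omega> - \<beta> a \<omega> \<in> C}"
  let ?A' = "(\<lambda>\<omega>. \<lambda>k\<in>K1. V k \<omega>) -` S1 \<inter> space M"
  have E_eq: "(\<lambda>\<omega>. \<lambda>k\<in>K2. V k \<omega>) -` S2 \<inter> space M = ?E"
  proof -
    have "(\<chi> l. V (q, l) \<omega>) = \<beta> b \<omega> - \<beta> a \<omega>" for \<omega>
      by (simp add: V_def s_def Pq vec_eq_iff)
    then show ?thesis by (auto simp: S2_def space_PiM K2_def)
  qed
  have A'm: "?A' \<in> events"
    using indv S1 by (auto simp: indep_var_eq intro: measurable_sets)
  have Em: "?E \<in> events"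
    using measurable_sets[OF _ C, of "\<lambda>\<omega>. \<beta> b \<omega> - \<beta> a \<omega>" M] beta_measurable[of a] beta_measurable[of b] ab
    by (auto simp: vimage_def Int_def conj_commute)
  have Am: "?A \<in> events"
  proof (intro sets.sets_Collect_finite_All J(1))
    fix j assume "j \<in> J"
    then show "{\<omega> \<in> space M. \<beta> j \<omega> \<in> X j} \<in> events"
      using measurable_sets[OF beta_measurable[of j] X] J ab by (auto simp: vimage_def Int_def conj_commute)
  qed
  have AE: "AE \<omega> in M. \<omega> \<in> ?A' \<longleftrightarrow> \<omega> \<in> ?A"
  proof -
    have "AE \<omega> in M. \<beta> 0 \<omega> = 0" using brownian by (simp add: brownian_motion_def)
    then show ?thesis
    proof eventually_elim
      case (elim \<omega>)
      have "(\<chi> l. \<Sum>i<idx j. V (i, l) \<omega>) = \<beta> j \<omega>" if j: "j \<in> J" for j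
      proof -
        have "(\<Sum>i<idx j. V (i, l) \<omega>) = \<beta> j \<omega> $ l" for l
        proof -
          have "(\<Sum>i<idx j. V (i, l) \<omega>) = \<beta> (s (idx j)) \<omega> $ l - \<beta> (s 0) \<omega> $ l"
            unfolding V_def prod.case by (rule sum_lessThan_telescope)
          moreover have "s 0 = 0" using P0 by (simp add: s_def)
          ultimately show ?thesis using idx[OF j] elim by simp
        qed
        then show ?thesis by (simp add: vec_eq_iff)
      qed
      moreover have "(\<chi> l. \<Sum>i<idx j. (\<lambda>k\<in>K1. V k \<omega>) (i, l)) = (\<chi> l. \<Sum>i<idx j. V (i, l) \<omega>)" if "j \<in> J" for j
        using idx[OF that] by (intro vec_lambda_inject[THEN iffD2] sum.cong ext) (auto simp: K1_def vec_eq_iff)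
      ultimately show ?case by (auto simp: S1_def space_PiM)
    qed
  qed
  have "prob (?A \<inter> ?E) = prob (?A' \<inter> ?E)"
    by (rule finite_measure_eq_AE) (use AE A'm Am Em in auto)
  also have "\<dots> = prob ?A' * prob ?E"
    using indep_varD[OF indv S1 S2] unfolding E_eq[symmetric]
    by (simp add: vimage_Times[symmetric] Int_def vimage_def conj_ac)
  also have "prob ?A' = prob ?A"
    by (rule finite_measure_eq_AE) (use AE A'm Am in auto)
  finally show ?thesis .
qed

lemma increment_event: "0 \<le> a \<Longrightarrow> a < b \<Longrightarrow> b \<le> T \<Longrightarrow> C \<in> sets borel \<Longrightarrow>
    {\<omega> \<in> space M. \<beta> b \<omega> - \<beta> a \<omega> \<in> C} \<in> events"
  using measurable_sets[of "\<lambda>\<omega>. \<beta> b \<omega> - \<beta> a \<omega>" M borel C] beta_measurable[of a] beta_measurable[of b]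
  by (auto simp: vimage_def Int_def conj_commute)

lemma past_path_measurable:
  "a \<le> T \<Longrightarrow> (\<lambda>\<omega>. \<lambda>t\<in>{0..a}. \<beta> t \<omega>) \<in> measurable M (PiM {0..a} (\<lambda>_. borel))"
  by (intro measurable_restrict beta_measurable) auto

lemma increment_indep_of_path:
  assumes ab: "0 \<le> a" "a < b" "b \<le> T" and C: "C \<in> sets borel"
    and S: "S \<in> sets (PiM {0..a} (\<lambda>_. borel))"
  shows "prob ((\<lambda>\<omega>. \<lambda>t\<in>{0..a}. \<beta> t \<omega>) -` S \<inter> space M \<inter> {\<omega> \<in> space M. \<beta> b \<omega> - \<beta> a \<omega> \<in> C}) =
    prob ((\<lambda>\<omega>. \<lambda>t\<in>{0..a}. \<beta> t \<omega>) -` S \<inter> space M) * prob {\<omega> \<in> space M. \<beta> b \<omega> - \<beta> a \<omega> \<in> C}"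
proof (rule indep_event_of_generator[OF past_path_measurable _ _ Int_stable_prod_algebra increment_event[OF ab C] _ S])
  show "sets (PiM {0..a} (\<lambda>_. borel)) = sigma_sets (space (PiM {0..a} (\<lambda>_. borel)))
      (prod_algebra {0..a} (\<lambda>_. borel :: (real ^ 'm) measure))"
    by (simp add: sets_PiM space_PiM)
  show "prod_algebra {0..a} (\<lambda>_. borel :: (real ^ 'm) measure) \<subseteq> Pow (space (PiM {0..a} (\<lambda>_. borel)))"
    unfolding space_PiM by (rule prod_algebra_sets_into_space)
  fix A assume "A \<in> prod_algebra {0..a} (\<lambda>_. borel :: (real ^ 'm) measure)"
  then obtain J X where J: "finite J" "J \<subseteq> {0..a}" "\<And>j. j \<in> J \<Longrightarrow> X j \<in> sets borel"
    and A: "A = prod_emb {0..a} (\<lambda>_. borel) J (Pi\<^sub>E J X)"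
    by (auto elim!: prod_algebraE)
  have "(\<lambda>\<omega>. \<lambda>t\<in>{0..a}. \<beta> t \<omega>) -` A \<inter> space M = {\<omega> \<in> space M. \<forall>j\<in>J. \<beta> j \<omega> \<in> X j}"
    unfolding A prod_emb_def using J(2) by (auto simp: space_PiM restrict_restrict Int_absorb1 PiE_iff)
  then show "prob ((\<lambda>\<omega>. \<lambda>t\<in>{0..a}. \<beta> t \<omega>) -` A \<inter> space M \<inter> {\<omega> \<in> space M. \<beta> b \<omega> - \<beta> a \<omega> \<in> C}) =
    prob ((\<lambda>\<omega>. \<lambda>t\<in>{0..a}. \<beta> t \<omega>) -` A \<inter> space M) * prob {\<omega> \<in> space M. \<beta> b \<omega> - \<beta> a \<omega> \<in> C}"
    using increment_indep_of_grid[OF ab J C] by simp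
qed (use ab in auto)

lemma Y_indep_path:
  assumes "A \<in> sets borel" "S \<in> sets (PiM {0..T} (\<lambda>_. borel))"
  shows "prob ((Y -` A \<inter> space M) \<inter> ((\<lambda>\<omega>. \<lambda>t\<in>{0..T}. \<beta> t \<omega>) -` S \<inter> space M)) =
    prob (Y -` A \<inter> space M) * prob ((\<lambda>\<omega>. \<lambda>t\<in>{0..T}. \<beta> t \<omega>) -` S \<inter> space M)"
  by (rule indep_setD[OF Y_indep]) (intro in_vimage_algebra assms)+

text \<open>The events \<open>{Y \<in> A} \<inter> {\<beta> up to time a \<in> S}\<close> are stable under intersection and remain so when all null
sets are added; together they generate the augmented past. The initial value is split off first, by its
independence of the whole Brownian path.\<close>

lemma increment_indep_of_filtration:
  assumes ab: "0 \<le> a" "a < b" "b \<le> T" and C: "C \<in> sets borel" and A: "A \<in> sets (F a)"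
  shows "prob (A \<inter> {\<omega> \<in> space M. \<beta> b \<omega> - \<beta> a \<omega> \<in> C}) =
    prob A * prob {\<omega> \<in> space M. \<beta> b \<omega> - \<beta> a \<omega> \<in> C}"
proof -
  let ?E = "{\<omega> \<in> space M. \<beta> b \<omega> - \<beta> a \<omega> \<in> C}"
  let ?B = "\<lambda>\<omega>. \<lambda>t\<in>{0..a}. \<beta> t \<omega>" and ?P = "PiM {0..a} (\<lambda>_. borel) :: (real \<Rightarrow> real ^ 'm) measure"
  define G where "G = {(Y -` A \<inter> space M) \<inter> (?B -` S \<inter> space M) | A S. A \<in> sets borel \<and> S \<in> sets ?P}"
  have genI: "(Y -` A \<inter> space M) \<inter> (?B -` S \<inter> space M) \<in> G" if "A \<in> sets borel" "S \<in> sets ?P" for A S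
    unfolding G_def using that by blast
  have aT: "a \<le> T" using ab by simp
  have Gev: "G \<union> null_sets M \<subseteq> events"
    unfolding G_def using measurable_sets[OF Y_measurable] measurable_sets[OF past_path_measurable[OF aT]]
    by auto
  have stable: "Int_stable (G \<union> null_sets M)"
  proof (rule Int_stableI)
    fix U V assume UV: "U \<in> G \<union> null_sets M" "V \<in> G \<union> null_sets M"
    show "U \<inter> V \<in> G \<union> null_sets M"
    proof (cases "U \<in> G \<and> V \<in> G")
      case True
      then obtain A1 S1 A2 S2 where "U = (Y -` A1 \<inter> space M) \<inter> (?B -` S1 \<inter> space M)"
          "V = (Y -` A2 \<inter> space M) \<inter> (?B -` S2 \<inter> space M)"
          and m: "A1 \<in> sets borel" "A2 \<in> sets borel" "S1 \<in> sets ?P" "S2 \<in> sets ?P"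
        unfolding G_def by blast
      then have "U \<inter> V = (Y -` (A1 \<inter> A2) \<inter> space M) \<inter> (?B -` (S1 \<inter> S2) \<inter> space M)" by auto
      moreover have "A1 \<inter> A2 \<in> sets borel" "S1 \<inter> S2 \<in> sets ?P" using m by auto
      ultimately show ?thesis unfolding G_def by blast
    next
      case False
      then show ?thesis using UV Gev null_set_Int1[of _ M] null_set_Int2[of _ M] by blast
    qed
  qed
  have genprob: "prob (U \<inter> ?E) = prob U * prob ?E" if U: "U \<in> G \<union> null_sets M" for U
  proof (cases "U \<in> G")
    case True
    then obtain A S where U: "U = (Y -` A \<inter> space M) \<inter> (?B -` S \<inter> space M)"
      and A: "A \<in> sets borel" and S: "S \<in> sets ?P" unfolding G_def by blast
    let ?BT = "\<lambda>\<omega>. \<lambda>t\<in>{0..T}. \<beta> t \<omega>" and ?PT = "PiM {0..T} (\<lambda>_. borel) :: (real \<Rightarrow> real ^ 'm) measure"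
    define S1 where "S1 = {f \<in> space ?PT. restrict f {0..a} \<in> S}"
    define S2 where "S2 = {f \<in> space ?PT. f b - f a \<in> C}"
    have S1: "S1 \<in> sets ?PT"
      using measurable_sets[OF measurable_restrict_subset[of "{0..a}" "{0..T}"] S] aT
      by (auto simp: S1_def vimage_def Int_def conj_commute)
    have S2: "S2 \<in> sets ?PT"
    proof -
      have "(\<lambda>f. f b - f a) \<in> borel_measurable ?PT"
        using ab by (intro borel_measurable_diff measurable_component_singleton) auto
      from measurable_sets[OF this C] show ?thesis
        by (auto simp: S2_def vimage_def Int_def conj_commute)
    qed
    have e1: "?BT -` S1 \<inter> space M = ?B -` S \<inter> space M"
      using aT by (auto simp: S1_def space_PiM restrict_restrict Int_absorb1)
    have e2: "?BT -` S2 \<inter> space M = ?E"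
      using ab by (auto simp: S2_def space_PiM)
    have e3: "?BT -` (S1 \<inter> S2) \<inter> space M = ?B -` S \<inter> space M \<inter> ?E"
      using e1 e2 by blast
    have "prob (U \<inter> ?E) = prob ((Y -` A \<inter> space M) \<inter> (?BT -` (S1 \<inter> S2) \<inter> space M))"
      unfolding U e3 by (simp add: Int_assoc)
    also have "\<dots> = prob (Y -` A \<inter> space M) * prob (?B -` S \<inter> space M \<inter> ?E)"
      unfolding e3[symmetric] by (rule Y_indep_path) (use A S1 S2 in auto)
    also have "\<dots> = prob (Y -` A \<inter> space M) * prob (?B -` S \<inter> space M) * prob ?E"
      using increment_indep_of_path[OF ab C S] by simp
    also have "prob (Y -` A \<inter> space M) * prob (?B -` S \<inter> space M) = prob U"
      unfolding U e1[symmetric] by (rule Y_indep_path[symmetric]) (use A S1 in auto)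
    finally show ?thesis .
  next
    case False
    then have "U \<in> null_sets M" using U by blast
    then have "prob U = 0" "prob (U \<inter> ?E) = 0"
      using null_set_Int2[OF _ increment_event[OF ab C], of U] increment_event[OF ab C]
      by (auto simp: measure_eq_0_null_sets Int_commute)
    then show ?thesis by simp
  qed
  have Asig: "A \<in> sigma_sets (space M) (G \<union> null_sets M)"
  proof -
    have "sets (F a) \<subseteq> sigma_sets (space M) (G \<union> null_sets M)"
      unfolding sets_F
    proof (intro sigma_sets_mono, safe)
      fix A :: "(real ^ 'd) set" assume "A \<in> sets borel"
      then have "(Y -` A \<inter> space M) \<inter> (?B -` space ?P \<inter> space M) \<in> G" by (intro genI) auto
      moreover have "?B -` space ?P \<inter> space M = space M" by (auto simp: space_PiM)
      ultimately have "Y -` A \<inter> space M \<in> G" by (simp add: Int_assoc)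
      then show "Y -` A \<inter> space M \<in> sigma_sets (space M) (G \<union> null_sets M)"
        by (intro sigma_sets.Basic UnI1)
    next
      fix s and A :: "(real ^ 'm) set" assume s: "s \<in> {0..a}" and A: "A \<in> sets borel"
      have "{f \<in> space ?P. f s \<in> A} \<in> sets ?P"
        using measurable_sets[OF measurable_component_singleton[OF s] A]
        by (auto simp: vimage_def Int_def conj_commute)
      then have inG: "(Y -` UNIV \<inter> space M) \<inter> (?B -` {f \<in> space ?P. f s \<in> A} \<inter> space M) \<in> G"
        by (intro genI) auto
      have eq: "(Y -` UNIV \<inter> space M) \<inter> (?B -` {f \<in> space ?P. f s \<in> A} \<inter> space M) =
          \<beta> s -` A \<inter> space M"
        using s by (auto simp: space_PiM)
      from inG have "\<beta> s -` A \<inter> space M \<in> G" unfolding eq .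
      then show "\<beta> s -` A \<inter> space M \<in> sigma_sets (space M) (G \<union> null_sets M)"
        by (intro sigma_sets.Basic UnI1)
    next
      fix B assume "B \<in> null_sets M"
      then show "B \<in> sigma_sets (space M) (G \<union> null_sets M)"
        by (intro sigma_sets.Basic UnI2)
    qed
    then show ?thesis using A by blast
  qed
  have Gpow: "G \<union> null_sets M \<subseteq> Pow (space M)" using Gev sets.space_closed by blast
  have idm: "(\<lambda>x. x) \<in> measurable M (sigma (space M) (G \<union> null_sets M))"
    by (rule measurable_measure_of[OF Gpow]) (use Gev in auto)
  have AM: "A \<inter> space M = A" using A sets_F_subset[OF aT] sets.sets_into_space by blast
  have "prob ((\<lambda>x. x) -` A \<inter> space M \<inter> ?E) = prob ((\<lambda>x. x) -` A \<inter> space M) * prob ?E"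
  proof (rule indep_event_of_generator[OF idm _ _ stable increment_event[OF ab C]])
    fix U assume U: "U \<in> G \<union> null_sets M"
    then have "(\<lambda>x. x) -` U \<inter> space M = U" using Gpow by auto
    then show "prob ((\<lambda>x. x) -` U \<inter> space M \<inter> ?E) = prob ((\<lambda>x. x) -` U \<inter> space M) * prob ?E"
      using genprob[OF U] by simp
  qed (use Gpow in \<open>simp_all add: Asig sets_measure_of[OF Gpow] space_measure_of[OF Gpow]\<close>)
  then show ?thesis using AM by simp
qed

text \<open>Independence in the form needed for Fubini's theorem; the two variables may take values in different
spaces.\<close>

lemma increment_joint_law:
  assumes ab: "0 \<le> a" "a < b" "b \<le> T" and U: "U \<in> measurable (F a) N" and h: "h \<in> measurable borel K"
  shows "distr M N U \<Otimes>\<^sub>M distr M K (\<lambda>\<omega>. h (\<beta> b \<omega> - \<beta> a \<omega>)) =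
    distr M (N \<Otimes>\<^sub>M K) (\<lambda>\<omega>. (U \<omega>, h (\<beta> b \<omega> - \<beta> a \<omega>)))"
proof (rule pair_measure_eqI)
  have aT: "a \<le> T" using ab by simp
  have UM: "U \<in> measurable M N" by (rule measurable_F_M[OF U aT])
  have hM: "(\<lambda>\<omega>. h (\<beta> b \<omega> - \<beta> a \<omega>)) \<in> measurable M K"
    using ab beta_measurable[of a] beta_measurable[of b] by (intro measurable_compose[OF _ h]) auto
  show "sigma_finite_measure (distr M N U)" "sigma_finite_measure (distr M K (\<lambda>\<omega>. h (\<beta> b \<omega> - \<beta> a \<omega>)))"
    using prob_space_distr[OF UM] prob_space_distr[OF hM] prob_space_imp_sigma_finite by blast+
  show "sets (distr M N U \<Otimes>\<^sub>M distr M K (\<lambda>\<omega>. h (\<beta> b \<omega> - \<beta> a \<omega>))) =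
      sets (distr M (N \<Otimes>\<^sub>M K) (\<lambda>\<omega>. (U \<omega>, h (\<beta> b \<omega> - \<beta> a \<omega>))))"
    unfolding sets_distr by (intro sets_pair_measure_cong sets_distr)
  fix A B assume "A \<in> sets (distr M N U)" "B \<in> sets (distr M K (\<lambda>\<omega>. h (\<beta> b \<omega> - \<beta> a \<omega>)))"
  then have A: "A \<in> sets N" and B: "B \<in> sets K" by auto
  have A': "U -` A \<inter> space M \<in> sets (F a)" using measurable_sets[OF U A] by simp
  have B': "h -` B \<in> sets borel" using measurable_sets[OF h B] by simp
  have "{\<omega> \<in> space M. \<beta> b \<omega> - \<beta> a \<omega> \<in> h -` B} = (\<lambda>\<omega>. h (\<beta> b \<omega> - \<beta> a \<omega>)) -` B \<inter> space M" by auto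
  from increment_indep_of_filtration[OF ab B' A', unfolded this]
  have "prob (U -` A \<inter> space M \<inter> ((\<lambda>\<omega>. h (\<beta> b \<omega> - \<beta> a \<omega>)) -` B \<inter> space M)) =
      prob (U -` A \<inter> space M) * prob ((\<lambda>\<omega>. h (\<beta> b \<omega> - \<beta> a \<omega>)) -` B \<inter> space M)" .
  moreover have "U -` A \<inter> space M \<inter> ((\<lambda>\<omega>. h (\<beta> b \<omega> - \<beta> a \<omega>)) -` B \<inter> space M) =
      (\<lambda>\<omega>. (U \<omega>, h (\<beta> b \<omega> - \<beta> a \<omega>))) -` (A \<times> B) \<inter> space M" by auto
  ultimately show "emeasure (distr M N U) A * emeasure (distr M K (\<lambda>\<omega>. h (\<beta> b \<omega> - \<beta> a \<omega>))) B =
      emeasure (distr M (N \<Otimes>\<^sub>M K) (\<lambda>\<omega>. (U \<omega>, h (\<beta> b \<omega> - \<beta> a \<omega>)))) (A \<times> B)"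
    using A B UM hM by (simp add: emeasure_distr measurable_Pair emeasure_eq_measure ennreal_mult[symmetric])
qed

end

section \<open>Integrals of simple processes\<close>

context brownian_with_initial
begin

lemma increment_distributed:
  assumes "0 \<le> a" "a < b" "b \<le> T"
  shows "distributed M lborel (\<lambda>\<omega>. \<beta> b \<omega> $ j - \<beta> a \<omega> $ j) (normal_density 0 (sqrt (b - a)))"
  using brownian assms by (auto simp: brownian_motion_def)

lemma scaled_increment_law:
  assumes ab: "0 \<le> a" "a < b" "b \<le> T"
  shows "distr M borel (\<lambda>\<omega> j. (\<beta> b \<omega> $ j - \<beta> a \<omega> $ j) / sqrt (b - a)) = std_gauss"
proof -
  define s where "s i = (if i = 0 then a else b)" for i :: nat
  define V where "V = (\<lambda>(i, j :: 'm) \<omega>. \<beta> (s (Suc i)) \<omega> $ j - \<beta> (s i) \<omega> $ j)"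
  have "0 \<le> s 0 \<and> (\<forall>i<1. s i < s (Suc i)) \<and> s 1 \<le> T" using ab by (simp add: s_def)
  then have "indep_vars (\<lambda>_. borel) V ({..<1} \<times> UNIV)"
    using brownian unfolding brownian_motion_def V_def by blast
  then have "indep_vars (\<lambda>j. PiM {(0, j)} (\<lambda>_. borel)) (\<lambda>j \<omega>. \<lambda>i\<in>{(0, j)}. V i \<omega>) (UNIV :: 'm set)"
    by (rule indep_vars_restrict) (auto simp: disjoint_family_on_def)
  then have "indep_vars (\<lambda>_. borel) (\<lambda>j \<omega>. (\<lambda>i\<in>{(0, j)}. V i \<omega>) (0, j) / sqrt (b - a)) (UNIV :: 'm set)"
    by (rule indep_vars_compose2)
       (intro borel_measurable_divide borel_measurable_const measurable_component_singleton, simp)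
  then have ind: "indep_vars (\<lambda>_. borel) (\<lambda>j \<omega>. (\<beta> b \<omega> $ j - \<beta> a \<omega> $ j) / sqrt (b - a)) (UNIV :: 'm set)"
    by (simp add: V_def s_def)
  have std: "distributed M lborel (\<lambda>\<omega>. (\<beta> b \<omega> $ j - \<beta> a \<omega> $ j) / sqrt (b - a)) std_normal_density" for j
    using normal_density_affine[OF increment_distributed[OF ab, of j], of "1 / sqrt (b - a)" 0] ab
    by (simp add: field_simps)
  have "distr M borel (\<lambda>\<omega>. (\<beta> b \<omega> $ j - \<beta> a \<omega> $ j) / sqrt (b - a)) = density lborel std_normal_density" for j
  proof -
    have "distr M borel (\<lambda>\<omega>. (\<beta> b \<omega> $ j - \<beta> a \<omega> $ j) / sqrt (b - a)) =
        distr M lborel (\<lambda>\<omega>. (\<beta> b \<omega> $ j - \<beta> a \<omega> $ j) / sqrt (b - a))"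
      by (rule distr_cong) auto
    then show ?thesis using std[of j] by (simp add: distributed_def)
  qed
  moreover have "distr M (PiM UNIV (\<lambda>_. borel)) (\<lambda>\<omega>. \<lambda>j\<in>UNIV. (\<beta> b \<omega> $ j - \<beta> a \<omega> $ j) / sqrt (b - a)) =
      PiM UNIV (\<lambda>j. distr M borel (\<lambda>\<omega>. (\<beta> b \<omega> $ j - \<beta> a \<omega> $ j) / sqrt (b - a)))"
    by (subst indep_vars_iff_distr_eq_PiM'[symmetric]) (use ind in \<open>auto simp: indep_vars_def\<close>)
  moreover have "distr M (PiM UNIV (\<lambda>_. borel)) (\<lambda>\<omega> j. (\<beta> b \<omega> $ j - \<beta> a \<omega> $ j) / sqrt (b - a)) =
      distr M borel (\<lambda>\<omega> j. (\<beta> b \<omega> $ j - \<beta> a \<omega> $ j) / sqrt (b - a))"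
    by (rule distr_cong) (auto simp: sets_PiM_equal_borel)
  ultimately show ?thesis by (simp add: std_gauss_def restrict_UNIV)
qed

lemma increment_moments:
  assumes ab: "0 \<le> a" "a < b" "b \<le> T"
  shows "integrable M (\<lambda>\<omega>. \<beta> b \<omega> $ j - \<beta> a \<omega> $ j)"
    and "integrable M (\<lambda>\<omega>. (\<beta> b \<omega> $ j - \<beta> a \<omega> $ j)\<^sup>2)"
    and "expectation (\<lambda>\<omega>. \<beta> b \<omega> $ j - \<beta> a \<omega> $ j) = 0"
    and "expectation (\<lambda>\<omega>. (\<beta> b \<omega> $ j - \<beta> a \<omega> $ j)\<^sup>2) = b - a"
proof -
  note D = increment_distributed[OF ab, of j]
  have pos: "0 < sqrt (b - a)" using ab by simp
  show "integrable M (\<lambda>\<omega>. \<beta> b \<omega> $ j - \<beta> a \<omega> $ j)"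
    by (rule distributed_integrable_var[OF D]) (use pos in \<open>auto intro: integrable_normal_moment_nz_1\<close>)
  show "integrable M (\<lambda>\<omega>. (\<beta> b \<omega> $ j - \<beta> a \<omega> $ j)\<^sup>2)"
    using distributed_integrable[OF D, of "\<lambda>x. x\<^sup>2"] integrable_normal_moment[OF pos, of 0 2] by simp
  show z: "expectation (\<lambda>\<omega>. \<beta> b \<omega> $ j - \<beta> a \<omega> $ j) = 0"
    by (rule normal_distributed_expectation[OF pos D])
  show "expectation (\<lambda>\<omega>. (\<beta> b \<omega> $ j - \<beta> a \<omega> $ j)\<^sup>2) = b - a"
    using normal_distributed_variance[OF pos D] ab unfolding z by simp
qed

lemma increment_indep_real:
  assumes ab: "0 \<le> a" "a < b" "b \<le> T" and U: "U \<in> borel_measurable (F a)"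
    and h: "h \<in> borel_measurable borel"
  shows "indep_var borel U borel (\<lambda>\<omega>. h (\<beta> b \<omega> $ j - \<beta> a \<omega> $ j) :: real)"
proof -
  have hj: "(\<lambda>x :: real ^ 'm. h (x $ j)) \<in> borel_measurable borel"
    by (intro measurable_compose[OF _ h]) auto
  have "(\<lambda>\<omega>. \<beta> b \<omega> - \<beta> a \<omega>) \<in> borel_measurable M"
    using beta_measurable[of a] beta_measurable[of b] ab by (intro borel_measurable_diff) auto
  from measurable_compose[OF this hj]
  have "(\<lambda>\<omega>. h (\<beta> b \<omega> $ j - \<beta> a \<omega> $ j)) \<in> borel_measurable M" by simp
  moreover have "U \<in> borel_measurable M" using U ab by (intro measurable_F_M[OF U]) auto
  ultimately show ?thesis
    using increment_joint_law[OF ab U hj] by (simp add: indep_var_distribution_eq)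
qed

text \<open>The Ito isometry for bounded integrands, together with the measurability and integrability that carry
its induction: in the square of the sum with one more term, the mixed product has mean zero because the
last increment is centred and independent of the past.\<close>

lemma simple_integral_isometry:
  assumes p: "0 \<le> p 0" "\<And>i. i < K \<Longrightarrow> p i < p (Suc i)" "p K \<le> T"
    and \<psi>: "\<And>i. i < K \<Longrightarrow> \<psi> i \<in> borel_measurable (F (p i))"
    and bnd: "\<And>i. i < K \<Longrightarrow> \<exists>C. \<forall>\<omega>\<in>space M. \<bar>\<psi> i \<omega>\<bar> \<le> C"
  shows "k \<le> K \<Longrightarrow> (\<lambda>\<omega>. \<Sum>i<k. \<psi> i \<omega> * (\<beta> (p (Suc i)) \<omega> $ j - \<beta> (p i) \<omega> $ j)) \<in> borel_measurable (F (p k)) \<and>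
    integrable M (\<lambda>\<omega>. (\<Sum>i<k. \<psi> i \<omega> * (\<beta> (p (Suc i)) \<omega> $ j - \<beta> (p i) \<omega> $ j))) \<and>
    integrable M (\<lambda>\<omega>. (\<Sum>i<k. \<psi> i \<omega> * (\<beta> (p (Suc i)) \<omega> $ j - \<beta> (p i) \<omega> $ j))\<^sup>2) \<and>
    expectation (\<lambda>\<omega>. (\<Sum>i<k. \<psi> i \<omega> * (\<beta> (p (Suc i)) \<omega> $ j - \<beta> (p i) \<omega> $ j))\<^sup>2) =
      expectation (\<lambda>\<omega>. \<Sum>i<k. (\<psi> i \<omega>)\<^sup>2 * (p (Suc i) - p i)) \<and>
    integrable M (\<lambda>\<omega>. \<Sum>i<k. (\<psi> i \<omega>)\<^sup>2 * (p (Suc i) - p i))"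
proof (induction k)
  case 0
  show ?case by simp
next
  case (Suc k)
  have mono: "p i \<le> p i'" if "i \<le> i'" "i' \<le> K" for i i'
    using increasing_seq_le_iff[of K p i i', OF p(2)] that by auto
  define S where "S \<omega> = (\<Sum>i<k. \<psi> i \<omega> * (\<beta> (p (Suc i)) \<omega> $ j - \<beta> (p i) \<omega> $ j))" for \<omega>
  define \<Delta> where "\<Delta> \<omega> = \<beta> (p (Suc k)) \<omega> $ j - \<beta> (p k) \<omega> $ j" for \<omega>
  have k: "k < K" using Suc.prems by simp
  have ab: "0 \<le> p k" "p k < p (Suc k)" "p (Suc k) \<le> T" "p k \<le> T"
    using p mono[of 0 k] mono[of "Suc k" K] mono[of k K] Suc.prems by auto
  from Suc.IH k have IH: "S \<in> borel_measurable (F (p k))" "integrable M S" "integrable M (\<lambda>\<omega>. (S \<omega>)\<^sup>2)"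
    "expectation (\<lambda>\<omega>. (S \<omega>)\<^sup>2) = expectation (\<lambda>\<omega>. \<Sum>i<k. (\<psi> i \<omega>)\<^sup>2 * (p (Suc i) - p i))"
    "integrable M (\<lambda>\<omega>. \<Sum>i<k. (\<psi> i \<omega>)\<^sup>2 * (p (Suc i) - p i))"
    by (auto simp: S_def[abs_def])
  note mom = increment_moments[OF ab(1-3), of j, folded \<Delta>_def]
  obtain C where C: "\<And>\<omega>. \<omega> \<in> space M \<Longrightarrow> \<bar>\<psi> k \<omega>\<bar> \<le> C" using bnd[OF k] by blast
  note \<psi>k = \<psi>[OF k] note \<psi>M = measurable_F_M[OF \<psi>k ab(4)] note SM = measurable_F_M[OF IH(1) ab(4)]
  have i\<psi>: "integrable M (\<psi> k)"
    by (rule integrable_const_bound[OF _ \<psi>M, of C]) (use C in auto)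
  have i\<psi>2: "integrable M (\<lambda>\<omega>. (\<psi> k \<omega>)\<^sup>2)"
  proof (rule integrable_const_bound[of _ "C\<^sup>2"])
    show "AE \<omega> in M. norm ((\<psi> k \<omega>)\<^sup>2) \<le> C\<^sup>2"
      using C by (intro AE_I2) (simp add: abs_le_square_iff[symmetric], metis abs_ge_self order_trans)
  qed (use \<psi>M in auto)
  have iS\<psi>: "integrable M (\<lambda>\<omega>. S \<omega> * \<psi> k \<omega>)"
  proof (rule Bochner_Integration.integrable_bound[of _ "\<lambda>\<omega>. C * S \<omega>"])
    show "AE \<omega> in M. norm (S \<omega> * \<psi> k \<omega>) \<le> norm (C * S \<omega>)"
    proof (intro AE_I2)
      fix \<omega> assume "\<omega> \<in> space M"
      then have "\<bar>\<psi> k \<omega>\<bar> \<le> \<bar>C\<bar>" using C[of \<omega>] by linarith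
      then show "norm (S \<omega> * \<psi> k \<omega>) \<le> norm (C * S \<omega>)"
        using mult_right_mono[of "\<bar>\<psi> k \<omega>\<bar>" "\<bar>C\<bar>" "\<bar>S \<omega>\<bar>"] by (simp add: abs_mult mult.commute)
    qed
  qed (use IH(2) \<psi>M SM in auto)
  have mS\<psi>: "(\<lambda>\<omega>. S \<omega> * \<psi> k \<omega>) \<in> borel_measurable (F (p k))"
    and m\<psi>2: "(\<lambda>\<omega>. (\<psi> k \<omega>)\<^sup>2) \<in> borel_measurable (F (p k))"
    using IH(1) \<psi>k by auto
  have id: "(\<lambda>x :: real. x) \<in> borel_measurable borel" and sq: "(\<lambda>x :: real. x\<^sup>2) \<in> borel_measurable borel" by auto
  note ind1 = increment_indep_real[OF ab(1-3) \<psi>k id, of j, folded \<Delta>_def]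
  note ind2 = increment_indep_real[OF ab(1-3) mS\<psi> id, of j, folded \<Delta>_def]
  note ind3 = increment_indep_real[OF ab(1-3) m\<psi>2 sq, of j, folded \<Delta>_def]
  have i1: "integrable M (\<lambda>\<omega>. \<psi> k \<omega> * \<Delta> \<omega>)"
    by (rule indep_var_integrable[OF ind1 i\<psi> mom(1)])
  have i2: "integrable M (\<lambda>\<omega>. S \<omega> * \<psi> k \<omega> * \<Delta> \<omega>)" and e2: "expectation (\<lambda>\<omega>. S \<omega> * \<psi> k \<omega> * \<Delta> \<omega>) = 0"
    using indep_var_integrable[OF ind2 iS\<psi> mom(1)] indep_var_lebesgue_integral[OF ind2 iS\<psi> mom(1)] mom(3)
    by auto
  have i3: "integrable M (\<lambda>\<omega>. (\<psi> k \<omega>)\<^sup>2 * (\<Delta> \<omega>)\<^sup>2)"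
    and e3: "expectation (\<lambda>\<omega>. (\<psi> k \<omega>)\<^sup>2 * (\<Delta> \<omega>)\<^sup>2) = expectation (\<lambda>\<omega>. (\<psi> k \<omega>)\<^sup>2) * (p (Suc k) - p k)"
    using indep_var_integrable[OF ind3 i\<psi>2 mom(2)] indep_var_lebesgue_integral[OF ind3 i\<psi>2 mom(2)] mom(4)
    by auto
  have sq_eq: "(S \<omega> + \<psi> k \<omega> * \<Delta> \<omega>)\<^sup>2 = (S \<omega>)\<^sup>2 + 2 * (S \<omega> * \<psi> k \<omega> * \<Delta> \<omega>) + (\<psi> k \<omega>)\<^sup>2 * (\<Delta> \<omega>)\<^sup>2" for \<omega>
    by (simp add: power2_eq_square algebra_simps)
  have Suc_eq: "(\<Sum>i<Suc k. \<psi> i \<omega> * (\<beta> (p (Suc i)) \<omega> $ j - \<beta> (p i) \<omega> $ j)) = S \<omega> + \<psi> k \<omega> * \<Delta> \<omega>" for \<omega>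
    by (simp add: S_def \<Delta>_def)
  have "(\<lambda>\<omega>. S \<omega> + \<psi> k \<omega> * \<Delta> \<omega>) \<in> borel_measurable (F (p (Suc k)))"
  proof -
    have vn: "(\<lambda>x :: real ^ 'm. x $ j) \<in> borel_measurable borel" by auto
    have "\<Delta> \<in> borel_measurable (F (p (Suc k)))"
      unfolding \<Delta>_def using beta_measurable_F[of "p (Suc k)" "p (Suc k)"] beta_measurable_F[of "p k" "p (Suc k)"] ab
      by (intro borel_measurable_diff measurable_compose[OF _ vn]) auto
    then show ?thesis
      using measurable_F_mono[OF IH(1), of "p (Suc k)"] measurable_F_mono[OF \<psi>k, of "p (Suc k)"] ab by auto
  qed
  moreover have "integrable M (\<lambda>\<omega>. S \<omega> + \<psi> k \<omega> * \<Delta> \<omega>)" using IH(2) i1 by simp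
  moreover have "integrable M (\<lambda>\<omega>. (S \<omega> + \<psi> k \<omega> * \<Delta> \<omega>)\<^sup>2)"
    unfolding sq_eq using IH(3) i2 i3 by simp
  moreover have "expectation (\<lambda>\<omega>. (S \<omega> + \<psi> k \<omega> * \<Delta> \<omega>)\<^sup>2) =
      expectation (\<lambda>\<omega>. (\<Sum>i<k. (\<psi> i \<omega>)\<^sup>2 * (p (Suc i) - p i)) + (\<psi> k \<omega>)\<^sup>2 * (p (Suc k) - p k))"
    unfolding sq_eq using IH(3,4,5) i2 i3 e2 e3 i\<psi>2 by simp
  moreover have "integrable M (\<lambda>\<omega>. (\<Sum>i<k. (\<psi> i \<omega>)\<^sup>2 * (p (Suc i) - p i)) + (\<psi> k \<omega>)\<^sup>2 * (p (Suc k) - p k))"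
    using IH(5) i\<psi>2 by simp
  ultimately show ?case unfolding Suc_eq by simp
qed

text \<open>Setting the integrand to zero from the moment at which its accumulated square exceeds \<open>c\<close> changes
nothing on the event that the total stays below \<open>c\<close>, and it makes the integrand bounded and its
accumulated square at most \<open>c\<close>; the isometry and Chebyshev's inequality then apply. The accumulated
square includes the current step, which is known at its beginning.\<close>

lemma simple_integral_tail_bound:
  assumes p: "0 \<le> p 0" "\<And>i. i < K \<Longrightarrow> p i < p (Suc i)" "p K \<le> T"
    and \<phi>: "\<And>i. i < K \<Longrightarrow> \<phi> i \<in> borel_measurable (F (p i))"
    and c: "0 < c" "0 < a"
  shows "prob {\<omega> \<in> space M. a < \<bar>\<Sum>i<K. \<phi> i \<omega> * (\<beta> (p (Suc i)) \<omega> $ j - \<beta> (p i) \<omega> $ j)\<bar>} \<le>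
    prob {\<omega> \<in> space M. c < (\<Sum>i<K. (\<phi> i \<omega>)\<^sup>2 * (p (Suc i) - p i))} + c / a\<^sup>2"
proof -
  have mono: "p i \<le> p i'" if "i \<le> i'" "i' \<le> K" for i i'
    using increasing_seq_le_iff[of K p i i', OF p(2)] that by auto
  define Q where "Q i \<omega> = (\<Sum>l<i. (\<phi> l \<omega>)\<^sup>2 * (p (Suc l) - p l))" for i \<omega>
  define \<psi> where "\<psi> i \<omega> = (if Q (Suc i) \<omega> \<le> c then \<phi> i \<omega> else 0)" for i \<omega>
  have term_nn: "0 \<le> (\<phi> l \<omega>)\<^sup>2 * (p (Suc l) - p l)" if "l < K" for l \<omega>
    using p(2)[OF that] by simp
  have Q_mono: "Q i \<omega> \<le> Q i' \<omega>" if "i \<le> i'" "i' \<le> K" for i i' \<omega>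
    unfolding Q_def using that by (intro sum_mono2) (auto intro!: term_nn)
  have Q_meas: "Q i \<in> borel_measurable (F (p i'))" if "i \<le> Suc i'" "i' < K" for i i'
    unfolding Q_def using that
    by (intro borel_measurable_sum borel_measurable_times borel_measurable_power borel_measurable_const
        measurable_F_mono[OF \<phi> mono]) auto
  have \<psi>_meas: "\<psi> i \<in> borel_measurable (F (p i))" if "i < K" for i
  proof -
    have [measurable]: "Q (Suc i) \<in> borel_measurable (F (p i))" "\<phi> i \<in> borel_measurable (F (p i))"
      using Q_meas[of "Suc i" i] \<phi> that by auto
    show ?thesis unfolding \<psi>_def by measurable
  qed
  have \<psi>_bnd: "\<exists>C. \<forall>\<omega>\<in>space M. \<bar>\<psi> i \<omega>\<bar> \<le> C" if i: "i < K" for i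
  proof (intro exI ballI)
    fix \<omega>
    show "\<bar>\<psi> i \<omega>\<bar> \<le> sqrt (c / (p (Suc i) - p i))"
    proof (cases "Q (Suc i) \<omega> \<le> c")
      case True
      have "0 \<le> Q i \<omega>" using Q_mono[of 0 i \<omega>] i by (simp add: Q_def)
      then have "(\<phi> i \<omega>)\<^sup>2 * (p (Suc i) - p i) \<le> c" using True by (simp add: Q_def)
      then have "(\<phi> i \<omega>)\<^sup>2 \<le> c / (p (Suc i) - p i)" using p(2)[OF i] by (simp add: pos_le_divide_eq)
      then show ?thesis using True by (simp add: \<psi>_def real_le_rsqrt)
    next
      case False
      then show ?thesis using c p(2)[OF i] by (simp add: \<psi>_def)
    qed
  qed
  have \<psi>_le: "(\<Sum>i<k. (\<psi> i \<omega>)\<^sup>2 * (p (Suc i) - p i)) \<le> c" if "k \<le> K" for k \<omega>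
    using that
  proof (induction k)
    case (Suc k)
    show ?case
    proof (cases "Q (Suc k) \<omega> \<le> c")
      case True
      have "\<psi> i \<omega> = \<phi> i \<omega>" if "i < Suc k" for i
        using Q_mono[of "Suc i" "Suc k" \<omega>] True that Suc.prems by (auto simp: \<psi>_def)
      then have "(\<Sum>i<Suc k. (\<psi> i \<omega>)\<^sup>2 * (p (Suc i) - p i)) = Q (Suc k) \<omega>" unfolding Q_def by (intro sum.cong) auto
      then show ?thesis using True by simp
    next
      case False
      then show ?thesis using Suc by (simp add: \<psi>_def)
    qed
  qed (use c in simp)
  define S where "S \<omega> = (\<Sum>i<K. \<psi> i \<omega> * (\<beta> (p (Suc i)) \<omega> $ j - \<beta> (p i) \<omega> $ j))" for \<omega>
  define R where "R \<omega> = (\<Sum>i<K. \<phi> i \<omega> * (\<beta> (p (Suc i)) \<omega> $ j - \<beta> (p i) \<omega> $ j))" for \<omega>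
  note iso = simple_integral_isometry[where \<psi> = \<psi> and k = K and j = j, OF p \<psi>_meas \<psi>_bnd order_refl, folded S_def]
  have SM: "S \<in> borel_measurable M"
    using iso unfolding S_def[abs_def, symmetric] by (auto intro: measurable_F_M[OF _ p(3)])
  have iS: "integrable M (\<lambda>\<omega>. (S \<omega>)\<^sup>2)" and iQ: "integrable M (\<lambda>\<omega>. \<Sum>i<K. (\<psi> i \<omega>)\<^sup>2 * (p (Suc i) - p i))"
    and eS: "expectation (\<lambda>\<omega>. (S \<omega>)\<^sup>2) = expectation (\<lambda>\<omega>. \<Sum>i<K. (\<psi> i \<omega>)\<^sup>2 * (p (Suc i) - p i))"
    using iso by (auto simp: S_def[abs_def])
  have "expectation (\<lambda>\<omega>. (S \<omega>)\<^sup>2) \<le> expectation (\<lambda>_. c)"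
    unfolding eS using iQ \<psi>_le by (intro integral_mono) auto
  then have ES: "expectation (\<lambda>\<omega>. (S \<omega>)\<^sup>2) \<le> c" by (simp add: prob_space)
  have mA: "{\<omega> \<in> space M. a < \<bar>S \<omega>\<bar>} \<in> events" using SM by measurable
  have "prob {\<omega> \<in> space M. a < \<bar>S \<omega>\<bar>} = expectation (indicator {\<omega> \<in> space M. a < \<bar>S \<omega>\<bar>})"
    using mA by simp
  also have "\<dots> \<le> expectation (\<lambda>\<omega>. (S \<omega>)\<^sup>2 / a\<^sup>2)"
  proof (rule integral_mono)
    fix \<omega> assume "\<omega> \<in> space M"
    have "a\<^sup>2 \<le> (S \<omega>)\<^sup>2" if "a < \<bar>S \<omega>\<bar>"
      using that c by (simp add: abs_le_square_iff[symmetric])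
    then show "indicator {\<omega> \<in> space M. a < \<bar>S \<omega>\<bar>} \<omega> \<le> (S \<omega>)\<^sup>2 / a\<^sup>2"
      using c by (auto simp: indicator_def pos_le_divide_eq)
  qed (use iS mA in \<open>auto intro!: integrable_real_indicator simp: less_top[symmetric]\<close>)
  also have "\<dots> \<le> c / a\<^sup>2" using ES c by (simp add: divide_right_mono)
  finally have cheb: "prob {\<omega> \<in> space M. a < \<bar>S \<omega>\<bar>} \<le> c / a\<^sup>2" .
  have QK: "Q K \<in> borel_measurable M"
    unfolding Q_def
  proof (intro borel_measurable_sum borel_measurable_times borel_measurable_power borel_measurable_const)
    fix i assume "i \<in> {..<K}"
    then show "\<phi> i \<in> borel_measurable M" using \<phi>[of i] mono[of i K] p(3) by (auto intro: measurable_F_M)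
  qed
  have mB: "{\<omega> \<in> space M. c < Q K \<omega>} \<in> events" using QK by measurable
  have "{\<omega> \<in> space M. a < \<bar>R \<omega>\<bar>} \<subseteq> {\<omega> \<in> space M. c < Q K \<omega>} \<union> {\<omega> \<in> space M. a < \<bar>S \<omega>\<bar>}"
  proof (safe)
    fix \<omega> assume w: "\<omega> \<in> space M" "a < \<bar>R \<omega>\<bar>" "\<not> a < \<bar>S \<omega>\<bar>"
    show "c < Q K \<omega>"
    proof (rule ccontr)
      assume "\<not> c < Q K \<omega>"
      then have "\<psi> i \<omega> = \<phi> i \<omega>" if "i < K" for i
        using Q_mono[of "Suc i" K \<omega>] that by (auto simp: \<psi>_def)
      then have "S \<omega> = R \<omega>" unfolding S_def R_def by (intro sum.cong) auto
      then show False using w by simp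
    qed
  qed
  then have "prob {\<omega> \<in> space M. a < \<bar>R \<omega>\<bar>} \<le> prob ({\<omega> \<in> space M. c < Q K \<omega>} \<union> {\<omega> \<in> space M. a < \<bar>S \<omega>\<bar>})"
    using mA mB by (intro finite_measure_mono) auto
  also have "\<dots> \<le> prob {\<omega> \<in> space M. c < Q K \<omega>} + prob {\<omega> \<in> space M. a < \<bar>S \<omega>\<bar>}"
    by (rule measure_Un_le[OF mB mA])
  finally show ?thesis using cheb unfolding R_def Q_def by simp
qed

end

lemma refine_indicator:
  fixes p w :: "nat \<Rightarrow> real"
  assumes p: "\<And>i. i < K \<Longrightarrow> p i < p (Suc i)" and ab: "\<alpha> \<le> \<beta>" "\<beta> \<le> K"
  shows "(\<Sum>i<K. indicator {p \<alpha><..p \<beta>} (p (Suc i)) * (w (Suc i) - w i)) = w \<beta> - w \<alpha>"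
proof -
  have "indicator {p \<alpha><..p \<beta>} (p (Suc i)) = (if i \<in> {\<alpha>..<\<beta>} then 1 else (0 :: real))" if "i < K" for i
    using increasing_seq_less_iff[of K p \<alpha> "Suc i", OF p] increasing_seq_le_iff[of K p "Suc i" \<beta>, OF p] ab that
    by (auto simp: indicator_def)
  then have "(\<Sum>i<K. indicator {p \<alpha><..p \<beta>} (p (Suc i)) * (w (Suc i) - w i)) =
      (\<Sum>i<K. if i \<in> {\<alpha>..<\<beta>} then w (Suc i) - w i else 0)"
    by (intro sum.cong) auto
  also have "\<dots> = (\<Sum>i\<in>{\<alpha>..<\<beta>}. w (Suc i) - w i)"
    using ab by (subst sum.inter_restrict[symmetric]) (auto intro!: sum.cong)
  also have "\<dots> = w \<beta> - w \<alpha>" using ab(1) by (rule sum_Suc_diff')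
  finally show ?thesis .
qed

text \<open>Processes on different subdivisions can be subtracted after refining both; on the finer subdivision
  the additional increments telescope, and the process is read off at right end points because its
  intervals are closed on the right.\<close>

lemma simple_integral_refine:
  assumes p: "\<And>i. i < K \<Longrightarrow> p i < p (Suc i)"
    and s: "\<And>i. i < k \<Longrightarrow> s i < s (Suc i)" "s ` {..k} \<subseteq> p ` {..K}"
  shows "simple_integral W k s \<xi> \<omega> =
    (\<Sum>i<K. simple_value k s \<xi> (p (Suc i)) \<omega> * (W (p (Suc i)) \<omega> - W (p i) \<omega>))"
proof -
  have "\<exists>j\<le>K. s l = p j" if "l \<le> k" for l using s(2) that by (auto simp: image_subset_iff)
  then obtain f where f: "\<And>l. l \<le> k \<Longrightarrow> f l \<le> K \<and> s l = p (f l)" by metis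
  have fle: "f l \<le> f (Suc l)" if "l < k" for l
    using f[of l] f[of "Suc l"] s(1)[OF that] increasing_seq_less_iff[of K p "f l" "f (Suc l)", OF p] that by auto
  have "(\<Sum>i<K. simple_value k s \<xi> (p (Suc i)) \<omega> * (W (p (Suc i)) \<omega> - W (p i) \<omega>)) =
    (\<Sum>l<k. \<Sum>i<K. \<xi> l \<omega> * (indicator {s l<..s (Suc l)} (p (Suc i)) * (W (p (Suc i)) \<omega> - W (p i) \<omega>)))"
    unfolding simple_value_def sum_distrib_right by (subst sum.swap) (simp add: mult.assoc)
  also have "\<dots> = (\<Sum>l<k. \<xi> l \<omega> * (W (s (Suc l)) \<omega> - W (s l) \<omega>))"
  proof (rule sum.cong)
    fix l assume l: "l \<in> {..<k}"
    then have "(\<Sum>i<K. indicator {s l<..s (Suc l)} (p (Suc i)) * (W (p (Suc i)) \<omega> - W (p i) \<omega>)) =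
        W (s (Suc l)) \<omega> - W (s l) \<omega>"
      using refine_indicator[of K p "f l" "f (Suc l)" "\<lambda>i. W (p i) \<omega>", OF p] f[of l] f[of "Suc l"] fle[of l] by simp
    then show "(\<Sum>i<K. \<xi> l \<omega> * (indicator {s l<..s (Suc l)} (p (Suc i)) * (W (p (Suc i)) \<omega> - W (p i) \<omega>))) =
        \<xi> l \<omega> * (W (s (Suc l)) \<omega> - W (s l) \<omega>)" by (simp add: sum_distrib_left[symmetric])
  qed simp
  finally show ?thesis by (simp add: simple_integral_def)
qed

lemma simple_value_refine:
  assumes p: "\<And>i. i < K \<Longrightarrow> p i < p (Suc i)"
    and s: "s ` {..k} \<subseteq> p ` {..K}" and i: "i < K" and u: "p i < u" "u \<le> p (Suc i)"
  shows "simple_value k s \<xi> u \<omega> = simple_value k s \<xi> (p (Suc i)) \<omega>"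
proof -
  have "\<exists>j\<le>K. s l = p j" if "l \<le> k" for l using s that by (auto simp: image_subset_iff)
  then obtain f where f: "\<And>l. l \<le> k \<Longrightarrow> f l \<le> K \<and> s l = p (f l)" by metis
  have "s l < u \<longleftrightarrow> s l < p (Suc i)" if "l \<le> k" for l
    using f[OF that] u i increasing_seq_le_iff[of K p "f l" i, OF p] increasing_seq_less_iff[of K p "f l" "Suc i", OF p] by auto
  then have "indicator {s l<..s (Suc l)} u = (indicator {s l<..s (Suc l)} (p (Suc i)) :: real)" if "l < k" for l
    using that by (simp add: indicator_def not_less[symmetric])
  then show ?thesis unfolding simple_value_def by (intro sum.cong) auto
qed

lemma step_integral_le:
  fixes p v :: "nat \<Rightarrow> real" and g :: "real \<Rightarrow> ennreal"
  assumes p: "\<And>i. i < K \<Longrightarrow> p i < p (Suc i)" "0 \<le> p 0" "p K \<le> t"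
    and le: "\<And>i u. i < K \<Longrightarrow> p i < u \<Longrightarrow> u \<le> p (Suc i) \<Longrightarrow> ennreal ((v i)\<^sup>2) \<le> g u"
  shows "ennreal (\<Sum>i<K. (v i)\<^sup>2 * (p (Suc i) - p i)) \<le> (\<integral>\<^sup>+u\<in>{0..t}. g u \<partial>lborel)"
proof -
  have "ennreal (\<Sum>i<K. (v i)\<^sup>2 * (p (Suc i) - p i)) = (\<Sum>i<K. ennreal ((v i)\<^sup>2) * ennreal (p (Suc i) - p i))"
    using p(1) by (subst sum_ennreal[symmetric]) (auto simp: ennreal_mult less_imp_le intro!: mult_nonneg_nonneg sum.cong)
  also have "\<dots> = (\<Sum>i<K. \<integral>\<^sup>+u. ennreal ((v i)\<^sup>2) * indicator {p i<..p (Suc i)} u \<partial>lborel)"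
    using p(1) by (intro sum.cong) (auto simp: nn_integral_cmult_indicator less_imp_le)
  also have "\<dots> = (\<integral>\<^sup>+u. (\<Sum>i<K. ennreal ((v i)\<^sup>2) * indicator {p i<..p (Suc i)} u) \<partial>lborel)"
    by (subst nn_integral_sum) auto
  also have "\<dots> \<le> (\<integral>\<^sup>+u\<in>{0..t}. g u \<partial>lborel)"
  proof (rule nn_integral_mono)
    fix u
    show "(\<Sum>i<K. ennreal ((v i)\<^sup>2) * indicator {p i<..p (Suc i)} u) \<le> g u * indicator {0..t} u"
    proof (cases "\<exists>i<K. u \<in> {p i<..p (Suc i)}")
      case True
      then obtain i where i: "i < K" "p i < u" "u \<le> p (Suc i)" by auto
      have "indicator {p i'<..p (Suc i')} u = (0 :: ennreal)" if "i' < K" "i' \<noteq> i" for i'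
        using i that increasing_seq_le_iff[of K p "Suc i'" i, OF p(1)] increasing_seq_le_iff[of K p "Suc i" i', OF p(1)]
        by (auto simp: indicator_def not_less_eq_eq)
      then have "(\<Sum>i'<K. ennreal ((v i')\<^sup>2) * indicator {p i'<..p (Suc i')} u) =
          (\<Sum>i'<K. if i' = i then ennreal ((v i)\<^sup>2) else 0)"
        using i by (intro sum.cong) auto
      also have "\<dots> = ennreal ((v i)\<^sup>2)" using i by simp
      also have "\<dots> \<le> g u" using le i by blast
      also have "g u = g u * indicator {0..t} u"
        using i p increasing_seq_le_iff[of K p 0 i, OF p(1)] increasing_seq_le_iff[of K p "Suc i" K, OF p(1)]
        by (auto simp: indicator_def)
      finally show ?thesis .
    next
      case False
      then have "(\<Sum>i<K. ennreal ((v i)\<^sup>2) * indicator {p i<..p (Suc i)} u) = 0"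
        by (intro sum.neutral) (auto simp: indicator_def)
      then show ?thesis by simp
    qed
  qed
  finally show ?thesis .
qed

text \<open>The value on \<open>(p i, p (i + 1)]\<close> was already determined at the left end of an interval of the coarser
subdivision, that is, not later than \<open>p i\<close>.\<close>

lemma (in brownian_with_initial) simple_value_measurable:
  assumes sp: "simple_process M F t k s \<xi>"
    and p: "\<And>i. i < K \<Longrightarrow> p i < p (Suc i)" and s: "s ` {..k} \<subseteq> p ` {..K}" and i: "i < K"
  shows "simple_value k s \<xi> (p (Suc i)) \<in> borel_measurable (F (p i))"
proof -
  have "(\<lambda>\<omega>. \<xi> l \<omega> * indicator {s l<..s (Suc l)} (p (Suc i))) \<in> borel_measurable (F (p i))" if l: "l < k" for l
  proof (cases "s l < p (Suc i)")
    case True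
    have "s l \<in> p ` {..K}" using s l by (meson atMost_iff image_subset_iff less_imp_le)
    then obtain j where "j \<le> K" "s l = p j" by blast
    then have "s l \<le> p i"
      using True i increasing_seq_le_iff[of K p j i, OF p] increasing_seq_less_iff[of K p j "Suc i", OF p] by auto
    moreover have "\<xi> l \<in> borel_measurable (F (s l))" using sp l by (simp add: simple_process_def)
    ultimately have "\<xi> l \<in> borel_measurable (F (p i))" by (rule measurable_F_mono[rotated])
    then show ?thesis by simp
  qed simp
  then show ?thesis unfolding simple_value_def by (intro borel_measurable_sum) auto
qed

section \<open>Increments of Ito integrals over short intervals\<close>

context brownian_with_initial
begin

text \<open>Let \<open>\<phi>\<close> and \<open>\<psi>\<close> approximate \<open>H\<close> on \<open>[0, t]\<close> and on \<open>[0, s]\<close>. The error in question is close to the integral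
of \<open>\<phi> - \<psi> - H\<^sub>s 1\<^bsub>(s, t]\<^esub>\<close>, a simple process up to boundedness, whose square integral is small: on
\<open>[0, s]\<close> both approximations are close to \<open>H\<close>, and on \<open>(s, t]\<close> the process is close to \<open>H - H\<^sub>s\<close>. The tail
bound for simple integrals applies, and the approximation errors disappear in the limit.\<close>

lemma ito_increment_bound:
  assumes st: "0 \<le> s" "s < t" "t \<le> T"
    and cont: "AE \<omega> in M. continuous_on {0..T} (\<lambda>u. H u \<omega>)"
    and Hs: "H s \<in> borel_measurable (F s)"
    and Zt: "has_ito_integral M F (\<lambda>u \<omega>. \<beta> u \<omega> $ j) t H Zt"
    and Zs: "has_ito_integral M F (\<lambda>u \<omega>. \<beta> u \<omega> $ j) s H Zs"
    and B: "B \<in> events" "AE \<omega> in M. \<omega> \<notin> B \<longrightarrow> (\<forall>u\<in>{s..t}. \<bar>H u \<omega> - H s \<omega>\<bar> \<le> \<rho>)"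
    and pos: "0 < \<rho>" "0 < a"
  shows "prob {\<omega> \<in> space M. 3 * a < \<bar>Zt \<omega> - Zs \<omega> - H s \<omega> * (\<beta> t \<omega> $ j - \<beta> s \<omega> $ j)\<bar>} \<le>
    prob B + 6 * \<rho>\<^sup>2 * (t - s) / a\<^sup>2"
proof -
  let ?W = "\<lambda>u \<omega>. \<beta> u \<omega> $ j"
  define D where "D \<omega> = Zt \<omega> - Zs \<omega> - H s \<omega> * (\<beta> t \<omega> $ j - \<beta> s \<omega> $ j)" for \<omega>
  define e where "e = \<rho>\<^sup>2 * (t - s)"
  have e: "e > 0" using st pos by (simp add: e_def)
  have en: "ennreal (2 * x + 2 * y) = 2 * ennreal x + 2 * ennreal y" if "0 \<le> x" "0 \<le> y" for x y
    using that by (simp add: ennreal_mult)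
  obtain k1 s1 \<xi>1 where sp1: "\<And>l. simple_process M F t (k1 l) (s1 l) (\<xi>1 l)"
    and lim1: "tendsto_zero_in_prob M
          (\<lambda>l \<omega>. \<integral>\<^sup>+u\<in>{0..t}. ennreal ((H u \<omega> - simple_value (k1 l) (s1 l) (\<xi>1 l) u \<omega>)\<^sup>2) \<partial>lborel)"
    and lim3: "tendsto_zero_in_prob M (\<lambda>l \<omega>. ennreal \<bar>Zt \<omega> - simple_integral ?W (k1 l) (s1 l) (\<xi>1 l) \<omega>\<bar>)"
    and Zt_meas: "Zt \<in> borel_measurable M"
    using Zt unfolding has_ito_integral_def by blast
  obtain k2 s2 \<xi>2 where sp2: "\<And>l. simple_process M F s (k2 l) (s2 l) (\<xi>2 l)"
    and lim2: "tendsto_zero_in_prob M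
          (\<lambda>l \<omega>. \<integral>\<^sup>+u\<in>{0..s}. ennreal ((H u \<omega> - simple_value (k2 l) (s2 l) (\<xi>2 l) u \<omega>)\<^sup>2) \<partial>lborel)"
    and lim4: "tendsto_zero_in_prob M (\<lambda>l \<omega>. ennreal \<bar>Zs \<omega> - simple_integral ?W (k2 l) (s2 l) (\<xi>2 l) \<omega>\<bar>)"
    and Zs_meas: "Zs \<in> borel_measurable M"
    using Zs unfolding has_ito_integral_def by blast
  have epos: "0 < ennreal e" "0 < ennreal a" using e pos by auto
  obtain A1 where A1: "\<And>l. A1 l \<in> events" "(\<lambda>l. prob (A1 l)) \<longlonglongrightarrow> 0" "\<And>l. {\<omega> \<in> space M. ennreal e <
      (\<integral>\<^sup>+u\<in>{0..t}. ennreal ((H u \<omega> - simple_value (k1 l) (s1 l) (\<xi>1 l) u \<omega>)\<^sup>2) \<partial>lborel)} \<subseteq> A1 l"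
    using lim1[unfolded tendsto_zero_in_prob_def, rule_format, OF epos(1)] by blast
  obtain A2 where A2: "\<And>l. A2 l \<in> events" "(\<lambda>l. prob (A2 l)) \<longlonglongrightarrow> 0" "\<And>l. {\<omega> \<in> space M. ennreal e <
      (\<integral>\<^sup>+u\<in>{0..s}. ennreal ((H u \<omega> - simple_value (k2 l) (s2 l) (\<xi>2 l) u \<omega>)\<^sup>2) \<partial>lborel)} \<subseteq> A2 l"
    using lim2[unfolded tendsto_zero_in_prob_def, rule_format, OF epos(1)] by blast
  obtain A3 where A3: "\<And>l. A3 l \<in> events" "(\<lambda>l. prob (A3 l)) \<longlonglongrightarrow> 0" "\<And>l. {\<omega> \<in> space M. ennreal a <
      ennreal \<bar>Zt \<omega> - simple_integral ?W (k1 l) (s1 l) (\<xi>1 l) \<omega>\<bar>} \<subseteq> A3 l"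
    using lim3[unfolded tendsto_zero_in_prob_def, rule_format, OF epos(2)] by blast
  obtain A4 where A4: "\<And>l. A4 l \<in> events" "(\<lambda>l. prob (A4 l)) \<longlonglongrightarrow> 0" "\<And>l. {\<omega> \<in> space M. ennreal a <
      ennreal \<bar>Zs \<omega> - simple_integral ?W (k2 l) (s2 l) (\<xi>2 l) \<omega>\<bar>} \<subseteq> A4 l"
    using lim4[unfolded tendsto_zero_in_prob_def, rule_format, OF epos(2)] by blast
  have sT: "s \<le> T" using st by simp
  have D_meas: "D \<in> borel_measurable M"
  proof -
    have vn: "(\<lambda>x :: real ^ 'm. x $ j) \<in> borel_measurable borel" by auto
    have "(\<lambda>\<omega>. \<beta> u \<omega> $ j) \<in> borel_measurable M" if "0 \<le> u" "u \<le> T" for u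
      using measurable_compose[OF beta_measurable[OF that] vn] .
    then show ?thesis
      unfolding D_def using Zt_meas Zs_meas measurable_F_M[OF Hs sT] st
      by (intro borel_measurable_diff borel_measurable_times) auto
  qed
  have mD: "{\<omega> \<in> space M. 3 * a < \<bar>D \<omega>\<bar>} \<in> events" using D_meas by measurable
  have step: "prob {\<omega> \<in> space M. 3 * a < \<bar>D \<omega>\<bar>} \<le>
      prob (A1 l) + prob (A2 l) + prob (A3 l) + prob (A4 l) + (prob B + 6 * e / a\<^sup>2)" for l
  proof -
    let ?S = "s1 l ` {..k1 l} \<union> s2 l ` {..k2 l} \<union> {s, t}"
    obtain p K where pS: "p ` {..K} = ?S" and p: "\<And>i. i < K \<Longrightarrow> p i < p (Suc i)"
      by (rule finite_set_increasing_enumeration[of ?S]) auto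
    have mono1: "s1 l i \<le> s1 l i'" if "i \<le> i'" "i' \<le> k1 l" for i i'
      using increasing_seq_le_iff[of "k1 l" "s1 l" i i'] sp1[of l] that by (auto simp: simple_process_def)
    have mono2: "s2 l i \<le> s2 l i'" if "i \<le> i'" "i' \<le> k2 l" for i i'
      using increasing_seq_le_iff[of "k2 l" "s2 l" i i'] sp2[of l] that by (auto simp: simple_process_def)
    have rng1: "s1 l i \<in> {0..t}" if "i \<le> k1 l" for i
      using mono1[of 0 i] mono1[of i "k1 l"] sp1[of l] that by (auto simp: simple_process_def)
    have rng2: "s2 l i \<in> {0..s}" if "i \<le> k2 l" for i
      using mono2[of 0 i] mono2[of i "k2 l"] sp2[of l] that by (auto simp: simple_process_def)
    have Srng: "?S \<subseteq> {0..t}" using rng1 rng2 st by force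
    have prng: "p i \<in> {0..t}" if "i \<le> K" for i
      using pS Srng that by blast
    define \<zeta> where "\<zeta> u \<omega> = simple_value (k1 l) (s1 l) (\<xi>1 l) u \<omega> - simple_value (k2 l) (s2 l) (\<xi>2 l) u \<omega>
        - H s \<omega> * indicator {s<..t} u" for u \<omega>
    have "s \<in> p ` {..K}" "t \<in> p ` {..K}" unfolding pS by auto
    then obtain is' it where is': "is' \<le> K" "p is' = s" and it: "it \<le> K" "p it = t"
      by (elim imageE) auto
    have isit: "is' \<le> it" using increasing_seq_less_iff[of K p is' it, OF p] is' it st by auto
    have sub1: "s1 l ` {..k1 l} \<subseteq> p ` {..K}" and sub2: "s2 l ` {..k2 l} \<subseteq> p ` {..K}" using pS by auto
    have R: "(\<Sum>i<K. \<zeta> (p (Suc i)) \<omega> * (?W (p (Suc i)) \<omega> - ?W (p i) \<omega>)) =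
        simple_integral ?W (k1 l) (s1 l) (\<xi>1 l) \<omega> - simple_integral ?W (k2 l) (s2 l) (\<xi>2 l) \<omega>
        - H s \<omega> * (?W t \<omega> - ?W s \<omega>)" for \<omega>
    proof -
      have i1: "simple_integral ?W (k1 l) (s1 l) (\<xi>1 l) \<omega> =
        (\<Sum>i<K. simple_value (k1 l) (s1 l) (\<xi>1 l) (p (Suc i)) \<omega> * (?W (p (Suc i)) \<omega> - ?W (p i) \<omega>))"
        by (rule simple_integral_refine[OF p _ sub1]) (use sp1[of l] in \<open>auto simp: simple_process_def\<close>)
      have i2: "simple_integral ?W (k2 l) (s2 l) (\<xi>2 l) \<omega> =
        (\<Sum>i<K. simple_value (k2 l) (s2 l) (\<xi>2 l) (p (Suc i)) \<omega> * (?W (p (Suc i)) \<omega> - ?W (p i) \<omega>))"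
        by (rule simple_integral_refine[OF p _ sub2]) (use sp2[of l] in \<open>auto simp: simple_process_def\<close>)
      have i3: "(\<Sum>i<K. indicator {s<..t} (p (Suc i)) * (?W (p (Suc i)) \<omega> - ?W (p i) \<omega>)) = ?W t \<omega> - ?W s \<omega>"
        using refine_indicator[of K p is' it "\<lambda>i. ?W (p i) \<omega>", OF p isit it(1)] is' it by simp
      show ?thesis
        unfolding i1 i2 i3[symmetric] \<zeta>_def
        by (simp add: sum_distrib_left sum_subtractf[symmetric] algebra_simps)
    qed
    have \<zeta>_meas: "\<zeta> (p (Suc i)) \<in> borel_measurable (F (p i))" if i: "i < K" for i
    proof -
      have "(\<lambda>\<omega>. H s \<omega> * indicator {s<..t} (p (Suc i))) \<in> borel_measurable (F (p i))"
      proof (cases "s < p (Suc i)")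
        case True
        then have "s \<le> p i"
          using is' i increasing_seq_less_iff[of K p is' "Suc i", OF p] increasing_seq_le_iff[of K p is' i, OF p] by auto
        then have "H s \<in> borel_measurable (F (p i))" by (rule measurable_F_mono[OF Hs])
        then show ?thesis by simp
      qed simp
      then show ?thesis
        unfolding \<zeta>_def
        using simple_value_measurable[OF sp1 p sub1 i] simple_value_measurable[OF sp2 p sub2 i]
        by (intro borel_measurable_diff) auto
    qed
    have p0: "0 \<le> p 0" "p K \<le> t" "p K \<le> T" using prng[of 0] prng[of K] st by auto
    define V where "V \<omega> = (\<Sum>i<K. (\<zeta> (p (Suc i)) \<omega>)\<^sup>2 * (p (Suc i) - p i))" for \<omega>
    \<comment> \<open>each of the three contributions \<open>2 g1\<close>, \<open>2 g2\<close>, \<open>2 g3\<close> below integrates to at most \<open>2 e\<close>\<close>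
    have V_AE: "AE \<omega> in M. 6 * e < V \<omega> \<longrightarrow> \<omega> \<in> A1 l \<union> A2 l \<union> B"
      using cont B(2) AE_space
    proof eventually_elim
      case (elim \<omega>)
      show ?case
      proof (rule impI, rule ccontr)
        assume V: "6 * e < V \<omega>" and notin: "\<omega> \<notin> A1 l \<union> A2 l \<union> B"
        let ?\<phi> = "\<lambda>u. simple_value (k1 l) (s1 l) (\<xi>1 l) u \<omega>" and ?\<psi> = "\<lambda>u. simple_value (k2 l) (s2 l) (\<xi>2 l) u \<omega>"
        define g1 where "g1 u = ennreal ((H u \<omega> - ?\<phi> u)\<^sup>2) * indicator {0..t} u" for u
        define g2 where "g2 u = ennreal ((H u \<omega> - ?\<psi> u)\<^sup>2) * indicator {0..s} u" for u
        define g3 where "g3 u = ennreal (\<rho>\<^sup>2) * indicator {s..t} u" for u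
        have Hm: "(\<lambda>u. indicator {0..T} u *\<^sub>R H u \<omega>) \<in> borel_measurable borel"
          by (rule borel_measurable_continuous_on_indicator[OF _ elim(1)]) simp
        have \<phi>m: "?\<phi> \<in> borel_measurable borel" "?\<psi> \<in> borel_measurable borel"
          unfolding simple_value_def by measurable
        have g1m: "g1 \<in> borel_measurable lborel"
        proof -
          have "g1 = (\<lambda>u. ennreal ((indicator {0..T} u *\<^sub>R H u \<omega> - ?\<phi> u)\<^sup>2) * indicator {0..t} u)"
            using st by (auto simp: g1_def indicator_def)
          then show ?thesis using Hm \<phi>m by simp
        qed
        have g2m: "g2 \<in> borel_measurable lborel"
        proof -
          have "g2 = (\<lambda>u. ennreal ((indicator {0..T} u *\<^sub>R H u \<omega> - ?\<psi> u)\<^sup>2) * indicator {0..s} u)"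
            using st by (auto simp: g2_def indicator_def)
          then show ?thesis using Hm \<phi>m by simp
        qed
        have g3m: "g3 \<in> borel_measurable lborel" unfolding g3_def by simp
        have I1: "(\<integral>\<^sup>+u. g1 u \<partial>lborel) \<le> ennreal e"
          using A1(3)[of l] notin elim(3) unfolding g1_def by (force simp: not_less)
        have I2: "(\<integral>\<^sup>+u. g2 u \<partial>lborel) \<le> ennreal e"
          using A2(3)[of l] notin elim(3) unfolding g2_def by (force simp: not_less)
        have I3: "(\<integral>\<^sup>+u. g3 u \<partial>lborel) = ennreal e"
          unfolding g3_def e_def using st by (simp add: nn_integral_cmult_indicator ennreal_mult)
        have "ennreal (V \<omega>) \<le> (\<integral>\<^sup>+u\<in>{0..t}. 2 * g1 u + 2 * g2 u + 2 * g3 u \<partial>lborel)"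
          unfolding V_def
        proof (rule step_integral_le[OF p p0(1,2)])
          fix i u assume i: "i < K" and u: "p i < u" "u \<le> p (Suc i)"
          have ut: "0 \<le> u" "u \<le> t" using u prng[of i] prng[of "Suc i"] i by auto
          have us: "s < u \<longleftrightarrow> s < p (Suc i)"
            using is' i u increasing_seq_less_iff[of K p is' "Suc i", OF p] increasing_seq_le_iff[of K p is' i, OF p] by auto
          have "\<zeta> (p (Suc i)) \<omega> = \<zeta> u \<omega>"
            unfolding \<zeta>_def using us ut prng[of "Suc i"] i
            by (auto simp: indicator_def simple_value_refine[OF p sub1 i u] simple_value_refine[OF p sub2 i u])
          also have "ennreal ((\<zeta> u \<omega>)\<^sup>2) \<le> 2 * g1 u + 2 * g2 u + 2 * g3 u"
          proof (cases "s < u")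
            case True
            have "?\<psi> u = 0"
              unfolding simple_value_def
            proof (rule sum.neutral, rule ballI)
              fix i assume "i \<in> {..<k2 l}"
              then have "s2 l (Suc i) \<le> s" using rng2[of "Suc i"] by auto
              then show "\<xi>2 l i \<omega> * indicator {s2 l i<..s2 l (Suc i)} u = 0" using True by (simp add: indicator_def)
            qed
            then have "\<zeta> u \<omega> = - (H u \<omega> - ?\<phi> u) + (H u \<omega> - H s \<omega>)"
              using True ut by (simp add: \<zeta>_def)
            moreover have "(- x + y)\<^sup>2 \<le> 2 * x\<^sup>2 + 2 * y\<^sup>2" for x y :: real
              using zero_le_power2[of "x + y"] by (simp add: power2_eq_square algebra_simps)
            ultimately have "(\<zeta> u \<omega>)\<^sup>2 \<le> 2 * (H u \<omega> - ?\<phi> u)\<^sup>2 + 2 * (H u \<omega> - H s \<omega>)\<^sup>2" by metis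
            moreover have "(H u \<omega> - H s \<omega>)\<^sup>2 \<le> \<rho>\<^sup>2"
              using elim(2) notin True ut pos by (auto simp: abs_le_square_iff[symmetric])
            ultimately have "ennreal ((\<zeta> u \<omega>)\<^sup>2) \<le> ennreal (2 * (H u \<omega> - ?\<phi> u)\<^sup>2 + 2 * \<rho>\<^sup>2)"
              by (intro ennreal_leI) linarith
            also have "\<dots> = 2 * g1 u + 2 * g3 u"
              using True ut en by (simp add: g1_def g3_def)
            also have "\<dots> \<le> 2 * g1 u + 2 * g2 u + 2 * g3 u" by (simp add: add_increasing2)
            finally show ?thesis .
          next
            case False
            then have "\<zeta> u \<omega> = - (H u \<omega> - ?\<phi> u) + (H u \<omega> - ?\<psi> u)"
              by (simp add: \<zeta>_def)
            moreover have "(- x + y)\<^sup>2 \<le> 2 * x\<^sup>2 + 2 * y\<^sup>2" for x y :: real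
              using zero_le_power2[of "x + y"] by (simp add: power2_eq_square algebra_simps)
            ultimately have "(\<zeta> u \<omega>)\<^sup>2 \<le> 2 * (H u \<omega> - ?\<phi> u)\<^sup>2 + 2 * (H u \<omega> - ?\<psi> u)\<^sup>2" by metis
            then have "ennreal ((\<zeta> u \<omega>)\<^sup>2) \<le> ennreal (2 * (H u \<omega> - ?\<phi> u)\<^sup>2 + 2 * (H u \<omega> - ?\<psi> u)\<^sup>2)" by (rule ennreal_leI)
            also have "\<dots> = 2 * g1 u + 2 * g2 u"
              using False ut en by (simp add: g1_def g2_def)
            also have "\<dots> \<le> 2 * g1 u + 2 * g2 u + 2 * g3 u" by simp
            finally show ?thesis .
          qed
          finally show "ennreal ((\<zeta> (p (Suc i)) \<omega>)\<^sup>2) \<le> 2 * g1 u + 2 * g2 u + 2 * g3 u" .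
        qed
        also have "\<dots> \<le> (\<integral>\<^sup>+u. 2 * g1 u + 2 * g2 u + 2 * g3 u \<partial>lborel)"
          by (intro nn_integral_mono) (auto simp: indicator_def)
        also have "\<dots> = 2 * (\<integral>\<^sup>+u. g1 u \<partial>lborel) + 2 * (\<integral>\<^sup>+u. g2 u \<partial>lborel) + 2 * (\<integral>\<^sup>+u. g3 u \<partial>lborel)"
          using g1m g2m g3m by (simp add: nn_integral_add nn_integral_cmult)
        also have "\<dots> \<le> 2 * ennreal e + 2 * ennreal e + 2 * ennreal e"
          using I1 I2 I3 by (intro add_mono mult_left_mono) auto
        also have "\<dots> = (2 + 2 + 2) * ennreal e" by (simp only: distrib_right)
        also have "\<dots> = ennreal (6 * e)" using e by (simp add: ennreal_mult)
        finally have "V \<omega> \<le> 6 * e" using e by (simp add: ennreal_le_iff)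
        then show False using V by simp
      qed
    qed
    have bnd: "prob {\<omega> \<in> space M. a < \<bar>\<Sum>i<K. \<zeta> (p (Suc i)) \<omega> * (?W (p (Suc i)) \<omega> - ?W (p i) \<omega>)\<bar>} \<le>
        prob {\<omega> \<in> space M. 6 * e < V \<omega>} + 6 * e / a\<^sup>2"
      unfolding V_def
      using simple_integral_tail_bound[OF p0(1) p p0(3), where \<phi> = "\<lambda>i. \<zeta> (p (Suc i))"] \<zeta>_meas e pos
      by simp
    have "prob {\<omega> \<in> space M. 6 * e < V \<omega>} \<le> prob (A1 l \<union> A2 l \<union> B)"
      by (rule finite_measure_mono_AE) (use V_AE A1 A2 B in auto)
    also have "\<dots> \<le> prob (A1 l) + prob (A2 l) + prob B"
      using measure_Un_le[of "A1 l \<union> A2 l" M B] measure_Un_le[of "A1 l" M "A2 l"] A1 A2 B by auto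
    finally have bV: "prob {\<omega> \<in> space M. 6 * e < V \<omega>} \<le> prob (A1 l) + prob (A2 l) + prob B" .
    let ?R = "{\<omega> \<in> space M. a < \<bar>\<Sum>i<K. \<zeta> (p (Suc i)) \<omega> * (?W (p (Suc i)) \<omega> - ?W (p i) \<omega>)\<bar>}"
    have mR: "?R \<in> events"
    proof -
      have vn: "(\<lambda>x :: real ^ 'm. x $ j) \<in> borel_measurable borel" by auto
      have W: "?W (p i) \<in> borel_measurable M" if "i \<le> K" for i
        using measurable_compose[OF beta_measurable vn] prng[OF that] st by auto
      have X: "\<zeta> (p (Suc i)) \<in> borel_measurable M" if "i < K" for i
        using measurable_F_M[OF \<zeta>_meas[OF that]] prng[of i] that st by auto
      have [measurable]: "(\<lambda>\<omega>. \<Sum>i<K. \<zeta> (p (Suc i)) \<omega> * (?W (p (Suc i)) \<omega> - ?W (p i) \<omega>)) \<in> borel_measurable M"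
        using W X by (intro borel_measurable_sum borel_measurable_times borel_measurable_diff) auto
      show ?thesis by measurable
    qed
    have "{\<omega> \<in> space M. 3 * a < \<bar>D \<omega>\<bar>} \<subseteq> (A3 l \<union> A4 l) \<union> ?R"
    proof
      fix \<omega> assume w: "\<omega> \<in> {\<omega> \<in> space M. 3 * a < \<bar>D \<omega>\<bar>}"
      show "\<omega> \<in> (A3 l \<union> A4 l) \<union> ?R"
      proof (rule ccontr)
        assume n: "\<not> ?thesis"
        have "\<bar>Zt \<omega> - simple_integral ?W (k1 l) (s1 l) (\<xi>1 l) \<omega>\<bar> \<le> a"
          using n A3(3)[of l] w pos by (force simp: not_less ennreal_less_iff)
        moreover have "\<bar>Zs \<omega> - simple_integral ?W (k2 l) (s2 l) (\<xi>2 l) \<omega>\<bar> \<le> a"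
          using n A4(3)[of l] w pos by (force simp: not_less ennreal_less_iff)
        moreover have "\<bar>simple_integral ?W (k1 l) (s1 l) (\<xi>1 l) \<omega> - simple_integral ?W (k2 l) (s2 l) (\<xi>2 l) \<omega>
            - H s \<omega> * (?W t \<omega> - ?W s \<omega>)\<bar> \<le> a"
          using n w unfolding R[of \<omega>, symmetric] by auto
        moreover have "D \<omega> = (Zt \<omega> - simple_integral ?W (k1 l) (s1 l) (\<xi>1 l) \<omega>) -
            (Zs \<omega> - simple_integral ?W (k2 l) (s2 l) (\<xi>2 l) \<omega>) +
            (simple_integral ?W (k1 l) (s1 l) (\<xi>1 l) \<omega> - simple_integral ?W (k2 l) (s2 l) (\<xi>2 l) \<omega>
            - H s \<omega> * (?W t \<omega> - ?W s \<omega>))" by (simp add: D_def)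
        ultimately have "\<bar>D \<omega>\<bar> \<le> 3 * a" by linarith
        then show False using w by simp
      qed
    qed
    then have "prob {\<omega> \<in> space M. 3 * a < \<bar>D \<omega>\<bar>} \<le> prob ((A3 l \<union> A4 l) \<union> ?R)"
      using A3 A4 mR by (intro finite_measure_mono) auto
    also have "\<dots> \<le> prob (A3 l) + prob (A4 l) + prob ?R"
      using measure_Un_le[of "A3 l \<union> A4 l" M ?R] measure_Un_le[of "A3 l" M "A4 l"] A3 A4 mR by auto
    finally show ?thesis using bnd bV by linarith
  qed
  have "(\<lambda>l. prob (A1 l) + prob (A2 l) + prob (A3 l) + prob (A4 l) + (prob B + 6 * e / a\<^sup>2))
      \<longlonglongrightarrow> 0 + 0 + 0 + 0 + (prob B + 6 * e / a\<^sup>2)"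
    by (intro tendsto_add A1 A2 A3 A4 tendsto_const)
  then have "prob {\<omega> \<in> space M. 3 * a < \<bar>D \<omega>\<bar>} \<le> 0 + 0 + 0 + 0 + (prob B + 6 * e / a\<^sup>2)"
    by (rule LIMSEQ_le_const) (use step in blast)
  then show ?thesis by (simp add: D_def e_def mult.assoc)
qed

end

section \<open>Short-time behaviour of the diffusion\<close>

lemma (in prob_space) prob_tendsto_zero_of_AE:
  assumes "\<And>k. A k \<in> events" and "AE \<omega> in M. \<forall>\<^sub>F k in sequentially. \<omega> \<notin> A k"
  shows "(\<lambda>k. prob (A k)) \<longlonglongrightarrow> 0"
proof -
  have "(\<lambda>k. expectation (indicator (A k))) \<longlonglongrightarrow> expectation (\<lambda>_. 0 :: real)"
  proof (rule integral_dominated_convergence[where w = "\<lambda>_. 1"])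
    show "AE \<omega> in M. (\<lambda>k. indicator (A k) \<omega>) \<longlonglongrightarrow> (0 :: real)"
      using assms(2)
    proof eventually_elim
      case (elim \<omega>)
      then show ?case by (rule tendsto_eventually[OF eventually_mono]) simp
    qed
  qed (use assms(1) in \<open>auto simp: indicator_def\<close>)
  then show ?thesis using assms(1) by simp
qed

text \<open>Rational times suffice to detect an oscillation of a continuous path, and make the event measurable.\<close>

lemma (in prob_space) modulus_of_continuity_event:
  fixes H :: "real \<Rightarrow> 'a \<Rightarrow> real"
  assumes t: "t \<le> T" and s: "\<And>k. 0 \<le> s k" "\<And>k. s k < t" "s \<longlonglongrightarrow> t"
    and H: "\<And>u. 0 \<le> u \<Longrightarrow> u \<le> T \<Longrightarrow> H u \<in> borel_measurable M"
    and cont: "AE \<omega> in M. continuous_on {0..T} (\<lambda>u. H u \<omega>)" and \<rho>: "0 < \<rho>"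
  obtains B where "\<And>k. B k \<in> events" "(\<lambda>k. prob (B k)) \<longlonglongrightarrow> 0"
    "\<And>k. AE \<omega> in M. \<omega> \<notin> B k \<longrightarrow> (\<forall>u\<in>{s k..t}. \<bar>H u \<omega> - H (s k) \<omega>\<bar> \<le> \<rho>)"
proof -
  define C where "C k = {s k<..<t} \<inter> \<rat>" for k
  define B where "B k = (\<Union>q\<in>C k. {\<omega> \<in> space M. \<rho> < \<bar>H q \<omega> - H (s k) \<omega>\<bar>})" for k
  have Cr: "0 \<le> q" "q \<le> T" "s k < q" "q < t" if "q \<in> C k" for q k
    using that s(1)[of k] t by (auto simp: C_def)
  have sT: "s k \<le> T" for k using s(2)[of k] t by simp
  have Bm: "B k \<in> events" for k
    unfolding B_def
  proof (rule sets.countable_UN'')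
    show "countable (C k)" unfolding C_def using countable_rat by (rule countable_subset[rotated]) auto
    fix q assume q: "q \<in> C k"
    have [measurable]: "H q \<in> borel_measurable M" "H (s k) \<in> borel_measurable M"
      using H Cr[OF q] s(1) sT by auto
    show "{\<omega> \<in> space M. \<rho> < \<bar>H q \<omega> - H (s k) \<omega>\<bar>} \<in> events" by measurable
  qed
  have "AE \<omega> in M. \<forall>\<^sub>F k in sequentially. \<omega> \<notin> B k"
    using cont
  proof eventually_elim
    case (elim \<omega>)
    have "t \<in> {0..T}" using t s(1,2)[of 0] by auto
    then obtain d where d: "d > 0" "\<And>u. u \<in> {0..T} \<Longrightarrow> dist u t < d \<Longrightarrow> dist (H u \<omega>) (H t \<omega>) < \<rho> / 2"
      using elim \<rho> unfolding continuous_on_iff by (metis half_gt_zero)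
    have "\<forall>\<^sub>F k in sequentially. dist (s k) t < d" using s(3) d(1) by (rule tendstoD)
    then show ?case
    proof eventually_elim
      case (elim k)
      show ?case
      proof
        assume "\<omega> \<in> B k"
        then obtain q where q: "q \<in> C k" "\<rho> < \<bar>H q \<omega> - H (s k) \<omega>\<bar>" by (auto simp: B_def)
        have "dist q t < d" using Cr[OF q(1)] elim by (simp add: dist_real_def)
        then have "dist (H q \<omega>) (H t \<omega>) < \<rho> / 2" using d Cr[OF q(1)] by auto
        moreover have "dist (H (s k) \<omega>) (H t \<omega>) < \<rho> / 2" using d elim s(1) sT by auto
        ultimately show False using q(2) unfolding dist_real_def by linarith
      qed
    qed
  qed
  then have lim: "(\<lambda>k. prob (B k)) \<longlonglongrightarrow> 0" by (rule prob_tendsto_zero_of_AE[OF Bm])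
  have ae: "AE \<omega> in M. \<omega> \<notin> B k \<longrightarrow> (\<forall>u\<in>{s k..t}. \<bar>H u \<omega> - H (s k) \<omega>\<bar> \<le> \<rho>)" for k
    using cont AE_space
  proof eventually_elim
    case (elim \<omega>)
    show ?case
    proof (intro impI ballI)
      fix u assume n: "\<omega> \<notin> B k" and u: "u \<in> {s k..t}"
      have "{s k<..<t} \<subseteq> closure (C k)"
        using open_Int_closure_subset[of "{s k<..<t}" "\<rat>"] Rats_closure_real by (simp add: C_def)
      then have "closure {s k<..<t} \<subseteq> closure (C k)" by (rule closure_minimal) simp
      then have sub: "{s k..t} \<subseteq> closure (C k)" using s(2)[of k] by (simp add: closure_greaterThanLessThan)
      have sub2: "closure (C k) \<subseteq> {s k..t}"
        by (rule closure_minimal) (auto simp: C_def)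
      show "\<bar>H u \<omega> - H (s k) \<omega>\<bar> \<le> \<rho>"
      proof (rule continuous_le_on_closure[where S = "C k" and f = "\<lambda>u. \<bar>H u \<omega> - H (s k) \<omega>\<bar>"])
        show "continuous_on (closure (C k)) (\<lambda>u. \<bar>H u \<omega> - H (s k) \<omega>\<bar>)"
          using s(1)[of k] t sub2 by (intro continuous_intros continuous_on_subset[OF elim(1)]) auto
        show "u \<in> closure (C k)" using sub u by auto
        show "\<bar>H q \<omega> - H (s k) \<omega>\<bar> \<le> \<rho>" if "q \<in> C k" for q
          using that n elim(2) by (auto simp: B_def not_less)
      qed
    qed
  qed
  from that[OF Bm lim ae] show thesis .
qed

locale diffusion = brownian_with_initial M T \<beta> Y
  for M :: "'w measure" and T and \<beta> :: "real \<Rightarrow> 'w \<Rightarrow> real ^ 'm::finite" and Y :: "'w \<Rightarrow> real ^ 'd::finite" +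
  fixes \<sigma> :: "real \<Rightarrow> real ^ 'd \<Rightarrow> real ^ 'm ^ 'd" and b :: "real \<Rightarrow> real ^ 'd \<Rightarrow> real ^ 'd"
    and X :: "real \<Rightarrow> 'w \<Rightarrow> real ^ 'd"
  assumes \<sigma>_cont: "continuous_on ({0..T} \<times> UNIV) (\<lambda>(t, x). \<sigma> t x)"
    and b_cont: "continuous_on ({0..T} \<times> UNIV) (\<lambda>(t, x). b t x)"
    and \<sigma>_surj: "\<And>t x. t \<in> {0..T} \<Longrightarrow> surj (mat_apply (\<sigma> t x))"
    and solution: "sde_solution M T \<beta> Y \<sigma> b X"
begin

lemma X_meas_F: "0 \<le> t \<Longrightarrow> t \<le> T \<Longrightarrow> X t \<in> borel_measurable (F t)"
  using solution by (auto simp: sde_solution_def)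

lemma X_meas: "0 \<le> t \<Longrightarrow> t \<le> T \<Longrightarrow> X t \<in> borel_measurable M"
  using X_meas_F measurable_F_M by blast

lemma X_cont: "AE \<omega> in M. continuous_on {0..T} (\<lambda>t. X t \<omega>)"
  using solution by (auto simp: sde_solution_def)

lemma \<sigma>_cont_path:
  assumes "continuous_on {0..T} (\<lambda>t. X t \<omega>)"
  shows "continuous_on {0..T} (\<lambda>t. \<sigma> t (X t \<omega>))"
proof -
  have "continuous_on {0..T} (\<lambda>t. (t, X t \<omega>))" by (intro continuous_intros assms)
  from continuous_on_compose2[OF \<sigma>_cont this] show ?thesis by auto
qed

lemma b_cont_path:
  assumes "continuous_on {0..T} (\<lambda>t. X t \<omega>)"
  shows "continuous_on {0..T} (\<lambda>t. b t (X t \<omega>))"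
proof -
  have "continuous_on {0..T} (\<lambda>t. (t, X t \<omega>))" by (intro continuous_intros assms)
  from continuous_on_compose2[OF b_cont this] show ?thesis by auto
qed

lemma \<sigma>_meas_F:
  assumes "0 \<le> t" "t \<le> T" shows "(\<lambda>\<omega>. \<sigma> t (X t \<omega>)) \<in> borel_measurable (F t)"
proof -
  have "continuous_on UNIV (\<lambda>x. (t, x))" by (intro continuous_intros)
  from continuous_on_compose2[OF \<sigma>_cont this] assms have "continuous_on UNIV (\<sigma> t)" by (auto simp: image_subset_iff)
  then have "\<sigma> t \<in> borel_measurable borel" by (rule borel_measurable_continuous_onI)
  from measurable_compose[OF X_meas_F[OF assms] this] show ?thesis .
qed

lemma \<sigma>_comp_meas_F:
  assumes "0 \<le> t" "t \<le> T" shows "(\<lambda>\<omega>. \<sigma> t (X t \<omega>) $ i $ j) \<in> borel_measurable (F t)"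
proof -
  have "(\<lambda>A :: real ^ 'm ^ 'd. A $ i $ j) \<in> borel_measurable borel"
    by (intro borel_measurable_continuous_onI continuous_intros)
  from measurable_compose[OF \<sigma>_meas_F[OF assms] this] show ?thesis .
qed

text \<open>The drift contributes \<open>O(t - s)\<close> along almost every path. In the stochastic part, \<open>\<sigma>\<close> along the path
oscillates by less than any given \<open>\<rho>'\<close> on \<open>[s, t]\<close> with probability close to one, so that the Ito
integral of \<open>\<sigma> - \<sigma>\<^sub>s\<close> is of the order \<open>\<rho>' \<surd>(t - s)\<close>.\<close>

lemma euler_error_tendsto_zero:
  assumes t: "t \<le> T" and s: "\<And>k. 0 \<le> s k" "\<And>k. s k < t" "s \<longlonglongrightarrow> t" and \<rho>: "0 < \<rho>"
  shows "(\<lambda>k. prob {\<omega> \<in> space M. \<rho> * sqrt (t - s k) \<le>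
      norm (X t \<omega> - X (s k) \<omega> - \<sigma> (s k) (X (s k) \<omega>) *v (\<beta> t \<omega> - \<beta> (s k) \<omega>))}) \<longlonglongrightarrow> 0"
proof -
  have t0: "0 \<le> t" using s(1,2)[of 0] by simp
  have sT: "s k \<le> T" for k using s(2)[of k] t by simp
  have "\<forall>u\<in>{0..T}. \<exists>Z.
        (\<forall>i j. has_ito_integral M F (\<lambda>s \<omega>. \<beta> s \<omega> $ j) u (\<lambda>s \<omega>. \<sigma> s (X s \<omega>) $ i $ j) (Z i j)) \<and>
        (\<forall>i. AE \<omega> in M. X u \<omega> $ i =
           Y \<omega> $ i + (\<Sum>j\<in>UNIV. Z i j \<omega>) + (LBINT s:{0..u}. b s (X s \<omega>) $ i))"
    using solution by (auto simp: sde_solution_def)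
  from bchoice[OF this] obtain Z where ZZ: "\<forall>u\<in>{0..T}.
        (\<forall>i j. has_ito_integral M F (\<lambda>s \<omega>. \<beta> s \<omega> $ j) u (\<lambda>s \<omega>. \<sigma> s (X s \<omega>) $ i $ j) (Z u i j)) \<and>
        (\<forall>i. AE \<omega> in M. X u \<omega> $ i =
           Y \<omega> $ i + (\<Sum>j\<in>UNIV. Z u i j \<omega>) + (LBINT s:{0..u}. b s (X s \<omega>) $ i))" by blast
  have Z: "has_ito_integral M F (\<lambda>s \<omega>. \<beta> s \<omega> $ j) u (\<lambda>s \<omega>. \<sigma> s (X s \<omega>) $ i $ j) (Z u i j)"
    if "u \<in> {0..T}" for u i j using ZZ that by blast
  have XZ: "AE \<omega> in M. X u \<omega> $ i =
           Y \<omega> $ i + (\<Sum>j\<in>UNIV. Z u i j \<omega>) + (LBINT s:{0..u}. b s (X s \<omega>) $ i)"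
    if "u \<in> {0..T}" for u i using ZZ that by blast
  have Zm: "Z u i j \<in> borel_measurable M" if "u \<in> {0..T}" for u i j
    using Z[OF that] by (auto simp: has_ito_integral_def)
  define E where "E k i j \<omega> = Z t i j \<omega> - Z (s k) i j \<omega> - \<sigma> (s k) (X (s k) \<omega>) $ i $ j * (\<beta> t \<omega> $ j - \<beta> (s k) \<omega> $ j)"
    for k i j \<omega>
  define R where "R k i \<omega> = (X t \<omega> - X (s k) \<omega>) $ i - (\<Sum>j\<in>UNIV. Z t i j \<omega> - Z (s k) i j \<omega>)" for k i \<omega>
  have vn: "(\<lambda>x :: real ^ 'm. x $ j) \<in> borel_measurable borel" for j by auto
  have vn': "(\<lambda>x :: real ^ 'd. x $ j) \<in> borel_measurable borel" for j by auto
  have bm: "(\<lambda>\<omega>. \<beta> u \<omega> $ j) \<in> borel_measurable M" if "0 \<le> u" "u \<le> T" for u j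
    using measurable_compose[OF beta_measurable[OF that] vn] .
  have Em: "E k i j \<in> borel_measurable M" for k i j
    unfolding E_def using Zm[of t] Zm[of "s k"] bm[of t] bm[of "s k"] measurable_F_M[OF \<sigma>_comp_meas_F[OF s(1) sT] sT] t t0 s(1) sT
    by (intro borel_measurable_diff borel_measurable_times) auto
  have Rm: "R k i \<in> borel_measurable M" for k i
    unfolding R_def
    using Zm[of t] Zm[of "s k"] X_meas[of t] X_meas[of "s k"] t t0 s(1) sT
    by (intro borel_measurable_diff borel_measurable_sum measurable_compose[OF _ vn']) auto
  have \<delta>: "0 < sqrt (t - s k)" for k using s(2)[of k] by simp
  define n where "n = real CARD('d) * (real CARD('m) + 1)"
  have n: "n > 0" by (simp add: n_def add_pos_nonneg)
  define r where "r = \<rho> / (2 * n)"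
  have r: "r > 0" using \<rho> n by (simp add: r_def)
  have E0: "(\<lambda>k. prob {\<omega> \<in> space M. r * sqrt (t - s k) < \<bar>E k i j \<omega>\<bar>}) \<longlonglongrightarrow> 0" for i j
  proof (rule LIMSEQ_I)
    fix \<epsilon> :: real assume \<epsilon>: "0 < \<epsilon>"
    \<comment> \<open>chosen such that the second term of the bound for Ito integrals is \<open>\<epsilon> / 2\<close>\<close>
    define \<rho>' where "\<rho>' = r * sqrt (\<epsilon> / 108)"
    have \<rho>': "\<rho>' > 0" using r \<epsilon> by (simp add: \<rho>'_def)
    have cont: "AE \<omega> in M. continuous_on {0..T} (\<lambda>u. \<sigma> u (X u \<omega>) $ i $ j)"
      using X_cont by eventually_elim (intro continuous_intros \<sigma>_cont_path)
    obtain B where B: "\<And>k. B k \<in> events" "(\<lambda>k. prob (B k)) \<longlonglongrightarrow> 0"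
      "\<And>k. AE \<omega> in M. \<omega> \<notin> B k \<longrightarrow> (\<forall>u\<in>{s k..t}. \<bar>\<sigma> u (X u \<omega>) $ i $ j - \<sigma> (s k) (X (s k) \<omega>) $ i $ j\<bar> \<le> \<rho>')"
      by (rule modulus_of_continuity_event[OF t s _ cont \<rho>'])
        (auto intro: measurable_F_M[OF \<sigma>_comp_meas_F])
    have bound: "prob {\<omega> \<in> space M. r * sqrt (t - s k) < \<bar>E k i j \<omega>\<bar>} \<le> prob (B k) + \<epsilon> / 2" for k
    proof -
      have "prob {\<omega> \<in> space M. 3 * (r * sqrt (t - s k) / 3) < \<bar>E k i j \<omega>\<bar>} \<le>
          prob (B k) + 6 * \<rho>'\<^sup>2 * (t - s k) / (r * sqrt (t - s k) / 3)\<^sup>2"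
        unfolding E_def
        by (rule ito_increment_bound[OF s(1) s(2) t cont \<sigma>_comp_meas_F[OF s(1) sT] Z Z B(1) B(3) \<rho>'])
           (use t t0 s(1) sT r \<delta> in auto)
      moreover have "6 * \<rho>'\<^sup>2 * (t - s k) / (r * sqrt (t - s k) / 3)\<^sup>2 = \<epsilon> / 2"
        using r \<epsilon> s(2)[of k] by (simp add: \<rho>'_def power_mult_distrib power_divide field_simps)
      ultimately show ?thesis by simp
    qed
    obtain k0 where "\<And>k. k \<ge> k0 \<Longrightarrow> norm (prob (B k) - 0) < \<epsilon> / 2"
      using LIMSEQ_D[OF B(2), of "\<epsilon> / 2"] \<epsilon> by auto
    then have "norm (prob {\<omega> \<in> space M. r * sqrt (t - s k) < \<bar>E k i j \<omega>\<bar>} - 0) < \<epsilon>" if "k \<ge> k0" for k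
      using bound[of k] that by (force simp: abs_of_nonneg)
    then show "\<exists>k0. \<forall>k\<ge>k0. norm (prob {\<omega> \<in> space M. r * sqrt (t - s k) < \<bar>E k i j \<omega>\<bar>} - 0) < \<epsilon>" by blast
  qed
  have R0: "(\<lambda>k. prob {\<omega> \<in> space M. r * sqrt (t - s k) < \<bar>R k i \<omega>\<bar>}) \<longlonglongrightarrow> 0" for i
  proof (rule prob_tendsto_zero_of_AE)
    show "{\<omega> \<in> space M. r * sqrt (t - s k) < \<bar>R k i \<omega>\<bar>} \<in> events" for k
      using Rm[of k i] by measurable
    have "AE \<omega> in M. \<forall>k. X (s k) \<omega> $ i =
           Y \<omega> $ i + (\<Sum>j\<in>UNIV. Z (s k) i j \<omega>) + (LBINT u:{0..s k}. b u (X u \<omega>) $ i)"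
      using XZ s(1) sT by (subst AE_all_countable) auto
    moreover have "AE \<omega> in M. X t \<omega> $ i =
           Y \<omega> $ i + (\<Sum>j\<in>UNIV. Z t i j \<omega>) + (LBINT u:{0..t}. b u (X u \<omega>) $ i)"
      using XZ t t0 by simp
    ultimately show "AE \<omega> in M. \<forall>\<^sub>F k in sequentially. \<omega> \<notin> {\<omega> \<in> space M. r * sqrt (t - s k) < \<bar>R k i \<omega>\<bar>}"
      using X_cont
    proof eventually_elim
      case (elim \<omega>)
      define f where "f u = b u (X u \<omega>) $ i" for u
      have fc: "continuous_on {0..T} f" unfolding f_def by (intro continuous_intros b_cont_path elim)
      have si: "set_integrable lborel {x..y} f" if "0 \<le> x" "y \<le> T" for x y
        by (rule borel_integrable_atLeastAtMost') (use that in \<open>auto intro: continuous_on_subset[OF fc]\<close>)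
      have "\<exists>C. \<forall>u\<in>{0..T}. \<bar>f u\<bar> \<le> C"
        using compact_imp_bounded[OF compact_continuous_image[OF fc compact_Icc]]
        by (simp add: bounded_iff)
      then obtain C where C: "\<And>u. u \<in> {0..T} \<Longrightarrow> \<bar>f u\<bar> \<le> C" by blast
      have C0: "0 \<le> C" using C[of t] t t0 by fastforce
      have Rb: "\<bar>R k i \<omega>\<bar> \<le> C * (t - s k)" for k
      proof -
        have "R k i \<omega> = (LBINT u:{0..t}. f u) - (LBINT u:{0..s k}. f u)"
          using elim by (simp add: R_def f_def sum_subtractf)
        also have "(LBINT u:{0..t}. f u) = (LBINT u:{0..s k}. f u) + (LBINT u:{s k<..t}. f u)"
        proof -
          have "{0..t} = {0..s k} \<union> {s k<..t}" using s(1,2)[of k] by auto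
          moreover have "set_integrable lborel {s k<..t} f"
            by (rule set_integrable_subset[OF si[of "s k" t]]) (use s(1) t in auto)
          ultimately show ?thesis
            using si[of 0 "s k"] sT by (simp only:) (intro set_integral_Un, auto)
        qed
        finally have "R k i \<omega> = (LBINT u:{s k<..t}. f u)" by simp
        also have "\<bar>\<dots>\<bar> \<le> (LBINT u:{s k<..t}. C)"
        proof -
          have i1: "set_integrable lborel {s k<..t} f"
            by (rule set_integrable_subset[OF si[of "s k" t]]) (use s(1) t in auto)
          have "\<bar>LBINT u:{s k<..t}. f u\<bar> \<le> (LBINT u:{s k<..t}. \<bar>f u\<bar>)"
            using set_integral_norm_bound[OF i1] by simp
          also have "\<dots> \<le> (LBINT u:{s k<..t}. C)"
          proof (rule set_integral_mono)
            show "set_integrable lborel {s k<..t} (\<lambda>u. \<bar>f u\<bar>)" using i1 by (rule set_integrable_abs)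
            show "set_integrable lborel {s k<..t} (\<lambda>u. C)"
              unfolding set_integrable_def using s(2)[of k]
              by (intro integrable_scaleR_left integrable_real_indicator) auto
            show "\<bar>f u\<bar> \<le> C" if "u \<in> {s k<..t}" for u
              using that s(1)[of k] t by (intro C) auto
          qed
          finally show ?thesis .
        qed
        also have "\<dots> = C * (t - s k)"
          using s(2)[of k] by (simp add: set_lebesgue_integral_def)
        finally show ?thesis .
      qed
      have "(\<lambda>k. C * sqrt (t - s k)) \<longlonglongrightarrow> C * sqrt (t - t)"
        by (intro tendsto_intros s(3))
      then have "\<forall>\<^sub>F k in sequentially. C * sqrt (t - s k) < r"
        using r by (intro order_tendstoD(2)[of _ "C * sqrt (t - t)"]) auto
      then show ?case
      proof eventually_elim
        case (elim k)
        have "C * (t - s k) = C * sqrt (t - s k) * sqrt (t - s k)" using s(2)[of k] by simp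
        also have "\<dots> \<le> r * sqrt (t - s k)" using elim \<delta>[of k] by (intro mult_right_mono) auto
        finally show ?case using Rb[of k] by auto
      qed
    qed
  qed
  define U where "U k = (\<Sum>i\<in>UNIV. (\<Sum>j\<in>UNIV. prob {\<omega> \<in> space M. r * sqrt (t - s k) < \<bar>E k i j \<omega>\<bar>}) +
      prob {\<omega> \<in> space M. r * sqrt (t - s k) < \<bar>R k i \<omega>\<bar>})" for k
  have U0: "U \<longlonglongrightarrow> 0"
  proof -
    have "U \<longlonglongrightarrow> (\<Sum>i\<in>(UNIV :: 'd set). (\<Sum>j\<in>(UNIV :: 'm set). 0) + 0)"
      unfolding U_def[abs_def] by (intro tendsto_sum tendsto_add E0 R0)
    then show ?thesis by simp
  qed
  let ?N = "\<lambda>k \<omega>. norm (X t \<omega> - X (s k) \<omega> - \<sigma> (s k) (X (s k) \<omega>) *v (\<beta> t \<omega> - \<beta> (s k) \<omega>))"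
  have "prob {\<omega> \<in> space M. \<rho> * sqrt (t - s k) \<le> ?N k \<omega>} \<le> U k" for k
  proof -
    let ?EE = "\<lambda>i j. {\<omega> \<in> space M. r * sqrt (t - s k) < \<bar>E k i j \<omega>\<bar>}"
    let ?RR = "\<lambda>i. {\<omega> \<in> space M. r * sqrt (t - s k) < \<bar>R k i \<omega>\<bar>}"
    have mE: "?EE i j \<in> events" for i j using Em[of k i j] by measurable
    have mR: "?RR i \<in> events" for i using Rm[of k i] by measurable
    have "{\<omega> \<in> space M. \<rho> * sqrt (t - s k) \<le> ?N k \<omega>} \<subseteq> (\<Union>i\<in>UNIV. (\<Union>j\<in>UNIV. ?EE i j) \<union> ?RR i)"
    proof
      fix \<omega> assume w: "\<omega> \<in> {\<omega> \<in> space M. \<rho> * sqrt (t - s k) \<le> ?N k \<omega>}"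
      show "\<omega> \<in> (\<Union>i\<in>UNIV. (\<Union>j\<in>UNIV. ?EE i j) \<union> ?RR i)"
      proof (rule ccontr)
        assume "\<not> ?thesis"
        then have Eb: "\<bar>E k i j \<omega>\<bar> \<le> r * sqrt (t - s k)" and Rb: "\<bar>R k i \<omega>\<bar> \<le> r * sqrt (t - s k)" for i j
          using w by (auto simp: not_less)
        let ?v = "X t \<omega> - X (s k) \<omega> - \<sigma> (s k) (X (s k) \<omega>) *v (\<beta> t \<omega> - \<beta> (s k) \<omega>)"
        have comp: "\<bar>?v $ i\<bar> \<le> (real CARD('m) + 1) * (r * sqrt (t - s k))" for i
        proof -
          have "?v $ i = (\<Sum>j\<in>UNIV. E k i j \<omega>) + R k i \<omega>"
            unfolding E_def R_def matrix_vector_mult_def by (simp add: sum_subtractf)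
          also have "\<bar>\<dots>\<bar> \<le> (\<Sum>j\<in>UNIV. \<bar>E k i j \<omega>\<bar>) + \<bar>R k i \<omega>\<bar>"
            by (rule order_trans[OF abs_triangle_ineq]) (simp add: sum_abs)
          also have "\<dots> \<le> (\<Sum>j\<in>(UNIV :: 'm set). r * sqrt (t - s k)) + r * sqrt (t - s k)"
            by (intro add_mono sum_mono Eb Rb)
          finally show ?thesis by (simp add: algebra_simps)
        qed
        have "norm ?v \<le> (\<Sum>i\<in>UNIV. \<bar>?v $ i\<bar>)" by (rule norm_le_l1_cart)
        also have "\<dots> \<le> (\<Sum>i\<in>(UNIV :: 'd set). (real CARD('m) + 1) * (r * sqrt (t - s k)))"
          by (intro sum_mono comp)
        also have "\<dots> = n * r * sqrt (t - s k)" by (simp add: n_def)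
        also have "\<dots> = \<rho> / 2 * sqrt (t - s k)" using n by (simp add: r_def)
        also have "\<dots> < \<rho> * sqrt (t - s k)" using \<rho> \<delta>[of k] by simp
        finally show False using w by simp
      qed
    qed
    then have "prob {\<omega> \<in> space M. \<rho> * sqrt (t - s k) \<le> ?N k \<omega>} \<le> prob (\<Union>i\<in>UNIV. (\<Union>j\<in>UNIV. ?EE i j) \<union> ?RR i)"
      using mE mR by (intro finite_measure_mono sets.finite_UN sets.Un) auto
    also have "\<dots> \<le> (\<Sum>i\<in>UNIV. prob ((\<Union>j\<in>UNIV. ?EE i j) \<union> ?RR i))"
      using mE mR by (intro measure_UNION_le sets.finite_UN sets.Un) auto
    also have "\<dots> \<le> U k"
      unfolding U_def
    proof (rule sum_mono)
      fix i
      have "prob ((\<Union>j\<in>UNIV. ?EE i j) \<union> ?RR i) \<le> prob (\<Union>j\<in>UNIV. ?EE i j) + prob (?RR i)"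
        using mE mR by (intro measure_Un_le sets.finite_UN) auto
      moreover have "prob (\<Union>j\<in>UNIV. ?EE i j) \<le> (\<Sum>j\<in>UNIV. prob (?EE i j))"
        using mE by (intro measure_UNION_le) auto
      ultimately show "prob ((\<Union>j\<in>UNIV. ?EE i j) \<union> ?RR i) \<le> (\<Sum>j\<in>UNIV. prob (?EE i j)) + prob (?RR i)"
        by linarith
    qed
    finally show ?thesis .
  qed
  then show ?thesis
    by (intro tendsto_sandwich[OF always_eventually always_eventually tendsto_const U0]) simp_all
qed

end

section \<open>No polynomial relation holds between successive increments\<close>

text \<open>Where all coefficients vanish, the constant polynomial \<open>1\<close> serves as a default value on the sphere.\<close>

definition normalized :: "nat \<Rightarrow> (('d::finite \<Rightarrow> nat) \<Rightarrow> real) \<Rightarrow> ('d \<Rightarrow> nat) \<Rightarrow> real" where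
  "normalized N c \<alpha> = (if (\<Sum>\<beta>\<in>exps N. \<bar>c \<beta>\<bar>) = 0 then indicator {\<lambda>_. 0} \<alpha>
     else indicator (exps N) \<alpha> * c \<alpha> / (\<Sum>\<beta>\<in>exps N. \<bar>c \<beta>\<bar>))"

lemma normalized_in_sphere:
  fixes c :: "('d::finite \<Rightarrow> nat) \<Rightarrow> real"
  shows "normalized N c \<in> poly_sphere N"
proof (cases "(\<Sum>\<beta>\<in>exps N. \<bar>c \<beta>\<bar>) = 0")
  case True
  have z: "(\<lambda>_. 0) \<in> (exps N :: ('d \<Rightarrow> nat) set)" by (simp add: exps_def)
  have abs: "\<bar>indicator {\<lambda>_. 0} \<alpha> :: real\<bar> = (if \<alpha> = (\<lambda>_. 0) then 1 else 0)" for \<alpha> :: "'d \<Rightarrow> nat"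
    by (simp add: indicator_def)
  have "(\<Sum>\<alpha>\<in>exps N. \<bar>indicator {\<lambda>_. 0 :: nat} (\<alpha> :: 'd \<Rightarrow> nat) :: real\<bar>) = 1"
    unfolding abs using z by simp
  then show ?thesis using z True unfolding poly_sphere_def normalized_def
    by (auto simp: indicator_def)
next
  case False
  have "(\<Sum>\<alpha>\<in>exps N. \<bar>normalized N c \<alpha>\<bar>) = (\<Sum>\<alpha>\<in>exps N. \<bar>c \<alpha>\<bar>) / (\<Sum>\<beta>\<in>exps N. \<bar>c \<beta>\<bar>)"
    unfolding sum_divide_distrib using False
    by (intro sum.cong) (auto simp: normalized_def abs_divide abs_of_nonneg sum_nonneg)
  then show ?thesis using False by (auto simp: poly_sphere_def normalized_def)
qed

lemma poly_eval_normalized: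
  assumes "poly_eval N c z = 0" and "\<beta> \<in> exps N" "c \<beta> \<noteq> 0"
  shows "poly_eval N (normalized N c) z = 0"
proof -
  have "0 < \<bar>c \<beta>\<bar>" using assms by simp
  also have "\<dots> \<le> (\<Sum>\<beta>\<in>exps N. \<bar>c \<beta>\<bar>)" using assms by (intro member_le_sum) auto
  finally have "poly_eval N (normalized N c) z = poly_eval N c z / (\<Sum>\<beta>\<in>exps N. \<bar>c \<beta>\<bar>)"
    unfolding poly_eval_def sum_divide_distrib by (intro sum.cong) (auto simp: normalized_def)
  then show ?thesis using assms by simp
qed

lemma bump_mat_apply_borel:
  "(\<lambda>((i, c, S), g). ennreal (i * bump N c (mat_apply S g)) :: ennreal) \<in> borel_measurable
    ((borel :: (real \<times> (('d::finite \<Rightarrow> nat) \<Rightarrow> real) \<times> (real ^ 'm::finite ^ 'd)) measure) \<Otimes>\<^sub>M (borel :: ('m \<Rightarrow> real) measure))"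
proof -
  have "continuous_on UNIV (\<lambda>p :: (real \<times> (('d \<Rightarrow> nat) \<Rightarrow> real) \<times> (real ^ 'm ^ 'd)) \<times> ('m \<Rightarrow> real).
      fst (fst p) * bump N (fst (snd (fst p))) (mat_apply (snd (snd (fst p))) (snd p)))"
    by (intro continuous_on_mult continuous_on_bump continuous_on_mat_apply continuous_on_fst continuous_on_snd
        continuous_on_id)
  then have "(\<lambda>p :: (real \<times> (('d \<Rightarrow> nat) \<Rightarrow> real) \<times> (real ^ 'm ^ 'd)) \<times> ('m \<Rightarrow> real).
      fst (fst p) * bump N (fst (snd (fst p))) (mat_apply (snd (snd (fst p))) (snd p))) \<in> borel_measurable borel"
    by (rule borel_measurable_continuous_onI)
  then show ?thesis unfolding borel_prod case_prod_unfold by simp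
qed

context diffusion
begin

text \<open>Conditionally on the past up to \<open>s\<close>, the coefficients \<open>c\<close> and the diffusion matrix are constants, and
averaging over the independent Gaussian increment produces \<open>gauss_mean\<close>.\<close>

lemma gauss_mean_lower_bound:
  assumes st: "0 \<le> s" "s < t" "t \<le> T"
    and c: "c \<in> borel_measurable (F s)" and A: "A \<in> sets (F s)"
    and lower: "\<And>\<omega>. \<omega> \<in> A \<Longrightarrow> \<kappa> \<le> gauss_mean N (c \<omega>) (\<sigma> s (X s \<omega>))"
    and csph: "\<And>\<omega>. c \<omega> \<in> poly_sphere N"
  shows "ennreal (\<kappa> * prob A) \<le> (\<integral>\<^sup>+\<omega>. ennreal (indicator A \<omega> *
     bump N (c \<omega>) (mat_apply (\<sigma> s (X s \<omega>)) (\<lambda>j. (\<beta> t \<omega> $ j - \<beta> s \<omega> $ j) / sqrt (t - s)))) \<partial>M)"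
proof -
  define U where "U \<omega> = (indicator A \<omega> :: real, c \<omega>, \<sigma> s (X s \<omega>))" for \<omega>
  define G where "G \<omega> = (\<lambda>j. (\<beta> t \<omega> $ j - \<beta> s \<omega> $ j) / sqrt (t - s))" for \<omega>
  define f where "f = (\<lambda>(u :: real \<times> (('d \<Rightarrow> nat) \<Rightarrow> real) \<times> (real ^ 'm ^ 'd), g).
      ennreal (fst u * bump N (fst (snd u)) (mat_apply (snd (snd u)) g)))"
  have fm: "f \<in> borel_measurable (borel \<Otimes>\<^sub>M borel)"
    using bump_mat_apply_borel[of N] unfolding f_def by (simp add: case_prod_unfold)
  have sT: "s \<le> T" using st by simp
  have AM: "A \<in> events" using A sets_F_subset[OF sT] by blast
  have indF: "(indicator A :: 'w \<Rightarrow> real) \<in> borel_measurable (F s)" using A by simp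
  have UF: "U \<in> borel_measurable (F s)"
    unfolding U_def by (intro borel_measurable_Pair indF c \<sigma>_meas_F st sT)
  have hm: "(\<lambda>x j. x $ j / sqrt (t - s)) \<in> measurable (borel :: (real ^ 'm) measure) (borel :: ('m \<Rightarrow> real) measure)"
    by (rule measurable_coordinatewise_then_product) simp
  have ind: "distr M borel U \<Otimes>\<^sub>M distr M borel G = distr M (borel \<Otimes>\<^sub>M borel) (\<lambda>\<omega>. (U \<omega>, G \<omega>))"
    using increment_joint_law[OF st UF hm] by (simp add: G_def[abs_def])
  have Um: "U \<in> borel_measurable M" by (rule measurable_F_M[OF UF sT])
  have lawG: "distr M borel G = std_gauss" unfolding G_def by (rule scaled_increment_law[OF st])
  interpret SG: sigma_finite_measure "std_gauss :: ('m \<Rightarrow> real) measure"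
    by (intro prob_space_imp_sigma_finite prob_space_std_gauss)
  have fU: "(\<integral>\<^sup>+g. f (U \<omega>, g) \<partial>std_gauss) = ennreal (indicator A \<omega> * gauss_mean N (c \<omega>) (\<sigma> s (X s \<omega>)))" for \<omega>
  proof -
    have "(\<integral>\<^sup>+g. f (U \<omega>, g) \<partial>std_gauss) =
        ennreal (\<integral>g. indicator A \<omega> * bump N (c \<omega>) (mat_apply (\<sigma> s (X s \<omega>)) g) \<partial>std_gauss)"
      unfolding f_def U_def prod.case fst_conv snd_conv
      by (intro nn_integral_eq_integral integrable_mult_right integrable_bump csph AE_I2 mult_nonneg_nonneg bump_nonneg) auto
    then show ?thesis by (simp add: gauss_mean_def)
  qed
  have "ennreal (\<kappa> * prob A) = (\<integral>\<^sup>+\<omega>. ennreal \<kappa> * indicator A \<omega> \<partial>M)"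
    using AM by (simp add: nn_integral_cmult_indicator emeasure_eq_measure ennreal_mult'')
  also have "\<dots> \<le> (\<integral>\<^sup>+\<omega>. (\<integral>\<^sup>+g. f (U \<omega>, g) \<partial>std_gauss) \<partial>M)"
    unfolding fU by (intro nn_integral_mono) (auto simp: indicator_def lower ennreal_leI)
  also have "\<dots> = (\<integral>\<^sup>+u. (\<integral>\<^sup>+g. f (u, g) \<partial>std_gauss) \<partial>distr M borel U)"
  proof -
    have "(\<lambda>u. \<integral>\<^sup>+g. f (u, g) \<partial>std_gauss) \<in> borel_measurable borel"
    proof (rule SG.borel_measurable_nn_integral)
      have "sets (borel \<Otimes>\<^sub>M std_gauss) = sets ((borel :: (real \<times> (('d \<Rightarrow> nat) \<Rightarrow> real) \<times> (real ^ 'm ^ 'd)) measure) \<Otimes>\<^sub>M (borel :: ('m \<Rightarrow> real) measure))"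
        by (intro sets_pair_measure_cong sets_std_gauss refl)
      then show "(\<lambda>(u, g). f (u, g)) \<in> borel_measurable (borel \<Otimes>\<^sub>M std_gauss)"
        using fm measurable_cong_sets by (simp add: case_prod_eta) blast
    qed
    then show ?thesis using Um by (subst nn_integral_distr) auto
  qed
  also have "\<dots> = (\<integral>\<^sup>+p. f p \<partial>(distr M borel U \<Otimes>\<^sub>M std_gauss))"
  proof (rule SG.nn_integral_fst)
    have "sets (distr M borel U \<Otimes>\<^sub>M std_gauss) = sets ((borel :: (real \<times> (('d \<Rightarrow> nat) \<Rightarrow> real) \<times> (real ^ 'm ^ 'd)) measure) \<Otimes>\<^sub>M (borel :: ('m \<Rightarrow> real) measure))"
      by (intro sets_pair_measure_cong sets_std_gauss sets_distr)
    then show "f \<in> borel_measurable (distr M borel U \<Otimes>\<^sub>M std_gauss)"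
      using fm measurable_cong_sets by blast
  qed
  also have "\<dots> = (\<integral>\<^sup>+p. f p \<partial>distr M (borel \<Otimes>\<^sub>M borel) (\<lambda>\<omega>. (U \<omega>, G \<omega>)))"
    using ind unfolding lawG by simp
  also have "\<dots> = (\<integral>\<^sup>+\<omega>. f (U \<omega>, G \<omega>) \<partial>M)"
  proof (rule nn_integral_distr)
    have "(\<lambda>\<omega>. \<beta> t \<omega> - \<beta> s \<omega>) \<in> borel_measurable M"
      using beta_measurable st sT by (intro borel_measurable_diff) auto
    from measurable_compose[OF this hm] have "G \<in> borel_measurable M" by (simp add: G_def[abs_def])
    with Um show "(\<lambda>\<omega>. (U \<omega>, G \<omega>)) \<in> measurable M (borel \<Otimes>\<^sub>M borel)" by (rule measurable_Pair)
    show "f \<in> borel_measurable (distr M (borel \<Otimes>\<^sub>M borel) (\<lambda>\<omega>. (U \<omega>, G \<omega>)))" using fm by simp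
  qed
  finally show ?thesis by (simp add: f_def U_def G_def)
qed

text \<open>Suppose that the coefficients do not all vanish on an event \<open>A\<close> of positive probability. On \<open>A\<close>, the
polynomial recentred at a time \<open>s\<^sub>k < t\<close>, rescaled and normalised vanishes at \<open>Z\<^sub>k = (X\<^sub>t - X\<^bsub>s\<^sub>k\<^esub>) / \<surd>(t - s\<^sub>k)\<close>.
Replacing \<open>Z\<^sub>k\<close> by its Gaussian approximation \<open>V\<^sub>k\<close> costs little with probability close to one, yet the
mean at \<open>V\<^sub>k\<close> is at least \<open>\<kappa>\<close> times the probability of the part of \<open>A\<close> on which \<open>X\<^bsub>s\<^sub>k\<^esub>\<close> stays in a
fixed ball; the ball is there to keep the diffusion matrices in a compact set.\<close>

lemma increment_polynomial_relation_trivial: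
  assumes rt: "0 \<le> r" "r < t" "t \<le> T"
    and Q: "\<And>\<alpha>. \<alpha> \<in> exps N \<Longrightarrow> Q \<alpha> \<in> borel_measurable (F r)"
    and rel: "AE \<omega> in M. (\<Sum>\<alpha>\<in>exps N. Q \<alpha> \<omega> * monomial \<alpha> (X t \<omega> - X r \<omega>)) = 0"
  shows "AE \<omega> in M. \<forall>\<alpha>\<in>exps N. Q \<alpha> \<omega> = 0"
proof -
  define A where "A = {\<omega> \<in> space M. \<exists>\<alpha>\<in>exps N. Q \<alpha> \<omega> \<noteq> 0}"
  have AF: "A \<in> sets (F r)"
  proof -
    have "{\<omega> \<in> space (F r). \<exists>\<alpha>\<in>exps N. Q \<alpha> \<omega> \<noteq> 0} \<in> sets (F r)"
    proof (rule sets.sets_Collect_finite_Ex)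
      fix \<alpha> :: "'d \<Rightarrow> nat" assume "\<alpha> \<in> exps N"
      from Q[OF this] show "{\<omega> \<in> space (F r). Q \<alpha> \<omega> \<noteq> 0} \<in> sets (F r)" by measurable
    qed simp
    then show ?thesis by (simp add: A_def)
  qed
  have t0: "0 \<le> t" "r \<le> T" using rt by auto
  have AM: "A \<in> events" using AF sets_F_subset[OF t0(2)] by blast
  have "prob A = 0"
  proof (rule ccontr)
    assume "prob A \<noteq> 0"
    define q where "q = prob A"
    have q: "0 < q" using \<open>prob A \<noteq> 0\<close> by (simp add: q_def less_le)
    define s where "s k = t - (t - r) / (real k + 2)" for k
    have s: "r < s k" "0 \<le> s k" "s k < t" "s k \<le> T" for k
    proof -
      have "(t - r) * 1 < (t - r) * (real k + 2)" using rt by (intro mult_strict_left_mono) auto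
      then have "(t - r) / (real k + 2) < t - r" by (simp add: pos_divide_less_eq)
      moreover have "0 < (t - r) / (real k + 2)" using rt by (intro divide_pos_pos) auto
      ultimately show "r < s k" "0 \<le> s k" "s k < t" "s k \<le> T" using rt unfolding s_def by linarith+
    qed
    have slim: "s \<longlonglongrightarrow> t"
    proof -
      have "(\<lambda>k. t - (t - r) / (real k + 2)) \<longlonglongrightarrow> t - 0"
        using LIMSEQ_ignore_initial_segment[OF lim_const_over_n[of "t - r"], of 2]
        by (intro tendsto_diff tendsto_const) (simp add: add.commute)
      then show ?thesis by (simp add: s_def[abs_def])
    qed
    have \<delta>: "0 < sqrt (t - s k)" for k using s(3)[of k] by simp
    define c where "c k \<omega> = normalized N (recenter N (X (s k) \<omega> - X r \<omega>) (sqrt (t - s k)) (\<lambda>\<alpha>. Q \<alpha> \<omega>))" for k \<omega>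
    have cF: "c k \<in> borel_measurable (F (s k))" for k
    proof (rule measurable_coordinatewise_then_product)
      fix \<alpha> :: "'d \<Rightarrow> nat"
      have rs: "r \<le> s k" using s(1)[of k] by simp
      have vn: "(\<lambda>x :: real ^ 'd. x $ j) \<in> borel_measurable borel" for j by auto
      have Xi: "(\<lambda>\<omega>. (X (s k) \<omega> - X r \<omega>) $ i) \<in> borel_measurable (F (s k))" for i
        using X_meas_F[OF s(2,4)[of k]] measurable_F_mono[OF X_meas_F[OF rt(1) t0(2)] rs]
        by (intro measurable_compose[OF _ vn] borel_measurable_diff)
      have rec: "(\<lambda>\<omega>. recenter N (X (s k) \<omega> - X r \<omega>) (sqrt (t - s k)) (\<lambda>\<alpha>. Q \<alpha> \<omega>) \<beta>) \<in> borel_measurable (F (s k))" for \<beta>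
        unfolding recenter_def using measurable_F_mono[OF Q rs] Xi
        by (cases "\<beta> \<in> exps N")
           (auto intro!: borel_measurable_sum borel_measurable_times borel_measurable_prod borel_measurable_power)
      show "(\<lambda>\<omega>. c k \<omega> \<alpha>) \<in> borel_measurable (F (s k))"
      proof -
        have [measurable]: "(\<lambda>\<omega>. \<Sum>\<beta>\<in>exps N. \<bar>recenter N (X (s k) \<omega> - X r \<omega>) (sqrt (t - s k)) (\<lambda>\<alpha>. Q \<alpha> \<omega>) \<beta>\<bar>) \<in> borel_measurable (F (s k))"
          using rec by (intro borel_measurable_sum borel_measurable_abs)
        note rec[measurable]
        show ?thesis unfolding c_def normalized_def by measurable
      qed
    qed
    have csph: "c k \<omega> \<in> poly_sphere N" for k \<omega> by (simp add: c_def normalized_in_sphere)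
    define V where "V k \<omega> = mat_apply (\<sigma> (s k) (X (s k) \<omega>)) (\<lambda>j. (\<beta> t \<omega> $ j - \<beta> (s k) \<omega> $ j) / sqrt (t - s k))" for k \<omega>
    define Z where "Z k \<omega> = (1 / sqrt (t - s k)) *\<^sub>R (X t \<omega> - X (s k) \<omega>)" for k \<omega>
    have bumpZ: "AE \<omega> in M. \<omega> \<in> A \<longrightarrow> bump N (c k \<omega>) (Z k \<omega>) = 0" for k
      using rel
    proof eventually_elim
      case (elim \<omega>)
      show ?case
      proof
        assume "\<omega> \<in> A"
        then obtain \<alpha> where "\<alpha> \<in> exps N" "Q \<alpha> \<omega> \<noteq> 0" by (auto simp: A_def)
        then obtain \<beta> where \<beta>: "\<beta> \<in> exps N"
          "recenter N (X (s k) \<omega> - X r \<omega>) (sqrt (t - s k)) (\<lambda>\<alpha>. Q \<alpha> \<omega>) \<beta> \<noteq> 0"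
          using recenter_nonzero[of "sqrt (t - s k)" \<alpha> N "\<lambda>\<alpha>. Q \<alpha> \<omega>"] \<delta>[of k] by (metis less_irrefl)
        have re: "X (s k) \<omega> - X r \<omega> + sqrt (t - s k) *\<^sub>R Z k \<omega> = X t \<omega> - X r \<omega>"
          using \<delta>[of k] by (simp add: Z_def)
        have "poly_eval N (recenter N (X (s k) \<omega> - X r \<omega>) (sqrt (t - s k)) (\<lambda>\<alpha>. Q \<alpha> \<omega>)) (Z k \<omega>) = 0"
          unfolding poly_eval_recenter[symmetric] re using elim by (simp only: poly_eval_def)
        from poly_eval_normalized[OF this \<beta>] show "bump N (c k \<omega>) (Z k \<omega>) = 0"
          by (simp add: bump_def c_def)
      qed
    qed
    obtain R where R: "prob {\<omega> \<in> space M. R < norm (X t \<omega>)} < q / 4"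
    proof -
      have m: "{\<omega> \<in> space M. real n < norm (X t \<omega>)} \<in> events" for n
        using X_meas[OF t0(1) rt(3)] by measurable
      have "(\<lambda>n. prob {\<omega> \<in> space M. real n < norm (X t \<omega>)}) \<longlonglongrightarrow> 0"
      proof (rule prob_tendsto_zero_of_AE[OF m], rule AE_I2)
        fix \<omega>
        obtain n0 where "norm (X t \<omega>) < real n0" using reals_Archimedean2 by blast
        then show "\<forall>\<^sub>F n in sequentially. \<omega> \<notin> {\<omega> \<in> space M. real n < norm (X t \<omega>)}"
          by (intro eventually_sequentiallyI[of n0]) auto
      qed
      then have "\<forall>\<^sub>F n in sequentially. prob {\<omega> \<in> space M. real n < norm (X t \<omega>)} < q / 4"
        using q by (intro order_tendstoD(2)[of _ 0]) auto
      then show ?thesis using that by (auto simp: eventually_sequentially)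
    qed
    define Far where "Far k = {\<omega> \<in> space M. 1 < norm (X t \<omega> - X (s k) \<omega>)}" for k
    have FarM: "Far k \<in> events" for k
    proof -
      have [measurable]: "X t \<in> borel_measurable M" "X (s k) \<in> borel_measurable M"
        using X_meas t0 rt s(2,4) by auto
      show ?thesis unfolding Far_def by measurable
    qed
    have Far0: "(\<lambda>k. prob (Far k)) \<longlonglongrightarrow> 0"
    proof (rule prob_tendsto_zero_of_AE[OF FarM])
      show "AE \<omega> in M. \<forall>\<^sub>F k in sequentially. \<omega> \<notin> Far k"
        using X_cont
      proof eventually_elim
        case (elim \<omega>)
        have "(\<lambda>k. X (s k) \<omega>) \<longlonglongrightarrow> X t \<omega>"
          by (rule continuous_on_tendsto_compose[OF elim slim]) (use t0 rt s in auto)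
        then have "\<forall>\<^sub>F k in sequentially. dist (X (s k) \<omega>) (X t \<omega>) < 1" by (rule tendstoD) simp
        then show ?case by eventually_elim (auto simp: Far_def dist_norm norm_minus_commute)
      qed
    qed
    define A' where "A' k = A \<inter> {\<omega> \<in> space M. norm (X (s k) \<omega>) \<le> R + 1}" for k
    have A'F: "A' k \<in> sets (F (s k))" for k
    proof -
      have [measurable]: "X (s k) \<in> borel_measurable (F (s k))" using X_meas_F s(2,4) by blast
      have "{\<omega> \<in> space (F (s k)). norm (X (s k) \<omega>) \<le> R + 1} \<in> sets (F (s k))" by measurable
      moreover have "A \<in> sets (F (s k))" using AF sets_F_mono[of r "s k"] s(1)[of k] by auto
      ultimately show ?thesis unfolding A'_def by auto
    qed
    have A'M: "A' k \<in> events" for k using A'F sets_F_subset[OF s(4)] by blast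
    have A'prob: "\<forall>\<^sub>F k in sequentially. q / 2 < prob (A' k)"
    proof -
      have "\<forall>\<^sub>F k in sequentially. prob (Far k) < q / 4"
        using q by (intro order_tendstoD(2)[OF Far0]) auto
      then show ?thesis
      proof eventually_elim
        case (elim k)
        have mX: "{\<omega> \<in> space M. R < norm (X t \<omega>)} \<in> events" using X_meas[OF t0(1) rt(3)] by measurable
        have "A \<subseteq> A' k \<union> ({\<omega> \<in> space M. R < norm (X t \<omega>)} \<union> Far k)"
        proof
          fix \<omega> assume w: "\<omega> \<in> A"
          then have ws: "\<omega> \<in> space M" using AM sets.sets_into_space by blast
          show "\<omega> \<in> A' k \<union> ({\<omega> \<in> space M. R < norm (X t \<omega>)} \<union> Far k)"
            using w ws norm_triangle_ineq2[of "X (s k) \<omega>" "X t \<omega>"]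
            by (auto simp: A'_def Far_def not_less norm_minus_commute)
        qed
        then have "q \<le> prob (A' k \<union> ({\<omega> \<in> space M. R < norm (X t \<omega>)} \<union> Far k))"
          unfolding q_def using A'M mX FarM by (intro finite_measure_mono) auto
        also have "\<dots> \<le> prob (A' k) + (prob {\<omega> \<in> space M. R < norm (X t \<omega>)} + prob (Far k))"
          using A'M mX FarM
          by (intro order_trans[OF measure_Un_le] add_left_mono measure_Un_le) auto
        finally show ?case using R elim by linarith
      qed
    qed
    define K where "K = (\<lambda>p. \<sigma> (fst p) (snd p)) ` ({0..T} \<times> cball 0 (R + 1))"
    have "compact K"
      unfolding K_def
    proof (rule compact_continuous_image)
      show "continuous_on ({0..T} \<times> cball 0 (R + 1)) (\<lambda>p. \<sigma> (fst p) (snd p))"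
        using continuous_on_subset[OF \<sigma>_cont, of "{0..T} \<times> cball 0 (R + 1)"] by (auto simp: case_prod_unfold)
    qed (intro compact_Times compact_Icc compact_cball)
    moreover have "surj (mat_apply S)" if "S \<in> K" for S using that \<sigma>_surj by (auto simp: K_def)
    ultimately obtain \<kappa> where \<kappa>: "0 < \<kappa>"
      "\<And>(c :: ('d \<Rightarrow> nat) \<Rightarrow> real) S. c \<in> poly_sphere N \<Longrightarrow> S \<in> K \<Longrightarrow> \<kappa> \<le> gauss_mean N c S"
      using gauss_mean_bounded_below[of K N] by blast
    define \<eta> where "\<eta> = \<kappa> * q / 8"
    have \<eta>: "0 < \<eta>" using \<kappa> q by (simp add: \<eta>_def)
    obtain \<rho> where \<rho>: "0 < \<rho>" "\<And>(c :: ('d \<Rightarrow> nat) \<Rightarrow> real) z z'. c \<in> poly_sphere N \<Longrightarrow> norm (z - z') < \<rho> \<Longrightarrow>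
        \<bar>bump N c z - bump N c z'\<bar> < \<eta>"
      using bump_uniform[OF \<eta>] by blast
    define Bad where "Bad k = {\<omega> \<in> space M. \<rho> * sqrt (t - s k) \<le>
        norm (X t \<omega> - X (s k) \<omega> - \<sigma> (s k) (X (s k) \<omega>) *v (\<beta> t \<omega> - \<beta> (s k) \<omega>))}" for k
    have Bad0: "(\<lambda>k. prob (Bad k)) \<longlonglongrightarrow> 0"
      unfolding Bad_def by (rule euler_error_tendsto_zero[OF rt(3) s(2,3) slim \<rho>(1)])
    have BadM: "Bad k \<in> events" for k
    proof -
      have cmv: "continuous_on UNIV (\<lambda>p :: (real ^ 'm ^ 'd) \<times> (real ^ 'm). fst p *v snd p)"
        unfolding matrix_vector_mult_def by (intro continuous_on_vec_lambda continuous_intros)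
      have "(\<lambda>\<omega>. (\<sigma> (s k) (X (s k) \<omega>), \<beta> t \<omega> - \<beta> (s k) \<omega>)) \<in> borel_measurable M"
        using measurable_F_M[OF \<sigma>_meas_F[OF s(2,4)] s(4)] beta_measurable t0 rt s(2,4)
        by (intro borel_measurable_Pair borel_measurable_diff) auto
      from measurable_compose[OF this borel_measurable_continuous_onI[OF cmv]]
      have [measurable]: "(\<lambda>\<omega>. \<sigma> (s k) (X (s k) \<omega>) *v (\<beta> t \<omega> - \<beta> (s k) \<omega>)) \<in> borel_measurable M" by simp
      have [measurable]: "X t \<in> borel_measurable M" "X (s k) \<in> borel_measurable M"
        using X_meas t0 rt s(2,4) by auto
      show ?thesis unfolding Bad_def by measurable
    qed
    have ZV: "norm (V k \<omega> - Z k \<omega>) < \<rho>" if "\<omega> \<in> space M" "\<omega> \<notin> Bad k" for k \<omega>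
    proof -
      have "V k \<omega> = (1 / sqrt (t - s k)) *\<^sub>R (\<sigma> (s k) (X (s k) \<omega>) *v (\<beta> t \<omega> - \<beta> (s k) \<omega>))"
        unfolding V_def mat_apply_def matrix_vector_mult_def by (simp add: vec_eq_iff sum_divide_distrib)
      then have "V k \<omega> - Z k \<omega> = (- 1 / sqrt (t - s k)) *\<^sub>R
          (X t \<omega> - X (s k) \<omega> - \<sigma> (s k) (X (s k) \<omega>) *v (\<beta> t \<omega> - \<beta> (s k) \<omega>))"
        unfolding Z_def by (simp add: scaleR_right_diff_distrib)
      then have "norm (V k \<omega> - Z k \<omega>) = norm (X t \<omega> - X (s k) \<omega> - \<sigma> (s k) (X (s k) \<omega>) *v (\<beta> t \<omega> - \<beta> (s k) \<omega>)) / sqrt (t - s k)"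
        using \<delta>[of k] by simp
      also have "\<dots> < \<rho>" using that \<delta>[of k] by (simp add: Bad_def not_le pos_divide_less_eq)
      finally show ?thesis .
    qed
    have main: "\<kappa> * prob (A' k) \<le> \<eta> + prob (Bad k)" for k
    proof -
      have "ennreal (\<kappa> * prob (A' k)) \<le> (\<integral>\<^sup>+\<omega>. ennreal (indicator (A' k) \<omega> * bump N (c k \<omega>) (V k \<omega>)) \<partial>M)"
        unfolding V_def
      proof (rule gauss_mean_lower_bound[OF s(2,3) rt(3) cF A'F _ csph])
        fix \<omega> assume "\<omega> \<in> A' k"
        then show "\<kappa> \<le> gauss_mean N (c k \<omega>) (\<sigma> (s k) (X (s k) \<omega>))"
          using s(2,4)[of k] by (intro \<kappa> csph) (auto simp: K_def A'_def intro!: image_eqI[of _ _ "(s k, X (s k) \<omega>)"])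
      qed
      also have "\<dots> \<le> (\<integral>\<^sup>+\<omega>. ennreal (\<eta> + indicator (Bad k) \<omega>) \<partial>M)"
      proof (rule nn_integral_mono_AE)
        show "AE \<omega> in M. ennreal (indicator (A' k) \<omega> * bump N (c k \<omega>) (V k \<omega>)) \<le> ennreal (\<eta> + indicator (Bad k) \<omega>)"
          using bumpZ[of k] AE_space
        proof eventually_elim
          case (elim \<omega>)
          show ?case
          proof (rule ennreal_leI, cases "\<omega> \<in> A' k")
            case True
            then have z: "bump N (c k \<omega>) (Z k \<omega>) = 0" using elim by (simp add: A'_def)
            show "indicator (A' k) \<omega> * bump N (c k \<omega>) (V k \<omega>) \<le> \<eta> + indicator (Bad k) \<omega>"
            proof (cases "\<omega> \<in> Bad k")
              case True
              then show ?thesis using bump_le_one[OF csph, of k \<omega> "V k \<omega>"] bump_nonneg[of N "c k \<omega>" "V k \<omega>"] \<eta>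
                by (simp add: indicator_def)
            next
              case False
              then show ?thesis using \<rho>(2)[OF csph[of k \<omega>] ZV[OF elim(2) False]] z \<eta>
                by (simp add: indicator_def abs_of_nonneg[OF bump_nonneg])
            qed
          qed (use \<eta> in \<open>simp add: indicator_def\<close>)
        qed
      qed
      also have "\<dots> = ennreal (\<eta> + prob (Bad k))"
      proof -
        have "(\<integral>\<^sup>+\<omega>. ennreal (\<eta> + indicator (Bad k) \<omega>) \<partial>M) = (\<integral>\<^sup>+\<omega>. ennreal \<eta> + indicator (Bad k) \<omega> \<partial>M)"
          using \<eta> by (intro nn_integral_cong) (simp add: indicator_def)
        also have "\<dots> = ennreal \<eta> + ennreal (prob (Bad k))"
          using BadM by (subst nn_integral_add) (auto simp: prob_space emeasure_eq_measure)
        finally show ?thesis using \<eta> by simp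
      qed
      finally show ?thesis using \<eta> by (subst (asm) ennreal_le_iff) auto
    qed
    have "\<forall>\<^sub>F k in sequentially. prob (Bad k) < \<eta>"
      using \<eta> by (intro order_tendstoD(2)[OF Bad0]) auto
    with A'prob have "\<forall>\<^sub>F k in sequentially. False"
    proof eventually_elim
      case (elim k)
      have "\<kappa> * (q / 2) < \<kappa> * prob (A' k)" using elim(1) \<kappa>(1) by simp
      also have "\<dots> \<le> \<eta> + prob (Bad k)" by (rule main)
      also have "\<dots> < 2 * \<eta>" using elim(2) by simp
      finally show ?case using \<kappa>(1) q by (simp add: \<eta>_def)
    qed
    then show False by simp
  qed
  then have "A \<in> null_sets M" using AM by (auto simp: null_sets_def emeasure_eq_measure)
  then have "AE \<omega> in M. \<omega> \<notin> A" by (rule AE_not_in)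
  then show ?thesis using AE_space by eventually_elim (auto simp: A_def)
qed

end

section \<open>The signature of a piecewise affine path\<close>

text \<open>On each tag interval \<open>K\<close>, replacing \<open>f\<close> by its value at the tag changes the integral of \<open>f h\<close> by at most
the oscillation of \<open>f\<close> on \<open>K\<close> times the bound of \<open>h\<close> times the length of \<open>K\<close>.\<close>

lemma has_rs_integral_of_density:
  fixes f g h :: "real \<Rightarrow> real"
  assumes f: "continuous_on {a..b} f"
    and fh: "(\<lambda>s. f s * h s) integrable_on {a..b}"
    and g: "\<And>u v. a \<le> u \<Longrightarrow> u \<le> v \<Longrightarrow> v \<le> b \<Longrightarrow> (h has_integral g v - g u) {u..v}"
    and C: "\<And>s. s \<in> {a..b} \<Longrightarrow> \<bar>h s\<bar> \<le> C"
    and ab: "a \<le> b"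
  shows "has_rs_integral f g a b (integral {a..b} (\<lambda>s. f s * h s))"
  unfolding has_rs_integral_def
proof (intro allI impI)
  fix \<epsilon> :: real assume \<epsilon>: "0 < \<epsilon>"
  have C0: "0 \<le> C" using C[of a] ab by fastforce
  define L where "L = (C + 1) * (b - a + 1)"
  have L: "0 < L" unfolding L_def using C0 ab by (intro mult_pos_pos) auto
  define e where "e = \<epsilon> / (2 * L)"
  have e: "0 < e" using \<epsilon> L by (simp add: e_def)
  have "uniformly_continuous_on {a..b} f" using f by (rule compact_uniformly_continuous) simp
  then obtain \<delta> where \<delta>: "0 < \<delta>" "\<And>x y. x \<in> {a..b} \<Longrightarrow> y \<in> {a..b} \<Longrightarrow> dist y x < \<delta> \<Longrightarrow> dist (f y) (f x) < e"
    unfolding uniformly_continuous_on_def using e by metis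
  show "\<exists>\<delta>>0. \<forall>p. p tagged_division_of {a..b} \<and> (\<lambda>x. ball x \<delta>) fine p \<longrightarrow>
      \<bar>(\<Sum>(x, K)\<in>p. f x * (g (Sup K) - g (Inf K))) - integral {a..b} (\<lambda>s. f s * h s)\<bar> < \<epsilon>"
  proof (intro exI[of _ \<delta>] conjI \<delta>(1) allI impI)
    fix p assume "p tagged_division_of {a..b} \<and> (\<lambda>x. ball x \<delta>) fine p"
    then have p: "p tagged_division_of cbox a b" and fine: "(\<lambda>x. ball x \<delta>) fine p" by auto
    have fhb: "(\<lambda>s. f s * h s) integrable_on cbox a b" using fh by simp
    have int_eq: "integral {a..b} (\<lambda>s. f s * h s) = (\<Sum>(x, K)\<in>p. integral K (\<lambda>s. f s * h s))"
      using integral_combine_tagged_division_topdown[OF fhb p] by simp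
    have piece: "\<bar>f x * (g (Sup K) - g (Inf K)) - integral K (\<lambda>s. f s * h s)\<bar> \<le> e * C * measure lborel K"
      if xK: "(x, K) \<in> p" for x K
    proof -
      obtain u v where K: "K = cbox u v" using tagged_division_ofD(4)[OF p xK] by blast
      have xin: "x \<in> K" and Ksub: "K \<subseteq> {a..b}"
        using tagged_division_ofD(2,3)[OF p xK] by auto
      have uv: "u \<le> v" using xin K by auto
      then have K': "K = {u..v}" and au: "a \<le> u" "v \<le> b" using K Ksub by auto
      have Kb: "K \<subseteq> ball x \<delta>" using fine xK by (auto simp: fine_def)
      have hg: "(h has_integral g v - g u) {u..v}" using g au uv by auto
      have fhK: "(\<lambda>s. f s * h s) integrable_on {u..v}"
        using integrable_subinterval_real[OF fh] au by auto
      have "((\<lambda>s. f x * h s - f s * h s) has_integral (f x * (g v - g u) - integral {u..v} (\<lambda>s. f s * h s))) (cbox u v)"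
        using has_integral_diff[OF has_integral_mult_right[OF hg, of "f x"] integrable_integral[OF fhK]] by simp
      then have "norm (f x * (g v - g u) - integral {u..v} (\<lambda>s. f s * h s)) \<le> e * C * measure lborel (cbox u v)"
      proof (rule has_integral_bound[rotated])
        show "0 \<le> e * C" using e C0 by simp
        fix s assume s: "s \<in> cbox u v"
        have "dist (f x) (f s) < e" using \<delta>(2)[of s x] s K' Ksub Kb xin by auto
        then have "\<bar>f x - f s\<bar> \<le> e" by (simp add: dist_real_def)
        moreover have "\<bar>h s\<bar> \<le> C" using C s K' Ksub by auto
        moreover have "f x * h s - f s * h s = (f x - f s) * h s" by (simp add: left_diff_distrib)
        ultimately show "norm (f x * h s - f s * h s) \<le> e * C"
          using e by (simp add: abs_mult mult_mono)
      qed
      then show ?thesis using uv by (simp add: K')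
    qed
    have fin: "finite p" using p by blast
    have "\<bar>(\<Sum>(x, K)\<in>p. f x * (g (Sup K) - g (Inf K))) - integral {a..b} (\<lambda>s. f s * h s)\<bar> =
        \<bar>\<Sum>(x, K)\<in>p. f x * (g (Sup K) - g (Inf K)) - integral K (\<lambda>s. f s * h s)\<bar>"
      unfolding int_eq by (simp add: sum_subtractf case_prod_unfold)
    also have "\<dots> \<le> (\<Sum>(x, K)\<in>p. e * C * measure lborel K)"
      by (rule order_trans[OF sum_abs]) (intro sum_mono, use piece in auto)
    also have "\<dots> = e * C * (b - a)"
      using additive_content_tagged_division[OF p] ab
      by (simp add: case_prod_unfold sum_distrib_left[symmetric])
    also have "\<dots> \<le> e * (C + 1) * (b - a + 1)"
      using e C0 ab by (intro mult_mono) auto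
    also have "\<dots> = e * L" by (simp add: L_def)
    also have "\<dots> = \<epsilon> / 2" using L by (simp add: e_def)
    also have "\<dots> < \<epsilon>" using \<epsilon> by simp
    finally show "\<bar>(\<Sum>(x, K)\<in>p. f x * (g (Sup K) - g (Inf K))) - integral {a..b} (\<lambda>s. f s * h s)\<bar> < \<epsilon>" .
  qed
qed

lemma has_rs_integral_unique:
  assumes "has_rs_integral f g a b I" "has_rs_integral f g a b J"
  shows "I = J"
proof (rule ccontr)
  assume "I \<noteq> J"
  then have e: "0 < \<bar>I - J\<bar> / 2" by simp
  obtain d1 where d1: "d1 > 0" "\<And>p. p tagged_division_of {a..b} \<Longrightarrow> (\<lambda>x. ball x d1) fine p \<Longrightarrow>
        \<bar>(\<Sum>(x, K)\<in>p. f x * (g (Sup K) - g (Inf K))) - I\<bar> < \<bar>I - J\<bar> / 2"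
    using assms(1)[unfolded has_rs_integral_def, THEN spec, THEN mp, OF e] by blast
  obtain d2 where d2: "d2 > 0" "\<And>p. p tagged_division_of {a..b} \<Longrightarrow> (\<lambda>x. ball x d2) fine p \<Longrightarrow>
        \<bar>(\<Sum>(x, K)\<in>p. f x * (g (Sup K) - g (Inf K))) - J\<bar> < \<bar>I - J\<bar> / 2"
    using assms(2)[unfolded has_rs_integral_def, THEN spec, THEN mp, OF e] by blast
  have "gauge (\<lambda>x :: real. ball x d1 \<inter> ball x d2)" using d1(1) d2(1) by (intro gauge_Int gauge_ball)
  then obtain p where "p tagged_division_of cbox a b" "(\<lambda>x. ball x d1 \<inter> ball x d2) fine p"
    by (rule fine_division_exists)
  then have p: "p tagged_division_of {a..b}" "(\<lambda>x. ball x d1) fine p" "(\<lambda>x. ball x d2) fine p"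
    by (simp_all add: fine_Int)
  show False using d1(2)[OF p(1,2)] d2(2)[OF p(1,3)] by (simp add: field_simps abs_if split: if_splits)
qed

lemma rs_integral_eq:
  assumes "has_rs_integral f g a b I" shows "rs_integral f g a b = I"
  unfolding rs_integral_def by (rule the_equality) (use assms has_rs_integral_unique in auto)

definition increment :: "(nat \<Rightarrow> real) \<Rightarrow> (real \<Rightarrow> real ^ 'd) \<Rightarrow> nat \<Rightarrow> 'd option \<Rightarrow> real" where
  "increment s x k i = time_augmented x i (s (Suc k)) - time_augmented x i (s k)"

locale piecewise_affine_path =
  fixes n :: nat and s :: "nat \<Rightarrow> real" and T :: real and x :: "real \<Rightarrow> real ^ 'd::finite"
  assumes diss: "dissection T n s"
    and pc: "piecewise_affine_interpolation n s x x"
begin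

lemma s0 [simp]: "s 0 = 0" and sn: "s n = T" and s_less: "k < n \<Longrightarrow> s k < s (Suc k)"
  using diss by (auto simp: dissection_def)

lemma s_mono: "i \<le> j \<Longrightarrow> j \<le> n \<Longrightarrow> s i \<le> s j"
proof (induction j)
  case (Suc j)
  then show ?case using s_less[of j] by (cases "i = Suc j") auto
qed simp

lemma s_range: "k \<le> n \<Longrightarrow> s k \<in> {0..T}"
  using s_mono[of 0 k] s_mono[of k n] sn by auto

definition knots :: "real set" where "knots = s ` {..n}"

lemma finite_knots: "finite knots" by (simp add: knots_def)

text \<open>A step function, with the value zero at the points of the dissection.\<close>

definition speed :: "'d option \<Rightarrow> real \<Rightarrow> real" where
  "speed i t = (\<Sum>k<n. indicator {s k<..<s (Suc k)} t * (increment s x k i / (s (Suc k) - s k)))"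

lemma speed_on_piece:
  assumes "k < n" "s k < t" "t < s (Suc k)"
  shows "speed i t = increment s x k i / (s (Suc k) - s k)"
proof -
  have "indicator {s k'<..<s (Suc k')} t = (if k' = k then 1 else (0 :: real))" if "k' < n" for k'
  proof (cases k' k rule: linorder_cases)
    case less
    then have "s (Suc k') \<le> s k" using s_mono[of "Suc k'" k] assms by auto
    then show ?thesis using assms less by (auto simp: indicator_def)
  next
    case greater
    then have "s (Suc k) \<le> s k'" using s_mono[of "Suc k" k'] that by auto
    then show ?thesis using assms greater by (auto simp: indicator_def)
  qed (use assms in auto)
  then have "speed i t = (\<Sum>k'<n. if k' = k then increment s x k i / (s (Suc k) - s k) else 0)"
    unfolding speed_def by (intro sum.cong) auto
  then show ?thesis using assms by simp
qed

lemma speed_bounded: "\<bar>speed i t\<bar> \<le> (\<Sum>k<n. \<bar>increment s x k i / (s (Suc k) - s k)\<bar>)"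
  unfolding speed_def
  by (rule order_trans[OF sum_abs]) (intro sum_mono, auto simp: indicator_def)

lemma in_piece:
  assumes "t \<in> {0..T}" "t \<notin> knots"
  obtains k where "k < n" "s k < t" "t < s (Suc k)"
proof -
  have "\<exists>k<m. s k < t \<and> t < s (Suc k)" if "m \<le> n" "t < s m" for m
    using that
  proof (induction m)
    case 0
    then show ?case using assms by auto
  next
    case (Suc m)
    have "t \<noteq> s m" using assms(2) Suc.prems by (auto simp: knots_def)
    then show ?case using Suc by (cases "t < s m") (auto simp: less_Suc_eq intro: exI[of _ m])
  qed
  from this[of n] assms sn have "\<exists>k<n. s k < t \<and> t < s (Suc k)"
    by (metis atLeastAtMost_iff atMost_iff image_eqI knots_def order_le_less order_refl)
  with that show thesis by blast
qed

lemma path_on_piece: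
  assumes k: "k < n" and t: "t \<in> {s k..s (Suc k)}"
  shows "time_augmented x i t = time_augmented x i (s k) + (t - s k) * (increment s x k i / (s (Suc k) - s k))"
proof (cases i)
  case None
  then show ?thesis using s_less[OF k] by (simp add: time_augmented_def increment_def)
next
  case (Some j)
  obtain p q where pq: "\<And>t. t \<in> {s k..s (Suc k)} \<Longrightarrow> x t = p + t *\<^sub>R q"
    using pc k unfolding piecewise_affine_interpolation_def by blast
  have "x (s k) = p + s k *\<^sub>R q" "x (s (Suc k)) = p + s (Suc k) *\<^sub>R q" "x t = p + t *\<^sub>R q"
    using pq t s_less[OF k] by auto
  then have "increment s x k i = (s (Suc k) - s k) * q $ j" "x t $ j = x (s k) $ j + (t - s k) * q $ j"
    by (simp_all add: Some increment_def time_augmented_def algebra_simps)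
  then show ?thesis using s_less[OF k] by (simp add: Some time_augmented_def)
qed

lemma path_continuous: "continuous_on {0..T} (time_augmented x i)"
proof (cases i)
  case None
  then show ?thesis by (simp add: time_augmented_def[abs_def] continuous_on_id)
next
  case (Some j)
  have "continuous_on {0..T} x" using pc sn by (simp add: piecewise_affine_interpolation_def)
  then show ?thesis using Some by (simp add: time_augmented_def[abs_def] continuous_intros)
qed

lemma path_derivative:
  assumes "t \<in> {0..T}" "t \<notin> knots"
  shows "(time_augmented x i has_vector_derivative speed i t) (at t)"
proof -
  obtain k where k: "k < n" "s k < t" "t < s (Suc k)" using in_piece[OF assms] .
  let ?c = "increment s x k i / (s (Suc k) - s k)"
  have "((\<lambda>t. time_augmented x i (s k) + (t - s k) * ?c) has_vector_derivative ?c) (at t)"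
    by (auto intro!: derivative_eq_intros)
  then have "(time_augmented x i has_vector_derivative ?c) (at t)"
  proof (rule has_vector_derivative_transform_within_open[where S = "{s k<..<s (Suc k)}"])
    show "time_augmented x i (s k) + (u - s k) * ?c = time_augmented x i u" if "u \<in> {s k<..<s (Suc k)}" for u
      using path_on_piece[OF k(1), of u i] that by simp
  qed (use k in auto)
  then show ?thesis by (simp only: speed_on_piece[OF k])
qed

lemma speed_has_integral:
  assumes "0 \<le> u" "u \<le> v" "v \<le> T"
  shows "(speed i has_integral time_augmented x i v - time_augmented x i u) {u..v}"
  by (rule fundamental_theorem_of_calculus_interior_strong[OF finite_knots assms(2)])
     (use assms in \<open>auto intro!: path_derivative continuous_on_subset[OF path_continuous]\<close>)

lemma continuous_times_speed_integrable:
  assumes "continuous_on {0..T} f" "0 \<le> u" "v \<le> T"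
  shows "(\<lambda>t. f t * speed i t) integrable_on {u..v}"
proof (cases "u \<le> v")
  case True
  have c: "continuous_on {u..v} f" using assms by (auto intro: continuous_on_subset)
  have "(\<lambda>t. f t * (indicator {s k<..<s (Suc k)} t * c)) integrable_on {u..v}" for k c
  proof -
    have "(\<lambda>t. f t * c) integrable_on {s k..s (Suc k)} \<inter> {u..v}"
    proof -
      have "{s k..s (Suc k)} \<inter> {u..v} = {max (s k) u..min (s (Suc k)) v}" by auto
      moreover have "(\<lambda>t. f t * c) integrable_on {max (s k) u..min (s (Suc k)) v}"
        by (intro integrable_continuous_interval continuous_intros continuous_on_subset[OF c]) auto
      ultimately show ?thesis by simp
    qed
    then have "(\<lambda>t. if t \<in> {s k..s (Suc k)} then f t * c else 0) integrable_on {u..v}"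
      by (subst integrable_restrict_Int)
    then show ?thesis
      by (rule integrable_spike_finite[of "{s k, s (Suc k)}", rotated 2]) (auto simp: indicator_def)
  qed
  then have "(\<lambda>t. \<Sum>k<n. f t * (indicator {s k<..<s (Suc k)} t * (increment s x k i / (s (Suc k) - s k)))) integrable_on {u..v}"
    by (intro integrable_sum finite_lessThan)
  then show ?thesis by (simp add: speed_def sum_distrib_left)
qed (simp add: integrable_on_empty)

lemma signature_step:
  assumes c: "continuous_on {0..T} (signature x w)" and t: "t \<in> {0..T}"
  shows "signature x (w @ [i]) t = integral {0..t} (\<lambda>u. signature x w u * speed i u)"
proof -
  have "has_rs_integral (signature x w) (time_augmented x i) 0 t (integral {0..t} (\<lambda>u. signature x w u * speed i u))"
  proof (rule has_rs_integral_of_density)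
    show "continuous_on {0..t} (signature x w)" by (rule continuous_on_subset[OF c]) (use t in auto)
    show "(\<lambda>u. signature x w u * speed i u) integrable_on {0..t}"
      using continuous_times_speed_integrable[OF c] t by auto
    show "(speed i has_integral time_augmented x i v - time_augmented x i u) {u..v}"
      if "0 \<le> u" "u \<le> v" "v \<le> t" for u v using speed_has_integral that t by auto
  qed (use speed_bounded t in auto)
  then show ?thesis by (simp add: rs_integral_eq)
qed

lemma signature_continuous: "continuous_on {0..T} (signature x w)"
proof (induction w rule: rev_induct)
  case Nil
  then show ?case by (simp add: continuous_on_const cong: continuous_on_cong)
next
  case (snoc i w)
  have "continuous_on {0..T} (\<lambda>t. integral {0..t} (\<lambda>u. signature x w u * speed i u))"
    by (rule indefinite_integral_continuous_1) (use continuous_times_speed_integrable[OF snoc] in auto)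
  then show ?case by (rule continuous_on_eq) (rule signature_step[OF snoc, symmetric])
qed

lemma signature_snoc:
  "t \<in> {0..T} \<Longrightarrow> signature x (w @ [i]) t = integral {0..t} (\<lambda>u. signature x w u * speed i u)"
  by (rule signature_step[OF signature_continuous])

lemma signature_zero: "w \<noteq> [] \<Longrightarrow> signature x w 0 = 0"
proof (cases w rule: rev_cases)
  case (snoc w' i)
  have "0 \<in> {0..T}" using s_range[of 0] by simp
  then show ?thesis using signature_snoc[of 0 w' i] snoc by simp
qed simp

lemma speed_continuous_at:
  assumes "t \<in> {0..T}" "t \<notin> knots"
  shows "continuous (at t) (speed i)"
proof -
  obtain k where k: "k < n" "s k < t" "t < s (Suc k)" using in_piece[OF assms] .
  have "\<forall>\<^sub>F u in at t. speed i u = speed i t"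
    using eventually_at_in_open'[of "{s k<..<s (Suc k)}" t] k
    by (auto elim!: eventually_mono simp: speed_on_piece[OF k] speed_on_piece[OF k(1)])
  then show ?thesis unfolding isCont_def using tendsto_eventually by blast
qed

lemma signature_derivative:
  assumes t: "t \<in> {0<..<T}" "t \<notin> knots"
  shows "(signature x (w @ [i]) has_vector_derivative signature x w t * speed i t) (at t)"
proof -
  have tc: "t \<in> {0..T}" using t by auto
  have cont: "continuous (at t) (\<lambda>u. signature x w u * speed i u)"
  proof (rule continuous_mult)
    show "continuous (at t) (signature x w)"
      using continuous_on_interior[OF signature_continuous] t by auto
    show "continuous (at t) (speed i)" by (rule speed_continuous_at[OF tc t(2)])
  qed
  have "((\<lambda>t. integral {0..t} (\<lambda>u. signature x w u * speed i u)) has_vector_derivative signature x w t * speed i t) (at t within {0..T} - {})"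
  proof (rule integral_has_vector_derivative_continuous_at[where S = "{}"])
    show "(\<lambda>u. signature x w u * speed i u) integrable_on {0..T}"
      using continuous_times_speed_integrable[OF signature_continuous] by auto
    show "continuous (at t within {0..T} - {}) (\<lambda>u. signature x w u * speed i u)"
      using cont continuous_at_imp_continuous_at_within by blast
  qed (use tc in auto)
  moreover have "at t within {0..T} - {} = at t" using t by (simp, intro at_within_interior) auto
  ultimately have "((\<lambda>t. integral {0..t} (\<lambda>u. signature x w u * speed i u)) has_vector_derivative signature x w t * speed i t) (at t)"
    by simp
  then show ?thesis
    by (rule has_vector_derivative_transform_within_open[where S = "{0<..<T}"]) (use t signature_snoc in auto)
qed

end

section \<open>The shuffle identity and Chen's relation\<close>

definition linear_extension :: "('d word \<Rightarrow> real) \<Rightarrow> ('d word \<Rightarrow>\<^sub>0 real) \<Rightarrow> real" where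
  "linear_extension f p = (\<Sum>u\<in>Poly_Mapping.keys p. Poly_Mapping.lookup p u * f u)"

lemma lookup_scaleR: "Poly_Mapping.lookup (c *\<^sub>R p) u = c *\<^sub>R Poly_Mapping.lookup p u"
  by (simp add: scaleR_poly_mapping_def Abs_poly_mapping_inverse[OF CollectI] finite_subset[OF _ finite_lookup])

lemma linear_extension_superset:
  assumes "finite A" "Poly_Mapping.keys p \<subseteq> A"
  shows "linear_extension f p = (\<Sum>u\<in>A. Poly_Mapping.lookup p u * f u)"
  unfolding linear_extension_def using assms
  by (intro sum.mono_neutral_left) (auto simp: in_keys_iff)

lemma linear_extension_add: "linear_extension f (p + q) = linear_extension f p + linear_extension f q"
proof -
  let ?A = "Poly_Mapping.keys p \<union> Poly_Mapping.keys q"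
  have "linear_extension f (p + q) = (\<Sum>u\<in>?A. Poly_Mapping.lookup (p + q) u * f u)"
    by (rule linear_extension_superset) (auto dest: subsetD[OF Poly_Mapping.keys_add])
  also have "\<dots> = (\<Sum>u\<in>?A. Poly_Mapping.lookup p u * f u) + (\<Sum>u\<in>?A. Poly_Mapping.lookup q u * f u)"
    by (simp add: lookup_add sum.distrib distrib_right)
  also have "\<dots> = linear_extension f p + linear_extension f q"
    by (subst (1 2) linear_extension_superset[symmetric]) auto
  finally show ?thesis .
qed

lemma linear_extension_scaleR: "linear_extension f (c *\<^sub>R p) = c * linear_extension f p"
proof -
  have "linear_extension f (c *\<^sub>R p) = (\<Sum>u\<in>Poly_Mapping.keys p. Poly_Mapping.lookup (c *\<^sub>R p) u * f u)"
    by (rule linear_extension_superset) (auto simp: in_keys_iff lookup_scaleR)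
  then show ?thesis by (simp add: lookup_scaleR linear_extension_def sum_distrib_left mult.assoc)
qed

lemma linear_extension_sum: "linear_extension f (\<Sum>i\<in>I. p i) = (\<Sum>i\<in>I. linear_extension f (p i))"
  by (induction I rule: infinite_finite_induct) (auto simp: linear_extension_add linear_extension_def[of f 0])

lemma linear_extension_formal [simp]: "linear_extension f (formal w) = f w"
  by (simp add: linear_extension_def formal_def)

lemma linear_extension_append_letter:
  "linear_extension f (append_letter p i) = linear_extension (\<lambda>u. f (u @ [i])) p"
  by (simp add: append_letter_def linear_extension_sum linear_extension_scaleR) (simp add: linear_extension_def)

context piecewise_affine_path
begin

text \<open>The uniqueness principle behind all identities for the signature below: both sides are continuous and
have the same derivative except at finitely many points.\<close>

lemma zero_derivative_off_knots:
  fixes f :: "real \<Rightarrow> real"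
  assumes "0 \<le> a" "a \<le> t" "t \<le> T" and c: "continuous_on {a..t} f"
    and d: "\<And>u. a < u \<Longrightarrow> u < t \<Longrightarrow> u \<notin> knots \<Longrightarrow> (f has_vector_derivative 0) (at u)"
  shows "f t = f a"
proof -
  have "((\<lambda>_. 0) has_integral (f t - f a)) {a..t}"
    by (rule fundamental_theorem_of_calculus_interior_strong[OF finite_knots assms(2) _ c]) (use d in auto)
  then have "f t - f a = 0" using has_integral_0 has_integral_unique by blast
  then show ?thesis by simp
qed

text \<open>Integration by parts: the product rule splits the derivative of the product as the recursion splits
the shuffle product.\<close>

lemma signature_shuffle:
  "t \<in> {0..T} \<Longrightarrow> signature x w t * signature x v t =
    linear_extension (\<lambda>u. signature x u t) (shuffle_product w v)"
proof (induction w v arbitrary: t rule: shuffle_product.induct)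
  case (3 w i v j)
  define f where "f t = signature x (w @ [i]) t * signature x (v @ [j]) t -
    (linear_extension (\<lambda>u. signature x (u @ [i]) t) (shuffle_product w (v @ [j])) +
     linear_extension (\<lambda>u. signature x (u @ [j]) t) (shuffle_product (w @ [i]) v))" for t
  have lin_cont: "continuous_on {0..T} (\<lambda>t. linear_extension (\<lambda>u. signature x (u @ [k]) t) p)" for k p
    unfolding linear_extension_def by (intro continuous_intros signature_continuous)
  have "f t = f 0"
  proof (rule zero_derivative_off_knots[where f = f and a = 0 and t = t])
    show "continuous_on {0..t} f"
    proof (rule continuous_on_subset)
      show "continuous_on {0..T} f"
        unfolding f_def by (intro continuous_intros lin_cont signature_continuous)
    qed (use 3(3) in auto)
    fix u assume u: "0 < u" "u < t" "u \<notin> knots"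
    then have uT: "u \<in> {0<..<T}" "u \<in> {0..T}" using 3(3) by auto
    have lin_deriv: "((\<lambda>t. linear_extension (\<lambda>r. signature x (r @ [k]) t) p) has_vector_derivative
        linear_extension (\<lambda>r. signature x r u) p * speed k u) (at u)" for k p
    proof -
      have "((\<lambda>t. \<Sum>r\<in>Poly_Mapping.keys p. Poly_Mapping.lookup p r * signature x (r @ [k]) t) has_vector_derivative
        (\<Sum>r\<in>Poly_Mapping.keys p. Poly_Mapping.lookup p r * (signature x r u * speed k u))) (at u)"
        by (intro has_vector_derivative_sum has_vector_derivative_mult_right signature_derivative uT u(3))
      then show ?thesis by (simp add: linear_extension_def sum_distrib_right mult.assoc)
    qed
    have "(f has_vector_derivative
        (signature x (w @ [i]) u * (signature x v u * speed j u) + signature x w u * speed i u * signature x (v @ [j]) u) -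
        (linear_extension (\<lambda>r. signature x r u) (shuffle_product w (v @ [j])) * speed i u +
         linear_extension (\<lambda>r. signature x r u) (shuffle_product (w @ [i]) v) * speed j u)) (at u)"
      unfolding f_def
      by (intro has_vector_derivative_diff has_vector_derivative_add has_vector_derivative_mult lin_deriv
          signature_derivative uT u(3))
    moreover have "(signature x (w @ [i]) u * (signature x v u * speed j u) + signature x w u * speed i u * signature x (v @ [j]) u) -
        (linear_extension (\<lambda>r. signature x r u) (shuffle_product w (v @ [j])) * speed i u +
         linear_extension (\<lambda>r. signature x r u) (shuffle_product (w @ [i]) v) * speed j u) = 0"
      unfolding 3(1)[OF uT(2), symmetric] 3(2)[OF uT(2), symmetric] by (simp add: algebra_simps)
    ultimately show "(f has_vector_derivative 0) (at u)" by metis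
  qed (use 3(3) in auto)
  moreover have "f 0 = 0"
    using signature_zero[of "r @ [k]" for r k] by (simp add: f_def linear_extension_def)
  ultimately have "f t = 0" by simp
  then show ?case by (simp add: f_def linear_extension_add linear_extension_append_letter del: signature.simps)
qed simp_all

text \<open>Chen's relation across one affine piece: as functions of the time spent on the piece, both sides solve
  the same linear differential equations, ordered by word length, with the same initial values.\<close>

lemma signature_across_piece:
  assumes k: "k < n"
  shows "signature x w (s (Suc k)) = (\<Sum>j\<le>length w. signature x (take j w) (s k) *
    (prod_list (map (increment s x k) (drop j w)) / fact (length w - j)))"
proof -
  define a where "a i = increment s x k i / (s (Suc k) - s k)" for i
  define R where "R w t = (\<Sum>j\<le>length w. signature x (take j w) (s k) *
    ((t - s k) ^ (length w - j) / fact (length w - j) * prod_list (map a (drop j w))))" for w t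
  have sk: "0 \<le> s k" "s k < s (Suc k)" "s (Suc k) \<le> T"
    using s_range[of k] s_range[of "Suc k"] s_less[OF k] k by auto
  have R_start: "R w (s k) = signature x w (s k)" for w
  proof -
    have "R w (s k) = (\<Sum>j\<le>length w. if j = length w then signature x w (s k) else 0)"
      unfolding R_def by (intro sum.cong) auto
    then show ?thesis by simp
  qed
  have R_snoc: "R (w @ [i]) t = (\<Sum>j\<le>length w. signature x (take j w) (s k) *
      ((t - s k) ^ Suc (length w - j) / fact (Suc (length w - j)) * prod_list (map a (drop j w)) * a i))
      + signature x (w @ [i]) (s k)" for w i t
  proof -
    have "R (w @ [i]) t = (\<Sum>j\<le>length w. signature x (take j (w @ [i])) (s k) *
      ((t - s k) ^ (Suc (length w) - j) / fact (Suc (length w) - j) * prod_list (map a (drop j (w @ [i])))))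
      + signature x (w @ [i]) (s k)"
      unfolding R_def by (simp del: signature.simps fact_Suc)
    also have "\<dots> = (\<Sum>j\<le>length w. signature x (take j w) (s k) *
      ((t - s k) ^ Suc (length w - j) / fact (Suc (length w - j)) * prod_list (map a (drop j w)) * a i))
      + signature x (w @ [i]) (s k)"
      by (intro arg_cong2[where f = "(+)"] sum.cong refl)
         (simp add: Suc_diff_le mult.assoc del: fact_Suc power_Suc)
    finally show ?thesis .
  qed
  have R_deriv: "((\<lambda>t. R (w @ [i]) t) has_vector_derivative R w u * a i) (at u)" for w i u
  proof -
    have "((\<lambda>t. (t - s k) ^ Suc m / fact (Suc m)) has_real_derivative (u - s k) ^ m / fact m) (at u)" for m
      by (rule derivative_eq_intros refl | simp)+
    then have d: "((\<lambda>t. (t - s k) ^ Suc m / fact (Suc m)) has_vector_derivative (u - s k) ^ m / fact m) (at u)" for m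
      by (simp only: has_real_derivative_iff_has_vector_derivative)
    have "((\<lambda>t. (\<Sum>j\<le>length w. signature x (take j w) (s k) *
      ((t - s k) ^ Suc (length w - j) / fact (Suc (length w - j)) * prod_list (map a (drop j w)) * a i))
      + signature x (w @ [i]) (s k)) has_vector_derivative ((\<Sum>j\<le>length w. signature x (take j w) (s k) *
      ((u - s k) ^ (length w - j) / fact (length w - j) * prod_list (map a (drop j w)) * a i)) + 0)) (at u)"
      by (intro has_vector_derivative_add has_vector_derivative_const has_vector_derivative_sum
          has_vector_derivative_mult_right has_vector_derivative_mult_left d)
    then show ?thesis unfolding R_snoc by (simp add: R_def sum_distrib_right mult.assoc)
  qed
  have "t \<in> {s k..s (Suc k)} \<Longrightarrow> signature x w t = R w t" for t
  proof (induction w arbitrary: t rule: rev_induct)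
    case Nil
    show ?case by (simp add: R_def)
  next
    case (snoc i w)
    have "signature x (w @ [i]) t - R (w @ [i]) t = signature x (w @ [i]) (s k) - R (w @ [i]) (s k)"
    proof (rule zero_derivative_off_knots[where f = "\<lambda>t. signature x (w @ [i]) t - R (w @ [i]) t"])
      have "continuous_on UNIV (R (w @ [i]))"
        using R_deriv[of w i] by (intro continuous_at_imp_continuous_on ballI has_vector_derivative_continuous) auto
      then show "continuous_on {s k..t} (\<lambda>t. signature x (w @ [i]) t - R (w @ [i]) t)"
        using snoc.prems sk
        by (intro continuous_on_diff continuous_on_subset[OF signature_continuous]) (auto intro: continuous_on_subset)
      fix u assume u: "s k < u" "u < t" "u \<notin> knots"
      then have uT: "u \<in> {0<..<T}" using sk snoc.prems by auto
      have "((\<lambda>t. signature x (w @ [i]) t - R (w @ [i]) t) has_vector_derivative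
          signature x w u * speed i u - R w u * a i) (at u)"
        by (intro has_vector_derivative_diff signature_derivative uT u(3) R_deriv)
      moreover have "signature x w u * speed i u - R w u * a i = 0"
        using snoc.IH[of u] speed_on_piece[OF k, of u i] u snoc.prems by (simp add: a_def)
      ultimately show "((\<lambda>t. signature x (w @ [i]) t - R (w @ [i]) t) has_vector_derivative 0) (at u)" by metis
    qed (use snoc.prems sk in auto)
    then show ?case using R_start[of "w @ [i]"] by simp
  qed
  then have "signature x w (s (Suc k)) = R w (s (Suc k))" using sk by simp
  moreover have "c ^ length v * prod_list (map a v) = prod_list (map (increment s x k) v)"
    if "c = s (Suc k) - s k" for c v
    using sk that by (induction v) (auto simp: a_def)
  ultimately show ?thesis
    unfolding R_def by (simp add: length_drop[symmetric] del: length_drop)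
qed

end

section \<open>Right quotients of linear functionals on words\<close>

lemma words_le_eq: "words_le N = {w. length w \<le> N}"
  by (auto simp: words_le_def words_def)

lemma finite_words_le [simp]: "finite (words_le N :: 'd::finite word set)"
proof -
  have "words_le N = {w :: 'd word. set w \<subseteq> UNIV \<and> length w \<le> N}" by (auto simp: words_le_eq)
  then show ?thesis using finite_lists_length_le[of "UNIV :: 'd option set" N] by simp
qed

lemma finite_words [simp]: "finite (words N :: 'd::finite word set)"
  by (rule finite_subset[OF _ finite_words_le[of N]]) (auto simp: words_le_eq words_def)

definition pairing :: "nat \<Rightarrow> ('d::finite word \<Rightarrow> real) \<Rightarrow> ('d word \<Rightarrow> real) \<Rightarrow> real" where
  "pairing N S c = (\<Sum>u\<in>words_le N. c u * S u)"

definition right_quotient :: "('d word \<Rightarrow> real) \<Rightarrow> 'd word \<Rightarrow> 'd word \<Rightarrow> real" where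
  "right_quotient c v u = c (u @ v)"

definition vanishes_above :: "nat \<Rightarrow> ('d word \<Rightarrow> real) \<Rightarrow> bool" where
  "vanishes_above N c \<longleftrightarrow> (\<forall>w. N < length w \<longrightarrow> c w = 0)"

lemma right_quotient_right_quotient:
  "right_quotient (right_quotient c v) w = right_quotient c (w @ v)"
  by (simp add: right_quotient_def fun_eq_iff)

lemma right_quotient_Nil [simp]: "right_quotient c [] = c"
  by (simp add: right_quotient_def fun_eq_iff)

lemma vanishes_above_right_quotient: "vanishes_above N c \<Longrightarrow> vanishes_above N (right_quotient c v)"
  by (simp add: vanishes_above_def right_quotient_def)

lemma right_quotient_long: "vanishes_above N c \<Longrightarrow> N < length v \<Longrightarrow> right_quotient c v = (\<lambda>_. 0)"
  by (simp add: vanishes_above_def right_quotient_def fun_eq_iff)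

lemma pairing_zero [simp]: "pairing N S (\<lambda>_. 0) = 0"
  by (simp add: pairing_def)

lemma pairing_linear: "pairing N S (\<lambda>u. \<Sum>i\<in>I. a i * f i u) = (\<Sum>i\<in>I. a i * pairing N S (f i))"
  unfolding pairing_def sum_distrib_right sum_distrib_left by (subst sum.swap) (simp add: mult.assoc)

lemma pairing_double_linear:
  "pairing N S (\<lambda>u. \<Sum>i\<in>I. \<Sum>j\<in>J. a i j * f i j u) = (\<Sum>i\<in>I. \<Sum>j\<in>J. a i j * pairing N S (f i j))"
  using pairing_linear[where I = I and a = "\<lambda>_. 1" and N = N and S = S and f = "\<lambda>i u. \<Sum>j\<in>J. a i j * f i j u"] by (simp add: pairing_linear)

text \<open>Splitting a word \<open>w\<close> after its first \<open>j\<close> letters is the same as choosing the pair of its factors.\<close>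

lemma pairing_deconcatenate:
  assumes c: "vanishes_above N c"
    and S': "\<And>w. S' w = (\<Sum>j\<le>length w. S (take j w) * g (drop j w))"
  shows "pairing N S' c = (\<Sum>v\<in>words_le N. g v * pairing N S (right_quotient c v))"
proof -
  let ?A = "SIGMA w:words_le N. {..length w}"
  let ?B = "{(v, u) \<in> words_le N \<times> words_le N. length u + length v \<le> N}"
  have "pairing N S' c = (\<Sum>w\<in>words_le N. \<Sum>j\<le>length w. c w * (S (take j w) * g (drop j w)))"
    by (simp add: pairing_def S' sum_distrib_left)
  also have "\<dots> = (\<Sum>(w, j)\<in>?A. c w * (S (take j w) * g (drop j w)))"
    by (rule sum.Sigma) auto
  also have "\<dots> = (\<Sum>(v, u)\<in>?B. g v * (c (u @ v) * S u))"
    by (rule sum.reindex_bij_witness[where i = "\<lambda>(v, u). (u @ v, length u)" and j = "\<lambda>(w, j). (drop j w, take j w)"])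
       (auto simp: words_le_eq)
  also have "\<dots> = (\<Sum>(v, u)\<in>words_le N \<times> words_le N. g v * (c (u @ v) * S u))"
    by (rule sum.mono_neutral_left)
       (auto, metis c[unfolded vanishes_above_def] length_append not_le)
  also have "\<dots> = (\<Sum>v\<in>words_le N. g v * pairing N S (right_quotient c v))"
    by (simp add: sum.cartesian_product[symmetric] pairing_def right_quotient_def sum_distrib_left)
  finally show ?thesis .
qed

lemma truncated_convolution:
  fixes A B f :: "nat \<Rightarrow> real"
  assumes "\<And>m. N < m \<Longrightarrow> f m = 0"
  shows "(\<Sum>a\<le>N. \<Sum>b\<le>N. A a * B b * f (a + b)) = (\<Sum>m\<le>N. (\<Sum>i\<le>m. A i * B (m - i)) * f m)"
proof -
  have "(\<Sum>a\<le>N. \<Sum>b\<le>N. A a * B b * f (a + b)) = (\<Sum>(a, b)\<in>{..N} \<times> {..N}. A a * B b * f (a + b))"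
    by (simp add: sum.cartesian_product)
  also have "\<dots> = (\<Sum>(a, b)\<in>{(a, b). a + b \<le> N}. A a * B b * f (a + b))"
    by (rule sum.mono_neutral_right) (auto, metis assms not_le)
  also have "\<dots> = (\<Sum>m\<le>N. \<Sum>i\<le>m. A i * B (m - i) * f (i + (m - i)))"
    by (rule sum.triangle_reindex_eq)
  finally show ?thesis by (simp add: sum_distrib_right)
qed

lemma exp_coefficients_add:
  fixes x y :: real
  shows "(\<Sum>i\<le>m. x ^ i / fact i * (y ^ (m - i) / fact (m - i))) = (x + y) ^ m / fact m"
proof -
  have "x ^ i / fact i * (y ^ (m - i) / fact (m - i)) = of_nat (m choose i) * x ^ i * y ^ (m - i) / fact m" if "i \<le> m" for i
    using binomial_fact[OF that, where 'a = real] by (simp add: field_simps)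
  then have "(\<Sum>i\<le>m. x ^ i / fact i * (y ^ (m - i) / fact (m - i))) = (\<Sum>i\<le>m. of_nat (m choose i) * x ^ i * y ^ (m - i) / fact m)"
    by (intro sum.cong) auto
  then show ?thesis by (simp add: binomial_ring sum_divide_distrib)
qed

text \<open>The coefficients of \<open>x\<close> times the mean of \<open>exp (y + \<theta> x)\<close> over \<open>\<theta> \<in> [0, 1]\<close>. They arise when a letter is
read at a uniformly distributed time in a piece of length \<open>x\<close> after a duration \<open>y\<close>.\<close>

lemma exp_coefficients_average:
  fixes x y :: real
  shows "x * (\<Sum>i\<le>m. x ^ i / fact (Suc i) * (y ^ (m - i) / fact (m - i))) =
    ((x + y) ^ Suc m - y ^ Suc m) / fact (Suc m)"
proof -
  have "(x + y) ^ Suc m / fact (Suc m) = (\<Sum>i\<le>Suc m. x ^ i / fact i * (y ^ (Suc m - i) / fact (Suc m - i)))"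
    by (rule exp_coefficients_add[symmetric])
  also have "\<dots> = y ^ Suc m / fact (Suc m) + (\<Sum>i\<le>m. x ^ Suc i / fact (Suc i) * (y ^ (m - i) / fact (m - i)))"
    by (subst sum.atMost_Suc_shift) simp
  also have "(\<Sum>i\<le>m. x ^ Suc i / fact (Suc i) * (y ^ (m - i) / fact (m - i))) =
      x * (\<Sum>i\<le>m. x ^ i / fact (Suc i) * (y ^ (m - i) / fact (m - i)))"
    unfolding sum_distrib_left by (intro sum.cong) (simp_all add: mult_ac)
  finally show ?thesis by (simp add: diff_divide_distrib)
qed

text \<open>A polynomial of degree at most \<open>N + 1\<close> with more than \<open>N + 1\<close> roots; as its constant term is zero, the
set \<open>Y\<close> may contain \<open>0\<close>.\<close>

lemma divided_power_sum_zero: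
  fixes a :: "nat \<Rightarrow> real"
  assumes "finite Y" "N + 2 \<le> card Y" and z: "\<And>y. y \<in> Y \<Longrightarrow> (\<Sum>m\<le>N. y ^ Suc m / fact (Suc m) * a m) = 0"
    and "m \<le> N"
  shows "a m = 0"
proof (rule ccontr)
  assume "a m \<noteq> 0"
  define c where "c i = (case i of 0 \<Rightarrow> 0 | Suc m \<Rightarrow> a m / fact (Suc m))" for i
  have eq: "(\<Sum>i\<le>Suc N. c i * y ^ i) = (\<Sum>m\<le>N. y ^ Suc m / fact (Suc m) * a m)" for y
    by (subst sum.atMost_Suc_shift) (simp add: c_def mult_ac)
  have "c (Suc m) \<noteq> 0" using \<open>a m \<noteq> 0\<close> by (simp add: c_def)
  with assms(4) have "\<exists>k. k \<le> Suc N \<and> c k \<noteq> 0" by (intro exI[of _ "Suc m"]) simp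
  from polyfun_rootbound[OF this]
  have r: "finite {y. (\<Sum>i\<le>Suc N. c i * y ^ i) = 0}" "card {y. (\<Sum>i\<le>Suc N. c i * y ^ i) = 0} \<le> Suc N"
    by auto
  have "Y \<subseteq> {y. (\<Sum>i\<le>Suc N. c i * y ^ i) = 0}" unfolding eq using z by blast
  then have "card Y \<le> Suc N" using card_mono[OF r(1)] r(2) order_trans by blast
  then show False using assms(2) by simp
qed

abbreviation zeros :: "nat \<Rightarrow> 'd word" where "zeros k \<equiv> replicate k None"

lemma count_list_replicate: "count_list (replicate k a) b = (if a = b then k else 0)"
  by (induction k) auto

text \<open>The exponent of the monomial to which a word contributes in Chen's relation.\<close>

definition content :: "'d word \<Rightarrow> 'd \<Rightarrow> nat" where
  "content w i = count_list w (Some i)"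

lemma content_zero_words:
  "{v \<in> words_le N. content v = (\<lambda>_. 0)} = zeros ` {..N}"
proof -
  have "v = zeros (length v)" if "content v = (\<lambda>_. 0)" for v :: "'d word"
  proof -
    have "Some i \<notin> set v" for i
      using fun_cong[OF that, of i] by (simp add: content_def count_list_0_iff)
    then have "\<forall>z\<in>set v. z = None" by (metis not_None_eq)
    then show ?thesis by (intro replicate_eqI) auto
  qed
  moreover have "content (zeros k :: 'd word) = (\<lambda>_. 0)" for k
    by (simp add: content_def fun_eq_iff count_list_0_iff)
  ultimately show ?thesis by (auto simp: words_le_eq image_iff)
qed

lemma content_unit_words:
  fixes i :: 'd
  shows "{v \<in> words_le N. content v = (\<lambda>l. if l = i then 1 else 0)} =
    (\<lambda>(p, q). zeros p @ Some i # zeros q) ` {(p, q). p + q < N}"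
proof -
  have "\<exists>p q. v = zeros p @ Some i # zeros q" if c: "content v = (\<lambda>l. if l = i then 1 else 0)" for v :: "'d word"
  proof -
    have "Some i \<in> set v" using fun_cong[OF c, of i] count_notin[of "Some i" v] by (auto simp: content_def)
    then obtain u w where v: "v = u @ Some i # w" by (meson split_list)
    have "count_list u (Some l) = 0 \<and> count_list w (Some l) = 0" for l
      using fun_cong[OF c, of l] unfolding v content_def by (auto split: if_splits)
    then have "Some l \<notin> set u \<union> set w" for l by (simp add: count_list_0_iff)
    then have "\<forall>z\<in>set u. z = None" "\<forall>z\<in>set w. z = None" by (metis UnCI not_None_eq)+
    then have "u = zeros (length u)" "w = zeros (length w)" by (auto intro: replicate_eqI)
    then show ?thesis using v by metis
  qed
  note decompose = this
  have unit: "content (zeros p @ Some i # zeros q) = (\<lambda>l. if l = i then 1 else 0)" for p q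
    by (auto simp: content_def fun_eq_iff count_list_0_iff)
  show ?thesis
  proof (intro set_eqI iffI)
    fix v :: "'d word" assume "v \<in> {v \<in> words_le N. content v = (\<lambda>l. if l = i then 1 else 0)}"
    then have v: "length v \<le> N" "content v = (\<lambda>l. if l = i then 1 else 0)" by (auto simp: words_le_eq)
    obtain p q where pq: "v = zeros p @ Some i # zeros q" using decompose[OF v(2)] by blast
    then have "(p, q) \<in> {(p, q). p + q < N}" using v(1) by simp
    then show "v \<in> (\<lambda>(p, q). zeros p @ Some i # zeros q) ` {(p, q). p + q < N}"
      using pq by (intro image_eqI[of _ _ "(p, q)"]) auto
  qed (use unit in \<open>auto simp: words_le_eq\<close>)
qed

lemma sum_content_zero:
  "(\<Sum>v\<in>{v \<in> words_le N. content v = (\<lambda>_. 0)}. f v) = (\<Sum>b\<le>N. f (zeros b))"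
  unfolding content_zero_words by (subst sum.reindex) (auto simp: inj_on_def)

lemma zeros_letter_zeros_inj:
  "zeros p @ Some i # zeros q = zeros p' @ Some i # zeros q' \<longleftrightarrow> p = p' \<and> q = q'"
proof
  assume eq: "zeros p @ Some i # zeros q = zeros p' @ Some i # zeros q'"
  have "length (takeWhile (\<lambda>z. z = None) (zeros p @ Some i # zeros q)) = p" for p q
    by (subst takeWhile_append2) auto
  with eq have "p = p'" by metis
  then show "p = p' \<and> q = q'" using eq by simp
qed simp

lemma sum_content_unit:
  assumes "\<And>v. N < length v \<Longrightarrow> f v = 0"
  shows "(\<Sum>v\<in>{v \<in> words_le N. content v = (\<lambda>l. if l = i then 1 else 0)}. f v) =
    (\<Sum>p\<le>N. \<Sum>q\<le>N. f (zeros p @ Some i # zeros q))"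
proof -
  have "(\<Sum>v\<in>{v \<in> words_le N. content v = (\<lambda>l. if l = i then 1 else 0)}. f v) =
      (\<Sum>(p, q)\<in>{(p, q). p + q < N}. f (zeros p @ Some i # zeros q))"
    unfolding content_unit_words
    by (subst sum.reindex) (auto simp: inj_on_def zeros_letter_zeros_inj case_prod_unfold intro!: sum.cong)
  also have "\<dots> = (\<Sum>(p, q)\<in>{..N} \<times> {..N}. f (zeros p @ Some i # zeros q))"
  proof (rule sum.mono_neutral_left)
    show "\<forall>x\<in>{..N} \<times> {..N} - {(p, q). p + q < N}. (case x of (p, q) \<Rightarrow> f (zeros p @ Some i # zeros q)) = 0"
      by (auto intro!: assms)
  qed auto
  finally show ?thesis by (simp add: sum.cartesian_product)
qed

lemma content_le_length: "content v i \<le> length v"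
  by (simp add: content_def count_le_length)

lemma prod_list_option:
  fixes f :: "'d::finite option \<Rightarrow> real"
  shows "prod_list (map f v) = f None ^ count_list v None * (\<Prod>i\<in>UNIV. f (Some i) ^ content v i)"
proof (induction v)
  case (Cons a v)
  show ?case
  proof (cases a)
    case None
    then show ?thesis using Cons by (simp add: content_def)
  next
    case (Some l)
    have "(\<Prod>i\<in>UNIV. f (Some i) ^ content (a # v) i) = (\<Prod>i\<in>UNIV. (if i = l then f (Some l) else 1) * f (Some i) ^ content v i)"
      by (intro prod.cong) (auto simp: content_def Some)
    then show ?thesis using Cons Some by (simp add: prod.distrib)
  qed
qed (simp add: content_def)

text \<open>Concatenating formally with the exponential of \<open>y\<close> times the letter \<open>0\<close>: the effect
  on a functional of letting time run for a duration \<open>y\<close> without any other motion.\<close>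

definition time_shift :: "nat \<Rightarrow> real \<Rightarrow> ('d word \<Rightarrow> real) \<Rightarrow> 'd word \<Rightarrow> real" where
  "time_shift N y c u = (\<Sum>b\<le>N. y ^ b / fact b * right_quotient c (zeros b) u)"

text \<open>The effect on a functional of reading the letter \<open>i\<close> once on a piece of duration \<open>y\<close>: the coefficient of
the \<open>i\<close>-th coordinate in the exponential of \<open>y\<close> times the letter \<open>0\<close> plus a combination of the others.\<close>

definition letter_shift :: "nat \<Rightarrow> real \<Rightarrow> 'd \<Rightarrow> ('d word \<Rightarrow> real) \<Rightarrow> 'd word \<Rightarrow> real" where
  "letter_shift N y i c u = (\<Sum>p\<le>N. \<Sum>q\<le>N. y ^ (p + q) / fact (Suc (p + q)) *
     right_quotient c (zeros p @ Some i # zeros q) u)"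

lemma vanishes_above_time_shift: "vanishes_above N c \<Longrightarrow> vanishes_above N (time_shift N y c)"
  by (auto simp: vanishes_above_def time_shift_def right_quotient_def intro!: sum.neutral)

lemma vanishes_above_letter_shift: "vanishes_above N c \<Longrightarrow> vanishes_above N (letter_shift N y i c)"
  by (auto simp: vanishes_above_def letter_shift_def right_quotient_def intro!: sum.neutral)

lemma time_shift_zero [simp]: "time_shift N 0 c = c"
proof
  fix u
  have "time_shift N 0 c u = (\<Sum>b\<le>N. if b = 0 then c u else 0)"
    unfolding time_shift_def by (intro sum.cong) (auto simp: right_quotient_def power_0_left)
  then show "time_shift N 0 c u = c u" by simp
qed

lemma time_shift_add:
  assumes "vanishes_above N c"
  shows "time_shift N x (time_shift N y c) = time_shift N (x + y) c"
proof
  fix u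
  have "time_shift N x (time_shift N y c) u =
      (\<Sum>a\<le>N. \<Sum>b\<le>N. x ^ a / fact a * (y ^ b / fact b) * c (u @ zeros (a + b)))"
    unfolding time_shift_def right_quotient_def
    by (simp add: sum_distrib_left replicate_add mult.assoc)
  also have "\<dots> = (\<Sum>m\<le>N. (\<Sum>i\<le>m. x ^ i / fact i * (y ^ (m - i) / fact (m - i))) * c (u @ zeros m))"
    by (rule truncated_convolution) (use assms in \<open>simp add: vanishes_above_def\<close>)
  also have "\<dots> = time_shift N (x + y) c u"
    by (simp only: exp_coefficients_add time_shift_def right_quotient_def)
  finally show "time_shift N x (time_shift N y c) u = time_shift N (x + y) c u" .
qed

lemma pairing_time_shift:
  "pairing N S (time_shift N y c) = (\<Sum>b\<le>N. y ^ b / fact b * pairing N S (right_quotient c (zeros b)))"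
  unfolding time_shift_def[abs_def] by (rule pairing_linear)

lemma pairing_letter_shift:
  "pairing N S (letter_shift N y i c) = (\<Sum>p\<le>N. \<Sum>q\<le>N. y ^ (p + q) / fact (Suc (p + q)) *
     pairing N S (right_quotient c (zeros p @ Some i # zeros q)))"
  unfolding letter_shift_def[abs_def] by (rule pairing_double_linear)

section \<open>Relations between signatures of the interpolated diffusion\<close>

locale interpolated_diffusion = diffusion M T \<beta> Y \<sigma> b X
  for M :: "'w measure" and T and \<beta> :: "real \<Rightarrow> 'w \<Rightarrow> real ^ 'm::finite" and Y :: "'w \<Rightarrow> real ^ 'd::finite"
    and \<sigma> b X +
  fixes n :: nat and s :: "nat \<Rightarrow> real" and x :: "'w \<Rightarrow> real \<Rightarrow> real ^ 'd" and N :: nat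
  assumes dissection: "dissection T n s"
    and interpolation: "\<And>\<omega>. \<omega> \<in> space M \<Longrightarrow> piecewise_affine_interpolation n s (\<lambda>t. X t \<omega>) (x \<omega>)"
begin

lemma path: "\<omega> \<in> space M \<Longrightarrow> piecewise_affine_path n s T (x \<omega>)"
  using interpolation[of \<omega>] dissection
  by unfold_locales (auto simp: piecewise_affine_interpolation_def)

lemma x_eq_X: "\<omega> \<in> space M \<Longrightarrow> k \<le> n \<Longrightarrow> x \<omega> (s k) = X (s k) \<omega>"
  using interpolation[of \<omega>] by (auto simp: piecewise_affine_interpolation_def)

lemma s_strict: "k < n \<Longrightarrow> s k < s (Suc k)" and s_zero: "s 0 = 0" and s_end: "s n = T"
  using dissection by (auto simp: dissection_def)

lemma s_less: "i < j \<Longrightarrow> j \<le> n \<Longrightarrow> s i < s j"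
  by (rule increasing_seq_less[of n s, OF s_strict])

lemma s_bounds: "k \<le> n \<Longrightarrow> 0 \<le> s k" "k \<le> n \<Longrightarrow> s k \<le> T"
  using s_less[of 0 k] s_less[of k n] s_zero s_end by (cases "k = 0"; cases "k = n"; force)+

definition S :: "nat \<Rightarrow> 'w \<Rightarrow> 'd word \<Rightarrow> real" where
  "S k \<omega> w = signature (x \<omega>) w (s k)"

lemma S_zero: "\<omega> \<in> space M \<Longrightarrow> S 0 \<omega> w = (if w = [] then 1 else 0)"
  using piecewise_affine_path.signature_zero[OF path, of \<omega> w] by (simp add: S_def s_zero)

lemma S_step:
  assumes "k < n" "\<omega> \<in> space M"
  shows "S (Suc k) \<omega> w = (\<Sum>j\<le>length w. S k \<omega> (take j w) *
    (prod_list (map (increment s (x \<omega>) k) (drop j w)) / fact (length (drop j w))))"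
  unfolding S_def by (subst piecewise_affine_path.signature_across_piece[OF path[OF assms(2)] assms(1)]) simp

lemma increment_None: "increment s (x \<omega>) k None = s (Suc k) - s k"
  by (simp add: increment_def time_augmented_def)

lemma increment_Some:
  "\<omega> \<in> space M \<Longrightarrow> k < n \<Longrightarrow> increment s (x \<omega>) k (Some i) = (X (s (Suc k)) \<omega> - X (s k) \<omega>) $ i"
  by (simp add: increment_def time_augmented_def x_eq_X)

lemma S_measurable: "k \<le> n \<Longrightarrow> (\<lambda>\<omega>. S k \<omega> w) \<in> borel_measurable (F (s k))"
proof (induction k arbitrary: w)
  case 0
  have "(\<lambda>\<omega>. if w = [] then 1 else 0 :: real) \<in> borel_measurable (F (s 0))" by simp
  then show ?case by (rule measurable_cong[THEN iffD1, rotated]) (simp add: S_zero)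
next
  case (Suc k)
  have k: "k < n" "s k \<le> s (Suc k)" using Suc.prems s_strict[of k] by auto
  note b = s_bounds[of k] s_bounds[of "Suc k"]
  have vn: "(\<lambda>x :: real ^ 'd. x $ j) \<in> borel_measurable borel" for j by auto
  have inc: "(\<lambda>\<omega>. increment s (x \<omega>) k i) \<in> borel_measurable (F (s (Suc k)))" for i
  proof (cases i)
    case None
    then show ?thesis by (simp add: increment_None)
  next
    case (Some j)
    have "(\<lambda>\<omega>. (X (s (Suc k)) \<omega> - X (s k) \<omega>) $ j) \<in> borel_measurable (F (s (Suc k)))"
      using X_meas_F[of "s (Suc k)"] measurable_F_mono[OF X_meas_F[of "s k"] k(2)] b k Suc.prems
      by (intro measurable_compose[OF _ vn] borel_measurable_diff) auto
    then show ?thesis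
      by (rule measurable_cong[THEN iffD1, rotated]) (simp add: Some increment_Some k)
  qed
  have prd: "(\<lambda>\<omega>. prod_list (map (increment s (x \<omega>) k) v)) \<in> borel_measurable (F (s (Suc k)))" for v
    by (induction v) (auto intro: inc borel_measurable_times)
  have "(\<lambda>\<omega>. \<Sum>j\<le>length w. S k \<omega> (take j w) *
    (prod_list (map (increment s (x \<omega>) k) (drop j w)) / fact (length (drop j w)))) \<in> borel_measurable (F (s (Suc k)))"
    using measurable_F_mono[OF Suc.IH k(2)] prd k(1)
    by (intro borel_measurable_sum borel_measurable_times borel_measurable_divide borel_measurable_const) auto
  then show ?case by (rule measurable_cong[THEN iffD1, rotated]) (simp add: S_step k)
qed

definition null :: "nat \<Rightarrow> ('d word \<Rightarrow> real) \<Rightarrow> bool" where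
  "null k c \<longleftrightarrow> (AE \<omega> in M. pairing N (S k \<omega>) c = 0)"

lemma null_zero_function: "null k (\<lambda>_. 0)"
  by (simp add: null_def)

text \<open>Chen's relation makes the pairing at the end of the piece a polynomial in the increment over the piece,
with coefficients known at its beginning; all of these vanish.\<close>

lemma null_peel:
  assumes k: "k < n" and c: "vanishes_above N c" and z: "null (Suc k) c" and \<alpha>: "\<alpha> \<in> exps N"
  shows "AE \<omega> in M. (\<Sum>v\<in>{v \<in> words_le N. content v = \<alpha>}.
    (s (Suc k) - s k) ^ count_list v None / fact (length v) * pairing N (S k \<omega>) (right_quotient c v)) = 0"
proof -
  define Q where "Q \<alpha> \<omega> = (\<Sum>v\<in>{v \<in> words_le N. content v = \<alpha>}.
    (s (Suc k) - s k) ^ count_list v None / fact (length v) * pairing N (S k \<omega>) (right_quotient c v))" for \<alpha> \<omega>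
  have "AE \<omega> in M. \<forall>\<alpha>\<in>exps N. Q \<alpha> \<omega> = 0"
  proof (rule increment_polynomial_relation_trivial)
    show "0 \<le> s k" "s k < s (Suc k)" "s (Suc k) \<le> T" using k s_bounds s_strict by auto
    show "Q \<alpha> \<in> borel_measurable (F (s k))" for \<alpha>
      unfolding Q_def pairing_def using S_measurable[of k] k
      by (intro borel_measurable_sum borel_measurable_times borel_measurable_const) auto
    show "AE \<omega> in M. (\<Sum>\<alpha>\<in>exps N. Q \<alpha> \<omega> * monomial \<alpha> (X (s (Suc k)) \<omega> - X (s k) \<omega>)) = 0"
      using z[unfolded null_def] AE_space
    proof eventually_elim
      case (elim \<omega>)
      let ?g = "\<lambda>v. prod_list (map (increment s (x \<omega>) k) v) / fact (length v)"
      let ?h = "\<lambda>v. ?g v * pairing N (S k \<omega>) (right_quotient c v)"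
      have "0 = (\<Sum>v\<in>words_le N. ?h v)"
        using elim pairing_deconcatenate[OF c, of "S (Suc k) \<omega>" "S k \<omega>" ?g] S_step[OF k elim(2)] by simp
      also have "\<dots> = (\<Sum>\<alpha>\<in>exps N. \<Sum>v\<in>{v \<in> words_le N. content v = \<alpha>}. ?h v)"
      proof (rule sum.group[symmetric])
        show "content ` words_le N \<subseteq> exps N"
          using content_le_length order_trans by (fastforce simp: exps_def words_le_eq)
      qed auto
      also have "\<dots> = (\<Sum>\<alpha>\<in>exps N. Q \<alpha> \<omega> * monomial \<alpha> (X (s (Suc k)) \<omega> - X (s k) \<omega>))"
        unfolding Q_def sum_distrib_right monomial_def
        using increment_Some[OF elim(2) k]
        by (intro sum.cong refl) (auto simp: prod_list_option increment_None)
      finally show ?case by simp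
    qed
  qed
  then show ?thesis by eventually_elim (use \<alpha> in \<open>auto simp: Q_def\<close>)
qed

lemma null_time_step:
  assumes k: "k < n" and c: "vanishes_above N c" and z: "null (Suc k) c"
  shows "null k (time_shift N (s (Suc k) - s k) c)"
proof -
  have "(\<lambda>_. 0) \<in> exps N" by (simp add: exps_def)
  from null_peel[OF k c z this] show ?thesis
    unfolding null_def by eventually_elim (simp add: sum_content_zero pairing_time_shift count_list_replicate)
qed

lemma null_letter_step:
  assumes k: "k < n" and c: "vanishes_above N c" and z: "null (Suc k) c" and N: "1 \<le> N"
  shows "null k (letter_shift N (s (Suc k) - s k) i c)"
proof -
  have "(\<lambda>l. if l = i then 1 else 0) \<in> exps N" using N by (simp add: exps_def)
  from null_peel[OF k c z this] show ?thesis
    unfolding null_def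
  proof eventually_elim
    case (elim \<omega>)
    have "(\<Sum>v\<in>{v \<in> words_le N. content v = (\<lambda>l. if l = i then 1 else 0)}.
      (s (Suc k) - s k) ^ count_list v None / fact (length v) * pairing N (S k \<omega>) (right_quotient c v)) =
      (\<Sum>p\<le>N. \<Sum>q\<le>N. (s (Suc k) - s k) ^ count_list (zeros p @ Some i # zeros q) None /
        fact (length (zeros p @ Some i # zeros q)) * pairing N (S k \<omega>) (right_quotient c (zeros p @ Some i # zeros q)))"
      by (rule sum_content_unit) (simp add: right_quotient_long[OF c])
    with elim show ?case
      by (simp add: pairing_letter_shift count_list_replicate del: fact_Suc)
  qed
qed

lemma null_time_shift:
  assumes "l \<le> k" "k \<le> n" and c: "vanishes_above N c" and "null k c"
  shows "null l (time_shift N (s k - s l) c)"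
  using assms(1)
proof (induction l rule: inc_induct)
  case base
  then show ?case using assms by simp
next
  case (step l)
  have "null l (time_shift N (s (Suc l) - s l) (time_shift N (s k - s (Suc l)) c))"
    by (rule null_time_step) (use step assms vanishes_above_time_shift in auto)
  then show ?case by (simp add: time_shift_add[OF c])
qed

text \<open>Closing the relation under appending zeros makes it hereditary: a relation for \<open>g\<cdot>0\<^sup>a\<close> at the end of a
piece involves only the \<open>g\<cdot>0\<^sup>b\<close> with \<open>b \<ge> a\<close> at its beginning.\<close>

definition null_zeros :: "nat \<Rightarrow> ('d word \<Rightarrow> real) \<Rightarrow> bool" where
  "null_zeros k g \<longleftrightarrow> (\<forall>a. null k (right_quotient g (zeros a)))"

lemma null_zeros_down:
  assumes k: "k < n" and g: "vanishes_above N g" and z: "null_zeros (Suc k) g"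
  shows "null_zeros k g"
  unfolding null_zeros_def
proof
  fix a
  show "null k (right_quotient g (zeros a))"
  proof (induction "Suc N - a" arbitrary: a rule: less_induct)
    case less
    show ?case
    proof (cases "a \<le> N")
      case False
      then show ?thesis using right_quotient_long[OF g, of "zeros a"] by (simp add: null_zero_function)
    next
      case True
      have IH: "null k (right_quotient g (zeros a'))" if "a < a'" for a'
        using that True by (intro less) auto
      have "null k (time_shift N (s (Suc k) - s k) (right_quotient g (zeros a)))"
        by (rule null_time_step[OF k vanishes_above_right_quotient[OF g]]) (use z in \<open>simp add: null_zeros_def\<close>)
      moreover have "AE \<omega> in M. \<forall>a'. a < a' \<longrightarrow> pairing N (S k \<omega>) (right_quotient g (zeros a')) = 0"
        using IH by (simp add: AE_all_countable null_def)
      ultimately show ?thesis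
        unfolding null_def
      proof eventually_elim
        case (elim \<omega>)
        have "0 = (\<Sum>b\<le>N. (s (Suc k) - s k) ^ b / fact b * pairing N (S k \<omega>) (right_quotient g (zeros (b + a))))"
          using elim(1) by (simp add: pairing_time_shift right_quotient_right_quotient replicate_add)
        also have "\<dots> = (\<Sum>b\<le>N. if b = 0 then pairing N (S k \<omega>) (right_quotient g (zeros a)) else 0)"
          by (intro sum.cong) (use elim(2) in auto)
        finally show ?case by simp
      qed
    qed
  qed
qed

lemma null_zeros_mono:
  assumes "l \<le> k" "k \<le> n" and g: "vanishes_above N g" and "null_zeros k g"
  shows "null_zeros l g"
  using assms(1)
proof (induction l rule: inc_induct)
  case (step l)
  then show ?case using null_zeros_down[OF _ g] assms(2) by simp
qed (use assms in simp)

text \<open>By downward induction on the number \<open>a\<close> of zeros after the letter. Reading the letter on the piece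
\<open>k\<close> and letting time run back from \<open>t\<^sub>k\<close> to \<open>t\<^sub>l\<close> gives a relation in which, by the induction hypothesis,
only the terms with \<open>a\<close> trailing zeros survive. Its coefficients are differences of divided powers of
\<open>t\<^bsub>k+1\<^esub> - t\<^sub>l\<close> and \<open>t\<^sub>k - t\<^sub>l\<close>, and summation over \<open>k\<close> turns them into the powers themselves.\<close>

lemma null_after_letter:
  assumes j: "l + N + 1 \<le> j" "j \<le> n" and g: "vanishes_above N g" and P: "null_zeros j g" and N: "1 \<le> N"
  shows "null l (right_quotient g (zeros p @ Some i # zeros a))"
proof (induction "Suc N - a" arbitrary: a p rule: less_induct)
  case less
  show ?case
  proof (cases "a \<le> N \<and> p \<le> N")
    case False
    then have "N < length (zeros p @ Some i # zeros a)" by auto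
    then show ?thesis using right_quotient_long[OF g] by (simp add: null_zero_function)
  next
    case True
    have IH: "null l (right_quotient g (zeros p' @ Some i # zeros a'))" if "a < a'" for a' p'
      using that True by (intro less) auto
    define H where "H \<omega> m a' = pairing N (S l \<omega>) (right_quotient g (zeros m @ Some i # zeros a'))" for \<omega> m a'
    have H_long: "H \<omega> m a' = 0" if "N \<le> m" for \<omega> m a'
      using right_quotient_long[OF g, of "zeros m @ Some i # zeros a'"] that by (simp add: H_def)
    have "null l (time_shift N (s k - s l) (letter_shift N (s (Suc k) - s k) i (right_quotient g (zeros a))))"
      if k: "l \<le> k" "k < j" for k
    proof (rule null_time_shift)
      have "null_zeros (Suc k) g" by (rule null_zeros_mono[OF _ j(2) g P]) (use k in simp)
      then show "null k (letter_shift N (s (Suc k) - s k) i (right_quotient g (zeros a)))"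
        using k j by (intro null_letter_step N vanishes_above_right_quotient g) (auto simp: null_zeros_def)
    qed (use k j g in \<open>auto intro: vanishes_above_letter_shift vanishes_above_right_quotient\<close>)
    then have "AE \<omega> in M. \<forall>k\<in>{l..<j}.
        pairing N (S l \<omega>) (time_shift N (s k - s l) (letter_shift N (s (Suc k) - s k) i (right_quotient g (zeros a)))) = 0"
      by (subst AE_ball_countable) (auto simp: null_def)
    moreover have "AE \<omega> in M. \<forall>p' a'. a < a' \<longrightarrow> H \<omega> p' a' = 0"
      using IH by (simp add: AE_all_countable null_def H_def)
    ultimately have "AE \<omega> in M. H \<omega> p a = 0"
    proof eventually_elim
      case (elim \<omega>)
      have diff: "(\<Sum>m\<le>N. ((s (Suc k) - s l) ^ Suc m / fact (Suc m) - (s k - s l) ^ Suc m / fact (Suc m)) * H \<omega> m a) = 0"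
        if k: "k \<in> {l..<j}" for k
      proof -
        define x y where "x = s (Suc k) - s k" and "y = s k - s l"
        have "0 = pairing N (S l \<omega>) (time_shift N y (letter_shift N x i (right_quotient g (zeros a))))"
          using elim(1) k by (simp add: x_def y_def)
        also have "\<dots> = (\<Sum>b\<le>N. y ^ b / fact b * (\<Sum>p\<le>N. \<Sum>q\<le>N. x ^ (p + q) / fact (Suc (p + q)) * H \<omega> (b + p) (q + a)))"
        proof -
          have "right_quotient (letter_shift N x i (right_quotient g (zeros a))) (zeros b) =
              (\<lambda>u. \<Sum>p\<le>N. \<Sum>q\<le>N. x ^ (p + q) / fact (Suc (p + q)) *
                 right_quotient g (zeros (b + p) @ Some i # zeros (q + a)) u)" for b
            by (simp add: fun_eq_iff letter_shift_def right_quotient_def replicate_add del: fact_Suc)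
          then show ?thesis
            unfolding pairing_time_shift by (simp only: pairing_double_linear H_def)
        qed
        also have "\<dots> = (\<Sum>b\<le>N. y ^ b / fact b * (\<Sum>p\<le>N. x ^ p / fact (Suc p) * H \<omega> (b + p) a))"
        proof -
          have "(\<Sum>q\<le>N. x ^ (p + q) / fact (Suc (p + q)) * H \<omega> (b + p) (q + a)) =
              (\<Sum>q\<le>N. if q = 0 then x ^ p / fact (Suc p) * H \<omega> (b + p) a else 0)" for b p
            by (intro sum.cong) (use elim(2) in auto)
          then show ?thesis by (simp del: fact_Suc)
        qed
        also have "\<dots> = (\<Sum>p\<le>N. \<Sum>b\<le>N. x ^ p / fact (Suc p) * (y ^ b / fact b) * H \<omega> (p + b) a)"
          by (subst sum.swap) (simp add: sum_distrib_left mult_ac add_ac del: fact_Suc)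
        also have "\<dots> = (\<Sum>m\<le>N. (\<Sum>i\<le>m. x ^ i / fact (Suc i) * (y ^ (m - i) / fact (m - i))) * H \<omega> m a)"
          by (rule truncated_convolution) (simp add: H_long)
        finally have "0 = x * (\<Sum>m\<le>N. (\<Sum>i\<le>m. x ^ i / fact (Suc i) * (y ^ (m - i) / fact (m - i))) * H \<omega> m a)"
          by simp
        also have "\<dots> = (\<Sum>m\<le>N. ((x + y) ^ Suc m / fact (Suc m) - y ^ Suc m / fact (Suc m)) * H \<omega> m a)"
          by (subst sum_distrib_left, intro sum.cong refl)
             (simp only: mult.assoc[symmetric] exp_coefficients_average diff_divide_distrib)
        finally show ?thesis by (simp add: x_def y_def)
      qed
      have tel: "(\<Sum>m\<le>N. (s k - s l) ^ Suc m / fact (Suc m) * H \<omega> m a) = 0" if "l \<le> k" "k \<le> j" for k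
        using that
      proof (induction k rule: dec_induct)
        case (step k)
        then have "(\<Sum>m\<le>N. (s (Suc k) - s l) ^ Suc m / fact (Suc m) * H \<omega> m a) =
            (\<Sum>m\<le>N. (s k - s l) ^ Suc m / fact (Suc m) * H \<omega> m a)"
          using diff[of k] by (simp add: left_diff_distrib sum_subtractf del: fact_Suc power_Suc)
        then show ?case using step by simp
      qed simp
      let ?Y = "(\<lambda>k. s k - s l) ` {l..j}"
      have inj: "inj_on (\<lambda>k. s k - s l) {l..j}"
      proof (rule inj_onI)
        fix k k' assume "k \<in> {l..j}" "k' \<in> {l..j}" "s k - s l = s k' - s l"
        then show "k = k'" using s_less[of k k'] s_less[of k' k] j(2) by (cases k k' rule: linorder_cases) auto
      qed
      show ?case
      proof (rule divided_power_sum_zero[where Y = ?Y and N = N and m = p and a = "\<lambda>m. H \<omega> m a"])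
        show "N + 2 \<le> card ?Y" using inj j(1) by (simp add: card_image)
        show "p \<le> N" using True by simp
        show "(\<Sum>m\<le>N. y ^ Suc m / fact (Suc m) * H \<omega> m a) = 0" if "y \<in> ?Y" for y
          using that tel by auto
      qed simp
    qed
    then show ?thesis by (simp add: null_def H_def)
  qed
qed

text \<open>Stripping the letters of a word from the right, each at the price of at most \<open>N + 1\<close> pieces, ends at time
\<open>0\<close>, where the signature is the indicator of the empty word.\<close>

lemma functional_zero:
  assumes c: "vanishes_above N c" and P: "null_zeros n c" and n: "N * (N + 1) \<le> n" and N: "1 \<le> N"
  shows "c = (\<lambda>_. 0)"
proof
  fix w
  show "c w = 0"
  proof (cases "length w \<le> N")
    case True
    have claim: "null_zeros (n - (N + 1) * length v) (right_quotient c v)" if "length v \<le> N" for v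
      using that
    proof (induction v)
      case Nil
      then show ?case using P by simp
    next
      case (Cons i v)
      let ?j = "n - (N + 1) * length v" and ?l = "n - (N + 1) * length (i # v)"
      have "(N + 1) * length (i # v) \<le> (N + 1) * N" using Cons.prems by (intro mult_le_mono2) simp
      then have lj: "?l + N + 1 \<le> ?j" using n by (simp add: algebra_simps)
      have g: "vanishes_above N (right_quotient c v)" by (rule vanishes_above_right_quotient[OF c])
      have IH: "null_zeros ?j (right_quotient c v)" using Cons by simp
      show ?case
      proof (cases i)
        case None
        have "null_zeros ?l (right_quotient c v)"
          by (rule null_zeros_mono[OF _ _ g IH]) (use lj in auto)
        then have "null ?l (right_quotient (right_quotient c v) (zeros (Suc a)))" for a
          unfolding null_zeros_def by blast
        moreover have "zeros (Suc a) @ v = zeros a @ None # v" for a by (induction a) auto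
        ultimately show ?thesis
          unfolding null_zeros_def None right_quotient_right_quotient by metis
      next
        case (Some l)
        show ?thesis
          unfolding null_zeros_def
        proof
          fix a
          have "null ?l (right_quotient (right_quotient c v) (zeros a @ Some l # zeros 0))"
            by (rule null_after_letter[OF lj _ g IH N]) simp
          then show "null ?l (right_quotient (right_quotient c (i # v)) (zeros a))"
            by (simp add: right_quotient_right_quotient Some)
        qed
      qed
    qed
    have "null_zeros 0 (right_quotient c w)"
      by (rule null_zeros_mono[OF _ _ vanishes_above_right_quotient[OF c] claim[OF True]]) auto
    then have "null 0 (right_quotient (right_quotient c w) (zeros 0))" unfolding null_zeros_def by blast
    then have "AE \<omega> in M. c w = 0"
      unfolding null_def using AE_space
    proof eventually_elim
      case (elim \<omega>)
      have "pairing N (S 0 \<omega>) (right_quotient c w) = (\<Sum>u\<in>(words_le N :: 'd word set). if u = [] then c w else 0)"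
        unfolding pairing_def using elim(2) by (intro sum.cong) (auto simp: S_zero right_quotient_def)
      also have "\<dots> = c w"
      proof -
        have "([] :: 'd word) \<in> words_le N" by (simp add: words_le_eq)
        then show ?thesis by simp
      qed
      finally show ?case using elim(1) by simp
    qed
    then show ?thesis by simp
  qed (use c in \<open>simp add: vanishes_above_def\<close>)
qed

text \<open>For such words all functionals \<open>c\<cdot>0\<^sup>a\<close> with \<open>a > 0\<close> are zero, so that the hereditary closure of the given
relation comes for free.\<close>

lemma signature_independent_not_ending_in_zero:
  assumes n: "N * (N + 1) \<le> n" and N: "1 \<le> N"
    and E: "\<And>w. w \<in> E \<Longrightarrow> length w \<le> N \<and> (w = [] \<or> last w \<noteq> None)"
  shows "ae_independent M (\<lambda>w \<omega>. signature (x \<omega>) w T) E"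
  unfolding ae_independent_def
proof (intro allI impI ballI)
  fix A c w
  assume A: "finite A \<and> A \<subseteq> E \<and> (AE \<omega> in M. (\<Sum>w\<in>A. c w * signature (x \<omega>) w T) = 0)" and w: "w \<in> A"
  define c' where "c' w = (if w \<in> A then c w else 0)" for w
  have "c' = (\<lambda>_. 0)"
  proof (rule functional_zero[OF _ _ n N])
    show "vanishes_above N c'" using A E by (force simp: vanishes_above_def c'_def)
    have "null n (right_quotient c' (zeros a))" for a
    proof (cases a)
      case 0
      have sub: "A \<subseteq> words_le N" using A E by (auto simp: words_le_eq)
      have "AE \<omega> in M. pairing N (S n \<omega>) c' = 0"
        using conjunct2[OF conjunct2[OF A]]
      proof eventually_elim
        case (elim \<omega>)
        have "pairing N (S n \<omega>) c' = (\<Sum>u\<in>A. c u * signature (x \<omega>) u T)"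
          unfolding pairing_def
          by (rule sum.mono_neutral_cong_right) (use sub in \<open>auto simp: c'_def S_def s_end\<close>)
        then show ?case using elim by simp
      qed
      then show ?thesis using 0 by (simp add: null_def)
    next
      case (Suc m)
      have "u @ zeros a \<notin> A" for u
      proof
        have snoc: "u @ zeros a = (u @ zeros m) @ [None]" using Suc by (simp add: replicate_append_same)
        assume "u @ zeros a \<in> A"
        then have "(u @ zeros m) @ [None] \<in> E" unfolding snoc using A by blast
        from E[OF this] show False by simp
      qed
      then have "right_quotient c' (zeros a) = (\<lambda>_. 0)" by (simp add: right_quotient_def c'_def fun_eq_iff)
      then show ?thesis by (simp add: null_zero_function)
    qed
    then show "null_zeros n c'" by (simp add: null_zeros_def)
  qed
  then show "c w = 0" using w by (metis c'_def)
qed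

end

section \<open>From independent words to arbitrary bases of words\<close>

lemma append_letter_keys: "Poly_Mapping.keys (append_letter p i) \<subseteq> (\<lambda>u. u @ [i]) ` Poly_Mapping.keys p"
proof -
  have "Poly_Mapping.keys (\<Sum>u\<in>A. c u *\<^sub>R formal (u @ [i])) \<subseteq> (\<lambda>u. u @ [i]) ` A" if "finite A" for A c
    using that
  proof (induction A rule: finite_induct)
    case (insert u A)
    have "Poly_Mapping.keys (c u *\<^sub>R formal (u @ [i])) \<subseteq> {u @ [i]}"
      by (auto simp: in_keys_iff lookup_scaleR formal_def lookup_single when_def split: if_splits)
    with insert.IH have "Poly_Mapping.keys (c u *\<^sub>R formal (u @ [i])) \<union>
        Poly_Mapping.keys (\<Sum>u\<in>A. c u *\<^sub>R formal (u @ [i])) \<subseteq> (\<lambda>u. u @ [i]) ` insert u A" by blast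
    then show ?case
      unfolding sum.insert[OF insert.hyps] by (rule order_trans[OF Poly_Mapping.keys_add])
  qed simp
  then show ?thesis unfolding append_letter_def by simp
qed

lemma shuffle_product_keys:
  "Poly_Mapping.keys (shuffle_product w v) \<subseteq> words (length w + length v)"
proof (induction w v rule: shuffle_product.induct)
  case (3 w i v j)
  have "Poly_Mapping.keys (append_letter (shuffle_product w (v @ [j])) i) \<subseteq> words (length (w @ [i]) + length (v @ [j]))"
    using append_letter_keys[of "shuffle_product w (v @ [j])" i] 3(1) by (fastforce simp: words_def)
  moreover have "Poly_Mapping.keys (append_letter (shuffle_product (w @ [i]) v) j) \<subseteq> words (length (w @ [i]) + length (v @ [j]))"
    using append_letter_keys[of "shuffle_product (w @ [i]) v" j] 3(2) by (fastforce simp: words_def)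
  ultimately show ?case
    unfolding shuffle_product.simps by (intro order_trans[OF Poly_Mapping.keys_add] Un_least)
qed (auto simp: formal_def words_def)

lemma poly_mapping_in_span:
  fixes p :: "'d word \<Rightarrow>\<^sub>0 real"
  assumes "Poly_Mapping.keys p \<subseteq> W"
  shows "p \<in> span (formal ` W)"
proof -
  have "p = (\<Sum>u\<in>Poly_Mapping.keys p. Poly_Mapping.lookup p u *\<^sub>R formal u)"
  proof (rule poly_mapping_eqI)
    fix w :: "'d word"
    have "Poly_Mapping.lookup (\<Sum>u\<in>A. c u *\<^sub>R formal u) w = (if w \<in> A then c w else 0)" if "finite A" for A c
      using that by (induction A rule: finite_induct)
        (auto simp: lookup_add lookup_scaleR formal_def lookup_single when_def)
    then show "Poly_Mapping.lookup p w =
        Poly_Mapping.lookup (\<Sum>u\<in>Poly_Mapping.keys p. Poly_Mapping.lookup p u *\<^sub>R formal u) w"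
      by (simp add: in_keys_iff)
  qed
  also have "\<dots> \<in> span (formal ` W)"
    using assms by (intro span_sum span_scale span_base) auto
  finally show ?thesis .
qed

text \<open>Padding with zeros on the right is a bijection, with stripping the trailing zeros as its inverse.\<close>

lemma card_words_not_ending_in_zero:
  "card {w \<in> words_le N. w = [] \<or> last w \<noteq> (None :: 'd::finite option)} = card (words N :: 'd word set)"
proof (rule bij_betw_same_card)
  define strip :: "'d word \<Rightarrow> 'd word" where "strip w = rev (dropWhile (\<lambda>z. z = None) (rev w))" for w
  have drop_zeros: "dropWhile (\<lambda>z. z = None) (zeros k @ u) = dropWhile (\<lambda>z. z = None) u" for k and u :: "'d word"
    by (induction k) auto
  have strip_append: "strip (w @ zeros k) = w" if "w = [] \<or> last w \<noteq> None" for w k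
  proof -
    have "strip (w @ zeros k) = rev (dropWhile (\<lambda>z. z = None) (rev w))"
      unfolding strip_def by (simp add: drop_zeros)
    also have "\<dots> = w" using that by (cases w rule: rev_cases) auto
    finally show ?thesis .
  qed
  have split: "w = strip w @ zeros (length w - length (strip w))" for w
  proof -
    have "rev w = takeWhile (\<lambda>z. z = None) (rev w) @ dropWhile (\<lambda>z. z = None) (rev w)" by simp
    then have "w = strip w @ rev (takeWhile (\<lambda>z. z = None) (rev w))"
      unfolding strip_def by (metis rev_append rev_rev_ident)
    moreover have "rev (takeWhile (\<lambda>z. z = None) (rev w)) = zeros (length (takeWhile (\<lambda>z. z = None) (rev w)))"
      by (intro replicate_eqI) (auto dest: set_takeWhileD)
    ultimately show ?thesis by (metis add_diff_cancel_left' length_append length_replicate)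
  qed
  have strip_last: "strip w = [] \<or> last (strip w) \<noteq> None" for w
  proof (cases "dropWhile (\<lambda>z. z = None) (rev w) = []")
    case False
    then show ?thesis
      using hd_dropWhile[OF False] by (simp only: strip_def last_rev not_False_eq_True simp_thms)
  qed (simp add: strip_def)
  have strip_length: "length (strip w) \<le> length w" for w
    using length_dropWhile_le[of "\<lambda>z. z = None" "rev w"] by (simp add: strip_def)
  show "bij_betw (\<lambda>w. w @ zeros (N - length w)) {w \<in> words_le N. w = [] \<or> last w \<noteq> (None :: 'd option)} (words N)"
  proof (rule bij_betw_byWitness[where f' = strip])
    show "\<forall>w\<in>words N. strip w @ zeros (N - length (strip w)) = w"
      using split by (auto simp: words_def)
    show "strip ` words N \<subseteq> {w \<in> words_le N. w = [] \<or> last w \<noteq> None}"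
      using strip_last strip_length by (auto simp: words_def words_le_eq)
  qed (auto simp: strip_append words_def words_le_eq)
qed

lemma family_independent_iff:
  fixes f :: "'i \<Rightarrow> 'v::real_vector"
  assumes I: "finite I"
  shows "inj_on f I \<and> independent (f ` I) \<longleftrightarrow> (\<forall>c. (\<Sum>i\<in>I. c i *\<^sub>R f i) = 0 \<longrightarrow> (\<forall>i\<in>I. c i = 0))"
proof
  assume ind: "inj_on f I \<and> independent (f ` I)"
  show "\<forall>c. (\<Sum>i\<in>I. c i *\<^sub>R f i) = 0 \<longrightarrow> (\<forall>i\<in>I. c i = 0)"
  proof (intro allI impI ballI)
    fix c i assume z: "(\<Sum>i\<in>I. c i *\<^sub>R f i) = 0" and i: "i \<in> I"
    have "(\<Sum>v\<in>f ` I. c (the_inv_into I f v) *\<^sub>R v) = (\<Sum>i\<in>I. c i *\<^sub>R f i)"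
      using ind by (subst sum.reindex) (auto simp: the_inv_into_f_f intro!: sum.cong)
    then have "c (the_inv_into I f (f i)) = 0"
      using independentD[of "f ` I" "f ` I" "\<lambda>v. c (the_inv_into I f v)" "f i"] ind I i z by auto
    then show "c i = 0" using ind i by (simp add: the_inv_into_f_f)
  qed
next
  assume ind: "\<forall>c. (\<Sum>i\<in>I. c i *\<^sub>R f i) = 0 \<longrightarrow> (\<forall>i\<in>I. c i = 0)"
  have inj: "inj_on f I"
  proof (rule inj_onI, rule ccontr)
    fix i j assume ij: "i \<in> I" "j \<in> I" "f i = f j" "i \<noteq> j"
    have "(\<Sum>k\<in>I. (if k = i then 1 else if k = j then -1 else 0) *\<^sub>R f k) =
        (\<Sum>k\<in>I. (if k = i then f i else 0) - (if k = j then f j else 0))"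
      by (intro sum.cong) (use ij in auto)
    also have "\<dots> = 0" using ij I by (simp add: sum_subtractf)
    finally have "\<forall>k\<in>I. (if k = i then 1 else if k = j then -1 else 0 :: real) = 0"
      using ind[THEN spec, of "\<lambda>k. if k = i then 1 else if k = j then -1 else 0"] by simp
    then show False using ij(1) by auto
  qed
  moreover have "independent (f ` I)"
  proof (rule independent_if_scalars_zero)
    fix c v assume z: "(\<Sum>v\<in>f ` I. c v *\<^sub>R v) = 0" and v: "v \<in> f ` I"
    have "(\<Sum>i\<in>I. c (f i) *\<^sub>R f i) = 0" using z inj by (simp add: sum.reindex)
    then show "c v = 0" using ind v by auto
  qed (use I in simp)
  ultimately show "inj_on f I \<and> independent (f ` I)" by simp
qed

lemma span_family_representation:
  assumes "finite I" "v \<in> span (f ` I)"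
  obtains c where "v = (\<Sum>i\<in>I. c i *\<^sub>R f i)"
proof -
  obtain c where c: "v = (\<Sum>u\<in>f ` I. c u *\<^sub>R u)"
    using assms span_finite[of "f ` I"] by auto
  have "\<exists>J\<subseteq>I. inj_on f J \<and> f ` I = f ` J" using subset_image_inj[of "f ` I" f I] by simp
  then obtain J where J: "J \<subseteq> I" "inj_on f J" "f ` J = f ` I" by metis
  have "(\<Sum>u\<in>f ` I. c u *\<^sub>R u) = (\<Sum>i\<in>J. c (f i) *\<^sub>R f i)"
    unfolding J(3)[symmetric] using J(2) by (simp add: sum.reindex)
  also have "\<dots> = (\<Sum>i\<in>I. (if i \<in> J then c (f i) else 0) *\<^sub>R f i)"
    by (rule sum.mono_neutral_cong_left) (use assms J in auto)
  finally show thesis using c by (intro that) (rule trans)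
qed

lemma independent_card_spans:
  fixes A B :: "'v::real_vector set"
  assumes "finite B" "independent A" "A \<subseteq> span B" "card B \<le> card A"
  shows "span B \<subseteq> span A"
proof (rule ccontr)
  assume "\<not> ?thesis"
  then obtain v where v: "v \<in> span B" "v \<notin> span A" by blast
  have "independent (insert v A)" by (rule independent_insertI[OF v(2) assms(2)])
  moreover have "insert v A \<subseteq> span B" using v assms(3) by simp
  ultimately have "finite (insert v A) \<and> card (insert v A) \<le> card B"
    by (rule independent_span_bound[OF assms(1)])
  moreover have "v \<notin> A" using v(2) span_base by blast
  ultimately show False using assms(4) by (auto simp: card_insert_if)
qed

lemma ae_spanI:
  assumes "Z \<in> borel_measurable M" "finite A" "A \<subseteq> I" "AE \<omega> in M. Z \<omega> = (\<Sum>i\<in>A. c i * f i \<omega>)"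
  shows "Z \<in> ae_span M f I"
  unfolding ae_span_def by (intro CollectI conjI exI[of _ A] exI[of _ c] assms)

lemma ae_spanE:
  assumes "Z \<in> ae_span M f I"
  obtains A c where "Z \<in> borel_measurable M" "finite A" "A \<subseteq> I" "AE \<omega> in M. Z \<omega> = (\<Sum>i\<in>A. c i * f i \<omega>)"
  using assms unfolding ae_span_def by (elim CollectE conjE exE) (rule that)

lemma ae_independentD:
  assumes "ae_independent M f I" "finite A" "A \<subseteq> I" "AE \<omega> in M. (\<Sum>i\<in>A. c i * f i \<omega>) = 0" "i \<in> A"
  shows "c i = 0"
  using assms(1)[unfolded ae_independent_def, THEN spec, of A, THEN spec, of c] assms(2-5) by blast

context interpolated_diffusion
begin

abbreviation Sig :: "'d word \<Rightarrow> 'w \<Rightarrow> real" where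
  "Sig w \<omega> \<equiv> signature (x \<omega>) w T"

definition shuffled :: "'d word \<Rightarrow> ('d word \<Rightarrow>\<^sub>0 real)" where
  "shuffled w = shuffle_product w (zeros (N - length w))"

lemma shuffled_in_span: "length w \<le> N \<Longrightarrow> shuffled w \<in> span (formal ` words N)"
  using shuffle_product_keys[of w "zeros (N - length w)"]
  by (intro poly_mapping_in_span) (simp add: shuffled_def)

lemma T_pos: "0 < n \<Longrightarrow> 0 < T"
  using s_less[of 0 n] s_zero s_end by simp

lemma signature_zeros: "\<omega> \<in> space M \<Longrightarrow> t \<in> {0..T} \<Longrightarrow> signature (x \<omega>) (zeros k) t = t ^ k / fact k"
proof (induction k arbitrary: t)
  case (Suc k)
  interpret p: piecewise_affine_path n s T "x \<omega>" by (rule path[OF Suc.prems(1)])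
  have "signature (x \<omega>) (zeros k @ [None]) t - t ^ Suc k / fact (Suc k) =
      signature (x \<omega>) (zeros k @ [None]) 0 - 0 ^ Suc k / fact (Suc k)"
  proof (rule p.zero_derivative_off_knots[where f = "\<lambda>t. signature (x \<omega>) (zeros k @ [None]) t - t ^ Suc k / fact (Suc k)"])
    show "continuous_on {0..t} (\<lambda>t. signature (x \<omega>) (zeros k @ [None]) t - t ^ Suc k / fact (Suc k))"
      using Suc.prems by (intro continuous_intros continuous_on_subset[OF p.signature_continuous]) auto
    fix u assume u: "0 < u" "u < t" "u \<notin> p.knots"
    then have uT: "u \<in> {0<..<T}" "u \<in> {0..T}" using Suc.prems by auto
    have "((\<lambda>t. t ^ Suc k / fact (Suc k)) has_real_derivative u ^ k / fact k) (at u)"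
      by (rule derivative_eq_intros refl | simp)+
    then have "((\<lambda>t. t ^ Suc k / fact (Suc k)) has_vector_derivative u ^ k / fact k) (at u)"
      by (simp only: has_real_derivative_iff_has_vector_derivative)
    from has_vector_derivative_diff[OF p.signature_derivative[OF uT(1) u(3), of "zeros k" None] this]
    have "((\<lambda>t. signature (x \<omega>) (zeros k @ [None]) t - t ^ Suc k / fact (Suc k)) has_vector_derivative
        signature (x \<omega>) (zeros k) u * p.speed None u - u ^ k / fact k) (at u)" .
    moreover have "p.speed None u = 1"
    proof -
      obtain j where j: "j < n" "s j < u" "u < s (Suc j)" using p.in_piece[OF uT(2) u(3)] .
      show ?thesis using s_strict[OF j(1)] by (simp add: p.speed_on_piece[OF j] increment_None)
    qed
    ultimately show "((\<lambda>t. signature (x \<omega>) (zeros k @ [None]) t - t ^ Suc k / fact (Suc k)) has_vector_derivative 0) (at u)"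
      using Suc.IH[OF Suc.prems(1) uT(2)] by simp
  qed (use Suc.prems in auto)
  moreover have "signature (x \<omega>) (zeros k @ [None]) 0 = 0" by (rule p.signature_zero) simp
  ultimately have "signature (x \<omega>) (zeros k @ [None]) t = t ^ Suc k / fact (Suc k)" by simp
  then show ?case by (simp add: replicate_append_same del: signature.simps fact_Suc)
qed simp

lemma linear_extension_shuffled:
  assumes "\<omega> \<in> space M"
  shows "linear_extension (\<lambda>u. Sig u \<omega>) (shuffled w) = T ^ (N - length w) / fact (N - length w) * Sig w \<omega>"
proof -
  have T: "T \<in> {0..T}" using s_bounds[of n] s_end by simp
  show ?thesis
    using piecewise_affine_path.signature_shuffle[OF path[OF assms] T, of w "zeros (N - length w)"]
      signature_zeros[OF assms T]
    by (simp add: shuffled_def mult.commute)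
qed

lemma Sig_measurable: "Sig w \<in> borel_measurable M"
  using measurable_F_M[OF S_measurable[of n w]] s_bounds[of n] by (simp add: S_def s_end)

text \<open>Shuffling with zeros maps the words \<open>E\<close> of length at most \<open>N\<close> that do not end in \<open>0\<close> to an independent
family, because the extension \<open>L\<close> of the signature, which multiplies by a positive constant there, is
independent on them. As there are as many of them as words of length \<open>N\<close>, they span, and \<open>L\<close> is
injective modulo null sets on the whole span of \<open>words N\<close>. Independence of the signatures of \<open>B\<close> and
representation of all others by them are then inherited from the formal basis.\<close>

lemma signature_basis:
  assumes n: "N * (N + 1) \<le> n" and N: "1 \<le> N" and B: "basis_of_words N B"
  shows "ae_basis M Sig B (ae_span M Sig (words_le N))"
proof -
  have T: "0 < T" using T_pos n N by (cases n) auto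
  define \<tau> where "\<tau> w = T ^ (N - length w) / fact (N - length w)" for w :: "'d word"
  have \<tau>: "\<tau> w > 0" for w using T by (simp add: \<tau>_def)
  define L where "L p \<omega> = linear_extension (\<lambda>u. Sig u \<omega>) p" for p \<omega>
  have L: "L (shuffled w) \<omega> = \<tau> w * Sig w \<omega>" if "\<omega> \<in> space M" for w \<omega>
    using linear_extension_shuffled[OF that] by (simp add: L_def \<tau>_def)
  have L_sum: "L (\<Sum>i\<in>I. c i *\<^sub>R p i) \<omega> = (\<Sum>i\<in>I. c i * L (p i) \<omega>)" for I c p \<omega>
    by (simp add: L_def linear_extension_sum linear_extension_scaleR)
  have Bsub: "B \<subseteq> words_le N" and Bind: "inj_on shuffled B \<and> independent (shuffled ` B)"
    and Bspan: "span (shuffled ` B) = span (formal ` words N)"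
    using B by (auto simp: basis_of_words_def family_basis_def shuffled_def[abs_def])
  have Bfin: "finite B" using Bsub finite_words_le by (rule finite_subset)
  define E where "E = {w \<in> words_le N. w = [] \<or> last w \<noteq> (None :: 'd option)}"
  have Efin: "finite E" by (simp add: E_def)
  have Eind: "ae_independent M Sig E"
    by (rule signature_independent_not_ending_in_zero[OF n N]) (auto simp: E_def words_le_eq)
  have E_zero: "\<forall>w\<in>E. c w = 0" if "AE \<omega> in M. L (\<Sum>w\<in>E. c w *\<^sub>R shuffled w) \<omega> = 0" for c
  proof -
    have "AE \<omega> in M. (\<Sum>w\<in>E. (c w * \<tau> w) * Sig w \<omega>) = 0"
      using that AE_space by eventually_elim (simp add: L_sum L mult.assoc)
    from ae_independentD[OF Eind Efin order_refl this] have "c w * \<tau> w = 0" if "w \<in> E" for w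
      using that by simp
    moreover have "\<tau> w \<noteq> 0" for w using \<tau>[of w] by simp
    ultimately show ?thesis by (metis mult_eq_0_iff)
  qed
  have "\<forall>c. (\<Sum>w\<in>E. c w *\<^sub>R shuffled w) = 0 \<longrightarrow> (\<forall>w\<in>E. c w = 0)"
  proof (intro allI impI)
    fix c assume z: "(\<Sum>w\<in>E. c w *\<^sub>R shuffled w) = 0"
    show "\<forall>w\<in>E. c w = 0" by (rule E_zero) (simp add: z L_def linear_extension_def)
  qed
  then have Eform: "inj_on shuffled E" "independent (shuffled ` E)"
    using family_independent_iff[OF Efin, of shuffled] by blast+
  have "span (formal ` words N) \<subseteq> span (shuffled ` E)"
  proof (rule independent_card_spans)
    show "shuffled ` E \<subseteq> span (formal ` words N)"
      using shuffled_in_span by (auto simp: E_def words_le_eq)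
    have "card (formal ` (words N :: 'd word set)) \<le> card (words N :: 'd word set)" by (intro card_image_le) simp
    also have "\<dots> = card E" unfolding E_def by (rule card_words_not_ending_in_zero[symmetric])
    also have "\<dots> = card (shuffled ` E)" using Eform(1) by (simp add: card_image)
    finally show "card (formal ` (words N :: 'd word set)) \<le> card (shuffled ` E)" .
  qed (use Eform in auto)
  then have L_inj: "p = 0" if p: "p \<in> span (formal ` words N)" "AE \<omega> in M. L p \<omega> = 0" for p
  proof -
    have "p \<in> span (shuffled ` E)" using that \<open>span (formal ` words N) \<subseteq> span (shuffled ` E)\<close> by blast
    then obtain c where c: "p = (\<Sum>w\<in>E. c w *\<^sub>R shuffled w)" by (rule span_family_representation[OF Efin])
    then have "\<forall>w\<in>E. c w = 0" using E_zero p(2) by blast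
    then show ?thesis unfolding c by simp
  qed
  have ind: "ae_independent M Sig B"
    unfolding ae_independent_def
  proof (intro allI impI)
    fix A c assume A: "finite A \<and> A \<subseteq> B \<and> (AE \<omega> in M. (\<Sum>w\<in>A. c w * Sig w \<omega>) = 0)"
    define c' where "c' w = (if w \<in> A then c w / \<tau> w else 0)" for w
    let ?p = "\<Sum>w\<in>B. c' w *\<^sub>R shuffled w"
    have "?p \<in> span (formal ` words N)"
      using Bsub by (intro span_sum span_scale shuffled_in_span) (auto simp: words_le_eq)
    moreover have "AE \<omega> in M. L ?p \<omega> = 0"
      using conjunct2[OF conjunct2[OF A]] AE_space
    proof eventually_elim
      case (elim \<omega>)
      have "L ?p \<omega> = (\<Sum>w\<in>B. c' w * (\<tau> w * Sig w \<omega>))" by (simp add: L_sum L[OF elim(2)])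
      also have "\<dots> = (\<Sum>w\<in>A. c w * Sig w \<omega>)"
        by (rule sum.mono_neutral_cong_right) (use A Bfin \<tau> in \<open>auto simp: c'_def less_imp_neq[symmetric]\<close>)
      finally show ?case using elim by simp
    qed
    ultimately have "?p = 0" by (rule L_inj)
    then have z: "\<forall>w\<in>B. c' w = 0" using family_independent_iff[OF Bfin, of shuffled] Bind by blast
    show "\<forall>w\<in>A. c w = 0"
    proof
      fix w assume w: "w \<in> A"
      then have "c' w = 0" using z A by blast
      then have "c w / \<tau> w = 0" using w by (simp add: c'_def)
      then show "c w = 0" using \<tau>[of w] by simp
    qed
  qed
  have rep: "\<exists>d. \<forall>\<omega>\<in>space M. Sig w \<omega> = (\<Sum>v\<in>B. d v * Sig v \<omega>)" if w: "w \<in> words_le N" for w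
  proof -
    have "shuffled w \<in> span (shuffled ` B)" unfolding Bspan using w by (intro shuffled_in_span) (simp add: words_le_eq)
    then obtain d where d: "shuffled w = (\<Sum>v\<in>B. d v *\<^sub>R shuffled v)" by (rule span_family_representation[OF Bfin])
    have "Sig w \<omega> = (\<Sum>v\<in>B. (d v * \<tau> v / \<tau> w) * Sig v \<omega>)" if "\<omega> \<in> space M" for \<omega>
    proof -
      have "\<tau> w * Sig w \<omega> = (\<Sum>v\<in>B. d v * (\<tau> v * Sig v \<omega>))"
        unfolding L[OF that, symmetric] d L_sum ..
      then have "Sig w \<omega> = (\<Sum>v\<in>B. d v * (\<tau> v * Sig v \<omega>)) / \<tau> w"
        using \<tau>[of w] by (simp add: field_simps)
      then show ?thesis by (simp add: sum_divide_distrib mult.assoc)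
    qed
    then show ?thesis by (intro exI[of _ "\<lambda>v. d v * \<tau> v / \<tau> w"] ballI)
  qed
  have span_eq: "ae_span M Sig B = ae_span M Sig (words_le N)"
  proof
    show "ae_span M Sig B \<subseteq> ae_span M Sig (words_le N)"
    proof
      fix Z assume "Z \<in> ae_span M Sig B"
      then show "Z \<in> ae_span M Sig (words_le N)"
        by (elim ae_spanE, intro ae_spanI) (use Bsub in auto)
    qed
    show "ae_span M Sig (words_le N) \<subseteq> ae_span M Sig B"
    proof
      fix Z assume "Z \<in> ae_span M Sig (words_le N)"
      then obtain A c where Z: "Z \<in> borel_measurable M" and A: "finite A" "A \<subseteq> words_le N"
        and Zeq: "AE \<omega> in M. Z \<omega> = (\<Sum>w\<in>A. c w * Sig w \<omega>)"
        by (rule ae_spanE)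
      have "\<forall>w\<in>A. \<exists>d. \<forall>\<omega>\<in>space M. Sig w \<omega> = (\<Sum>v\<in>B. d v * Sig v \<omega>)" using rep A by blast
      from bchoice[OF this] obtain d where
        d: "\<And>w \<omega>. w \<in> A \<Longrightarrow> \<omega> \<in> space M \<Longrightarrow> Sig w \<omega> = (\<Sum>v\<in>B. d w v * Sig v \<omega>)" by blast
      have "AE \<omega> in M. Z \<omega> = (\<Sum>v\<in>B. (\<Sum>w\<in>A. c w * d w v) * Sig v \<omega>)"
        using Zeq AE_space
      proof eventually_elim
        case (elim \<omega>)
        have "Z \<omega> = (\<Sum>w\<in>A. c w * (\<Sum>v\<in>B. d w v * Sig v \<omega>))"
          unfolding elim(1) by (intro sum.cong refl) (simp add: d elim(2))
        then show ?case
          unfolding sum_distrib_left sum_distrib_right by (subst (asm) sum.swap) (simp add: mult.assoc)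
      qed
      then show "Z \<in> ae_span M Sig B" by (rule ae_spanI[OF Z Bfin order_refl])
    qed
  qed
  have "Sig w \<in> ae_span M Sig (words_le N)" if "w \<in> B" for w
    by (rule ae_spanI[of _ _ "{w}" _ "\<lambda>_. 1"]) (use Sig_measurable that Bsub in auto)
  then show ?thesis using ind span_eq by (simp add: ae_basis_def)
qed

end

lemma Ck_on_imp_continuous_on:
  assumes "Ck_on (Suc k) S f" shows "continuous_on S f"
proof -
  obtain f' where "\<forall>x\<in>S. (f has_derivative f' x) (at x within S)" using assms by auto
  then show ?thesis by (intro has_derivative_continuous_on) blast
qed

text \<open>Ellipticity makes the square matrix \<open>S S\<^sup>T\<close> injective, hence onto, and its range lies in that of \<open>S\<close>.\<close>

lemma elliptic_imp_surjective:
  fixes S :: "real ^ 'm ^ 'd"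
  assumes l: "0 < l" and ell: "\<And>\<xi>. l * (norm \<xi>)\<^sup>2 \<le> (\<xi> v* (S ** transpose S)) \<bullet> \<xi>"
  shows "surj (mat_apply S)"
proof -
  let ?A = "S ** transpose S"
  have tA: "transpose ?A = ?A" by (simp add: matrix_transpose_mul)
  have "inj ((*v) ?A)"
  proof (rule linear_injective_0[THEN iffD2, rule_format])
    fix \<xi> assume "?A *v \<xi> = 0"
    then have "\<xi> v* ?A = 0" using transpose_matrix_vector[of ?A \<xi>] tA by simp
    then have "l * (norm \<xi>)\<^sup>2 \<le> 0" using ell[of \<xi>] by simp
    then show "\<xi> = 0" using l by (simp add: mult_le_0_iff)
  qed (rule matrix_vector_mul_linear)
  then have surjA: "surj ((*v) ?A)" by (intro linear_injective_imp_surjective matrix_vector_mul_linear) auto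
  show ?thesis
    unfolding surj_def
  proof
    fix z
    obtain w where "?A *v w = z" using surjA by (metis surjD)
    then have "S *v (transpose S *v w) = z" by (simp only: matrix_vector_mul_assoc)
    then have "mat_apply S (\<lambda>j. (transpose S *v w) $ j) = z"
      by (simp add: mat_apply_def matrix_vector_mult_def)
    then show "\<exists>g. z = mat_apply S g" by blast
  qed
qed

theorem theorem5:
  fixes M :: "'w measure" and T :: real
    and \<beta> :: "real \<Rightarrow> 'w \<Rightarrow> real ^ 'm"
    and Y :: "'w \<Rightarrow> real ^ 'd"
    and X :: "real \<Rightarrow> 'w \<Rightarrow> real ^ 'd"
    and b :: "real \<Rightarrow> real ^ 'd \<Rightarrow> real ^ 'd"
    and \<sigma> :: "real \<Rightarrow> real ^ 'd \<Rightarrow> real ^ 'm ^ 'd"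
    and N :: nat and B :: "'d word set"
    and D :: "nat \<Rightarrow> nat \<Rightarrow> real"
    and Xn :: "nat \<Rightarrow> 'w \<Rightarrow> real \<Rightarrow> real ^ 'd"
  assumes "prob_space M" and "T > 0"
    and "brownian_motion M T \<beta>"
    and "Y \<in> borel_measurable M"
    and "prob_space.indep_set M
           (sets (vimage_algebra (space M) Y borel))
           (sets (vimage_algebra (space M) (\<lambda>\<omega>. \<lambda>t\<in>{0..T}. \<beta> t \<omega>)
             (PiM {0..T} (\<lambda>_. borel))))"
    and "Ck_on 3 ({0..T} \<times> UNIV) (\<lambda>(t, x). b t x)"
    and "Ck_on 4 ({0..T} \<times> UNIV) (\<lambda>(t, x). \<sigma> t x)"
    and "\<exists>K. \<forall>t\<in>{0..T}. \<forall>x. norm (b t x) \<le> K * (1 + norm x)"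
    and "\<exists>K. \<forall>t\<in>{0..T}. \<forall>x. norm (\<sigma> t x) \<le> K * (1 + norm x)"
    and "\<exists>l>0. \<forall>t\<in>{0..T}. \<forall>x \<xi>.
           (\<xi> v* (\<sigma> t x ** transpose (\<sigma> t x))) \<bullet> \<xi> \<ge> l * (norm \<xi>)\<^sup>2"
    and "sde_solution M T \<beta> Y \<sigma> b X"
    and "N \<ge> 1" and "basis_of_words N B"
    and "\<forall>n\<ge>1. dissection T n (D n)"
    and "(\<lambda>n. mesh n (D n)) \<longlonglongrightarrow> 0"
    and "\<forall>n\<ge>1. \<forall>\<omega>\<in>space M. piecewise_affine_interpolation n (D n) (\<lambda>t. X t \<omega>) (Xn n \<omega>)"
  shows "\<exists>n0. \<forall>n\<ge>n0.
           ae_basis M (\<lambda>w \<omega>. signature (Xn n \<omega>) w T) B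
             (ae_span M (\<lambda>w \<omega>. signature (Xn n \<omega>) w T) (words_le N))"
proof (intro exI[of _ "N * (N + 1)"] allI impI)
  fix n assume n: "N * (N + 1) \<le> n"
  then have n1: "1 \<le> n" using assms(12) by (cases n) auto
  obtain l where l: "0 < l" "\<And>t x \<xi>. t \<in> {0..T} \<Longrightarrow>
      l * (norm \<xi>)\<^sup>2 \<le> (\<xi> v* (\<sigma> t x ** transpose (\<sigma> t x))) \<bullet> \<xi>"
    using assms(10) by blast
  have b_cont: "continuous_on ({0..T} \<times> UNIV) (\<lambda>(t, x). b t x)"
    by (rule Ck_on_imp_continuous_on[of 2]) (use assms(6) in \<open>simp add: numeral_3_eq_3 numeral_2_eq_2\<close>)
  have \<sigma>_cont: "continuous_on ({0..T} \<times> UNIV) (\<lambda>(t, x). \<sigma> t x)"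
    by (rule Ck_on_imp_continuous_on[of 3]) (use assms(7) in \<open>simp add: eval_nat_numeral\<close>)
  interpret prob_space M by (rule assms(1))
  interpret brownian_with_initial M T \<beta> Y
    by unfold_locales (rule assms(3), rule assms(4), rule assms(5))
  have "surj (mat_apply (\<sigma> t x))" if "t \<in> {0..T}" for t x
    by (rule elliptic_imp_surjective[OF l(1) l(2)[OF that]])
  then interpret diffusion M T \<beta> Y \<sigma> b X
    by unfold_locales (rule \<sigma>_cont, rule b_cont, blast, rule assms(11))
  have "dissection T n (D n)" using assms(14) n1 by blast
  moreover have "piecewise_affine_interpolation n (D n) (\<lambda>t. X t \<omega>) (Xn n \<omega>)" if "\<omega> \<in> space M" for \<omega>
    using assms(16) n1 that by blast
  ultimately interpret interpolated_diffusion M T \<beta> Y \<sigma> b X n "D n" "Xn n" N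
    by unfold_locales
  show "ae_basis M (\<lambda>w \<omega>. signature (Xn n \<omega>) w T) B
      (ae_span M (\<lambda>w \<omega>. signature (Xn n \<omega>) w T) (words_le N))"
    by (rule signature_basis[OF n assms(12,13)])
qed

end
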